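(* Let $m$ be a positive even integer and let $1\le i\le m$. Let $\varphi: S^\bullet(S^m(E_i))\to\mathcal P^{m\bullet}(M(m,i))$ be the $GL(E_i)$-algebra homomorphism defined in the context. Then the restriction of $\varphi$ to $[S^i(S^m(E_i))]^{SL(E_i)}$ is nonzero if and only if the $GL(V_m)$-submodule $U_i$ of $S^i(S^m(V_m^* ))$ generated by $v_o^{\otimes i}$ intersects nontrivially the isotypic component $\mathcal I_{m\delta_i}$ of $S^i(S^m(V_m^* ))$ corresponding to the irreducible $GL(V_m)$-module $V_m(m\delta_i)^*$.
   Context: All vector spaces are complex. $S^k(W)$ is viewed as the subspace of symmetric tensors in $\otimes^kW$; $\mathcal P^k(W)$ is the space of homogeneous polynomial functions of degree $k$ on $W$. $V_m=\mathbb C^m$ has standard basis $v_1,\dots,v_m$ and dual basis $v_1^*,\dots,v_m^*$. Put $$v_o=\frac1{m!}\sum_{\sigma\in\mathfrak S_m}v^*_{\sigma(1)}\otimes\cdots\otimes v^*_{\sigma(m)}\in S^m(V_m^* ),$$ so that $v_o^{\otimes i}\in S^i(S^m(V_m^* ))$. $E_i$ is a vector space with basis $e_1,\dots,e_i$, identified with $V_i=\mathbb C^i$. $M(m,i)$ is the space of $m\times i$ complex matrices, identified with $V_m\otimes V_i^*$; $GL(m)\times GL(i)$ acts on it by $(g,h)\cdot X=gXh^{-1}$ and accordingly on polynomial functions. Definition of $\varphi$: on $S^m(E_i)$, $\varphi$ is the $GL(E_i)$-linear map sending $v\in S^m(V_i)$ to the polynomial function $X\mapsto\langle v_o\otimes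 v,X^{\otimes m}\rangle$ on $M(m,i)=V_m\otimes V_i^*$, where $v_o\otimes v\in(\otimes^mV_m^* )\otimes(\otimes^mV_i)=\otimes^m(V_m^*\otimes V_i)$. Equivalently, $\varphi(w^{\otimes m})(X)=\prod_{p=1}^m(Xw)_p$ for $w\in\mathbb C^i$. It is extended uniquely to an algebra homomorphism from the symmetric algebra $S^\bullet(S^m(E_i))$ to the algebra of polynomial functions on $M(m,i)$, mapping $S^j(S^m(E_i))$ into $\mathcal P^{mj}(M(m,i))$. $\delta_i$ is the partition $(1,\dots,1)$ with $i$ ones, $m\delta_i=(m,\dots,m)$ ($i$ parts), and $V_m(\mu)$ is the irreducible $GL(V_m)$-module with highest weight the partition $\mu$. *)

theory Defs
  imports
    "Jordan_Normal_Form.Determinant"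
    "HOL-Library.Function_Algebras"
    "HOL-Combinatorics.Permutations"
begin

section \<open>Tensors\<close>

text \<open>
  All vector spaces are subspaces of some function space \<open>'b \<Rightarrow> complex\<close>, where \<open>'b\<close> indexes
  coordinates. The tensor algebra over \<open>'b \<Rightarrow> complex\<close> lives in \<open>'b list \<Rightarrow> complex\<close>; a tensor of
  order \<open>k\<close> is supported on lists of length \<open>k\<close>. Hence \<open>S\<^sup>i(S\<^sup>m(W))\<close> with
  \<open>W \<subseteq> (nat \<Rightarrow> complex)\<close> is a subspace of \<open>nat list list \<Rightarrow> complex\<close>. Basis vectors are numbered
  from \<open>0\<close>.
\<close>

definition fscale :: "complex \<Rightarrow> ('b \<Rightarrow> complex) \<Rightarrow> 'b \<Rightarrow> complex" where
  "fscale c f = (\<lambda>x. c * f x)"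

global_interpretation fvs: vector_space fscale
  by unfold_locales (auto simp: fscale_def fun_eq_iff algebra_simps)

definition linear_map_on :: "('b \<Rightarrow> complex) set \<Rightarrow> (('b \<Rightarrow> complex) \<Rightarrow> 'c \<Rightarrow> complex) \<Rightarrow> bool" where
  "linear_map_on M T \<longleftrightarrow>
     (\<forall>x\<in>M. \<forall>y\<in>M. T (x + y) = T x + T y) \<and> (\<forall>c. \<forall>x\<in>M. T (fscale c x) = fscale c (T x))"

definition coord_space :: "nat \<Rightarrow> (nat \<Rightarrow> complex) set" where
  "coord_space n = {f. \<forall>k\<ge>n. f k = 0}"

definition basis_vec :: "nat \<Rightarrow> nat \<Rightarrow> complex" where
  "basis_vec j = (\<lambda>k. if k = j then 1 else 0)"

definition tensor :: "('b \<Rightarrow> complex) list \<Rightarrow> 'b list \<Rightarrow> complex" where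
  "tensor ws = (\<lambda>l. if length l = length ws then \<Prod>p<length ws. (ws ! p) (l ! p) else 0)"

definition tensor_power :: "nat \<Rightarrow> ('b \<Rightarrow> complex) set \<Rightarrow> ('b list \<Rightarrow> complex) set" where
  "tensor_power k W = fvs.span {tensor ws | ws. length ws = k \<and> set ws \<subseteq> W}"

definition sym_power :: "nat \<Rightarrow> ('b \<Rightarrow> complex) set \<Rightarrow> ('b list \<Rightarrow> complex) set" where
  "sym_power k W = {t \<in> tensor_power k W.
     \<forall>\<sigma> l. \<sigma> permutes {..<k} \<longrightarrow> length l = k \<longrightarrow> t (permute_list \<sigma> l) = t l}"

text \<open>
  The symmetric algebra is realised on symmetric tensors: the product of \<open>s\<close> and \<open>t\<close> is the
  symmetrisation of \<open>s \<otimes> t\<close>, so that the \<open>k\<close>-th power of \<open>w\<close> is \<open>w \<otimes> \<dots> \<otimes> w\<close>.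
\<close>

definition tensor_mult :: "('b list \<Rightarrow> complex) \<Rightarrow> ('b list \<Rightarrow> complex) \<Rightarrow> 'b list \<Rightarrow> complex" where
  "tensor_mult s t = (\<lambda>l. \<Sum>k\<le>length l. s (take k l) * t (drop k l))"

definition symmetrise :: "('b list \<Rightarrow> complex) \<Rightarrow> 'b list \<Rightarrow> complex" where
  "symmetrise t = (\<lambda>l. (\<Sum>\<sigma> | \<sigma> permutes {..<length l}. t (permute_list \<sigma> l)) / fact (length l))"

definition sym_mult :: "('b list \<Rightarrow> complex) \<Rightarrow> ('b list \<Rightarrow> complex) \<Rightarrow> 'b list \<Rightarrow> complex" where
  "sym_mult s t = symmetrise (tensor_mult s t)"

definition sym_algebra :: "('b \<Rightarrow> complex) set \<Rightarrow> ('b list \<Rightarrow> complex) set" where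
  "sym_algebra W = fvs.span (\<Union>k. sym_power k W)"

section \<open>Group actions\<close>

text \<open>
  A linear map of \<open>'b \<Rightarrow> complex\<close> is given by its matrix \<open>K :: 'b \<Rightarrow> 'b \<Rightarrow> complex\<close>, with respect to
  a finite set \<open>B\<close> of relevant indices. \<open>tensor_kernel K\<close> is the matrix of the tensor powers of
  that map (see \<open>kernel_map_tensor\<close> below).
\<close>

definition kernel_map :: "'b set \<Rightarrow> ('b \<Rightarrow> 'b \<Rightarrow> complex) \<Rightarrow> ('b \<Rightarrow> complex) \<Rightarrow> 'b \<Rightarrow> complex" where
  "kernel_map B K t = (\<lambda>a. \<Sum>b\<in>B. K a b * t b)"

definition mat_kernel :: "complex mat \<Rightarrow> nat \<Rightarrow> nat \<Rightarrow> complex" where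
  "mat_kernel A = (\<lambda>a b. if a < dim_row A \<and> b < dim_col A then A $$ (a, b) else 0)"

definition tensor_kernel :: "('a \<Rightarrow> 'b \<Rightarrow> complex) \<Rightarrow> 'a list \<Rightarrow> 'b list \<Rightarrow> complex" where
  "tensor_kernel K =
     (\<lambda>l l'. if length l = length l' then \<Prod>p<length l. K (l ! p) (l' ! p) else 0)"

definition tuples :: "nat \<Rightarrow> 'b set \<Rightarrow> 'b list set" where
  "tuples k B = {l. set l \<subseteq> B \<and> length l = k}"

definition vec_act :: "nat \<Rightarrow> complex mat \<Rightarrow> (nat \<Rightarrow> complex) \<Rightarrow> nat \<Rightarrow> complex" where
  "vec_act n g = kernel_map {..<n} (mat_kernel g)"

definition sym_sym_act ::
  "nat \<Rightarrow> nat \<Rightarrow> nat \<Rightarrow> complex mat \<Rightarrow> (nat list list \<Rightarrow> complex) \<Rightarrow> nat list list \<Rightarrow> complex" where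
  "sym_sym_act i m n g =
     kernel_map (tuples i (tuples m {..<n})) (tensor_kernel (tensor_kernel (mat_kernel g)))"

definition GL :: "nat \<Rightarrow> complex mat monoid" where
  "GL n = units_of (ring_mat TYPE(complex) n ())"

definition SL :: "nat \<Rightarrow> complex mat set" where
  "SL n = {g \<in> carrier_mat n n. det g = 1}"

text \<open>The action on a dual space, in coordinates with respect to the dual basis.\<close>

definition contragredient :: "nat \<Rightarrow> complex mat \<Rightarrow> complex mat" where
  "contragredient n g = transpose_mat (inv\<^bsub>GL n\<^esub> g)"

definition sym_sym_dual_act ::
  "nat \<Rightarrow> nat \<Rightarrow> nat \<Rightarrow> complex mat \<Rightarrow> (nat list list \<Rightarrow> complex) \<Rightarrow> nat list list \<Rightarrow> complex" where
  "sym_sym_dual_act i m n g = sym_sym_act i m n (contragredient n g)"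

section \<open>Modules\<close>

definition is_submodule ::
  "'g set \<Rightarrow> ('g \<Rightarrow> ('b \<Rightarrow> complex) \<Rightarrow> 'b \<Rightarrow> complex) \<Rightarrow> ('b \<Rightarrow> complex) set \<Rightarrow> ('b \<Rightarrow> complex) set \<Rightarrow> bool"
  where
  "is_submodule G act M U \<longleftrightarrow> U \<subseteq> M \<and> fvs.subspace U \<and> (\<forall>g\<in>G. \<forall>u\<in>U. act g u \<in> U)"

definition irreducible_module ::
  "'g set \<Rightarrow> ('g \<Rightarrow> ('b \<Rightarrow> complex) \<Rightarrow> 'b \<Rightarrow> complex) \<Rightarrow> ('b \<Rightarrow> complex) set \<Rightarrow> bool" where
  "irreducible_module G act M \<longleftrightarrow>
     is_submodule G act M M \<and> M \<noteq> {0} \<and> (\<forall>U. is_submodule G act M U \<longrightarrow> U = {0} \<or> U = M)"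

definition modules_isomorphic ::
  "'g set \<Rightarrow> ('g \<Rightarrow> ('b \<Rightarrow> complex) \<Rightarrow> 'b \<Rightarrow> complex) \<Rightarrow> ('b \<Rightarrow> complex) set
     \<Rightarrow> ('g \<Rightarrow> ('c \<Rightarrow> complex) \<Rightarrow> 'c \<Rightarrow> complex) \<Rightarrow> ('c \<Rightarrow> complex) set \<Rightarrow> bool" where
  "modules_isomorphic G act M act' M' \<longleftrightarrow>
     (\<exists>T. linear_map_on M T \<and> bij_betw T M M' \<and> (\<forall>g\<in>G. \<forall>x\<in>M. T (act g x) = act' g (T x)))"

text \<open>The isotypic component of \<open>M\<close> corresponding to the irreducible module \<open>N\<close>.\<close>

definition isotypic_component ::
  "'g set \<Rightarrow> ('g \<Rightarrow> ('b \<Rightarrow> complex) \<Rightarrow> 'b \<Rightarrow> complex) \<Rightarrow> ('b \<Rightarrow> complex) set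
     \<Rightarrow> ('g \<Rightarrow> ('c \<Rightarrow> complex) \<Rightarrow> 'c \<Rightarrow> complex) \<Rightarrow> ('c \<Rightarrow> complex) set \<Rightarrow> ('b \<Rightarrow> complex) set" where
  "isotypic_component G act M act' N =
     fvs.span (\<Union>{L. is_submodule G act M L \<and> modules_isomorphic G act' N act L})"

section \<open>Polynomial functions on matrices\<close>

text \<open>Functions on matrices are extended by \<open>0\<close> outside \<open>carrier_mat r c\<close>.\<close>

definition hom_poly_funs :: "nat \<Rightarrow> nat \<Rightarrow> nat \<Rightarrow> (complex mat \<Rightarrow> complex) set" where
  "hom_poly_funs r c k = fvs.span
     {\<lambda>X. if X \<in> carrier_mat r c then \<Prod>p\<leftarrow>ps. X $$ p else 0 |
        ps. length ps = k \<and> set ps \<subseteq> {..<r} \<times> {..<c}}"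

definition poly_funs :: "nat \<Rightarrow> nat \<Rightarrow> (complex mat \<Rightarrow> complex) set" where
  "poly_funs r c = fvs.span (\<Union>k. hom_poly_funs r c k)"

section \<open>Irreducible modules of the general linear group\<close>

text \<open>
  A finite-dimensional module is given as a matrix representation \<open>\<rho> : GL(n) \<rightarrow> GL(d)\<close>. Modules
  are rational: the matrix entries are polynomials in the entries of \<open>g\<close> and \<open>1 / det g\<close>.
\<close>

definition rational_rep :: "nat \<Rightarrow> nat \<Rightarrow> (complex mat \<Rightarrow> complex mat) \<Rightarrow> bool" where
  "rational_rep n d \<rho> \<longleftrightarrow> \<rho> \<in> hom (GL n) (GL d) \<and>
     (\<exists>N. \<forall>a<d. \<forall>b<d. \<exists>f\<in>poly_funs n n. \<forall>g\<in>carrier (GL n). det g ^ N * \<rho> g $$ (a, b) = f g)"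

definition partition_part :: "nat list \<Rightarrow> nat \<Rightarrow> nat" where
  "partition_part \<mu> j = (if j < length \<mu> then \<mu> ! j else 0)"

text \<open>
  A highest weight vector is an eigenvector of the Borel subgroup of upper triangular matrices
  \<open>b\<close>, with eigenvalue the product of the \<open>b\<^sub>j\<^sub>j\<close> to the power \<open>\<mu>\<^sub>j\<close>.
\<close>

definition has_highest_weight ::
  "nat \<Rightarrow> nat \<Rightarrow> (complex mat \<Rightarrow> complex mat) \<Rightarrow> nat list \<Rightarrow> bool" where
  "has_highest_weight n d \<rho> \<mu> \<longleftrightarrow>
     (\<exists>v\<in>coord_space d. v \<noteq> 0 \<and>
        (\<forall>b\<in>carrier (GL n). upper_triangular b \<longrightarrow>
           vec_act d (\<rho> b) v = fscale (\<Prod>j<n. b $$ (j, j) ^ partition_part \<mu> j) v))"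

definition is_irreducible_rep ::
  "nat \<Rightarrow> nat list \<Rightarrow> nat \<Rightarrow> (complex mat \<Rightarrow> complex mat) \<Rightarrow> bool" where
  "is_irreducible_rep n \<mu> d \<rho> \<longleftrightarrow>
     rational_rep n d \<rho> \<and>
     irreducible_module (carrier (GL n)) (\<lambda>g. vec_act d (\<rho> g)) (coord_space d) \<and>
     has_highest_weight n d \<rho> \<mu>"

definition dual_rep_act ::
  "nat \<Rightarrow> (complex mat \<Rightarrow> complex mat) \<Rightarrow> complex mat \<Rightarrow> (nat \<Rightarrow> complex) \<Rightarrow> nat \<Rightarrow> complex" where
  "dual_rep_act d \<rho> g = vec_act d (contragredient d (\<rho> g))"

section \<open>The tensor \<open>v\<^sub>o\<close> and the homomorphism \<open>\<phi>\<close>\<close>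

definition v_o :: "nat \<Rightarrow> nat list \<Rightarrow> complex" where
  "v_o m = fscale (1 / fact m)
     (\<Sum>\<sigma> | \<sigma> permutes {..<m}. tensor (map (\<lambda>p. basis_vec (\<sigma> p)) [0..<m]))"

text \<open>The function \<open>X \<mapsto> \<langle>v\<^sub>o \<otimes> v, X \<otimes> \<dots> \<otimes> X\<rangle>\<close> on \<open>m \<times> i\<close> matrices, in coordinates.\<close>

definition v_o_pairing :: "nat \<Rightarrow> nat \<Rightarrow> (nat list \<Rightarrow> complex) \<Rightarrow> complex mat \<Rightarrow> complex" where
  "v_o_pairing m i v = (\<lambda>X. if X \<in> carrier_mat m i then
     \<Sum>k\<in>tuples m {..<m}. \<Sum>l\<in>tuples m {..<i}. v_o m k * v l * tensor_kernel (mat_kernel X) k l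
     else 0)"

text \<open>
  \<open>\<phi>\<close> is a homomorphism of graded algebras; in degree one, where \<open>v\<close> is identified with the
  tensor \<open>[v]\<close> of order one, it is \<open>v_o_pairing\<close>. The unit of the target is the constant function
  \<open>1\<close> on \<open>carrier_mat m i\<close>.
\<close>

definition is_phi ::
  "nat \<Rightarrow> nat \<Rightarrow> ((nat list list \<Rightarrow> complex) \<Rightarrow> complex mat \<Rightarrow> complex) \<Rightarrow> bool" where
  "is_phi m i \<phi> \<longleftrightarrow>
     (let W = sym_power m (coord_space i) in
        linear_map_on (sym_algebra W) \<phi> \<and>
        \<phi> (tensor []) = (\<lambda>X. if X \<in> carrier_mat m i then 1 else 0) \<and>
        (\<forall>s\<in>sym_algebra W. \<forall>t\<in>sym_algebra W. \<phi> (sym_mult s t) = \<phi> s * \<phi> t) \<and>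
        (\<forall>j. \<forall>t\<in>sym_power j W. \<phi> t \<in> hom_poly_funs m i (m * j)) \<and>
        (\<forall>v\<in>W. \<phi> (tensor [v]) = v_o_pairing m i v))"

definition SL_invariants :: "nat \<Rightarrow> nat \<Rightarrow> nat \<Rightarrow> (nat list list \<Rightarrow> complex) set" where
  "SL_invariants j m n =
     {t \<in> sym_power j (sym_power m (coord_space n)). \<forall>g\<in>SL n. sym_sym_act j m n g t = t}"

section \<open>Consistency of the encoding\<close>

lemma finite_tuples: "finite B \<Longrightarrow> finite (tuples k B)"
  unfolding tuples_def by (rule finite_lists_length_eq)

lemma tuples_Suc: "tuples (Suc k) B = (\<lambda>(b, l). b # l) ` (B \<times> tuples k B)"
  by (auto simp: tuples_def image_iff length_Suc_conv)

lemma tensor_Nil: "tensor [] l = (if l = [] then 1 else 0)"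
  by (simp add: tensor_def)

lemma tensor_Cons_Cons: "tensor (w # ws) (b # l) = w b * tensor ws l"
  by (simp add: tensor_def prod.lessThan_Suc_shift del: prod.lessThan_Suc)

lemma tensor_Cons_Nil: "tensor (w # ws) [] = 0"
  by (simp add: tensor_def)

lemma tensor_kernel_Cons: "tensor_kernel K (a # l) (b # l') = K a b * tensor_kernel K l l'"
  by (simp add: tensor_kernel_def prod.lessThan_Suc_shift del: prod.lessThan_Suc)

lemma sum_tensor_kernel:
  assumes "length l = length ws"
  shows "(\<Sum>l'\<in>tuples (length ws) B. tensor_kernel K l l' * tensor ws l')
       = tensor (map (\<lambda>w a. \<Sum>b\<in>B. K a b * w b) ws) l"
  using assms
proof (induction ws arbitrary: l)
  case Nil
  have "tuples 0 B = {[]}" by (auto simp: tuples_def)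
  with Nil show ?case by (simp add: tensor_kernel_def tensor_Nil)
next
  case (Cons w ws)
  then obtain a l0 where l: "l = a # l0" and len: "length l0 = length ws"
    by (cases l) auto
  have inj: "inj_on (\<lambda>(b, l). b # l) (B \<times> tuples (length ws) B)"
    by (auto simp: inj_on_def)
  have "(\<Sum>l'\<in>tuples (length (w # ws)) B. tensor_kernel K l l' * tensor (w # ws) l')
      = (\<Sum>(b, l')\<in>B \<times> tuples (length ws) B. (K a b * w b) * (tensor_kernel K l0 l' * tensor ws l'))"
    unfolding l length_Cons tuples_Suc sum.reindex[OF inj]
    by (intro sum.cong refl) (simp add: case_prod_beta tensor_kernel_Cons tensor_Cons_Cons)
  also have "\<dots> = (\<Sum>b\<in>B. K a b * w b) * (\<Sum>l'\<in>tuples (length ws) B. tensor_kernel K l0 l' * tensor ws l')"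
    unfolding sum_product sum.cartesian_product ..
  also have "\<dots> = tensor (map (\<lambda>w a. \<Sum>b\<in>B. K a b * w b) (w # ws)) l"
    unfolding Cons.IH[OF len] l list.map tensor_Cons_Cons ..
  finally show ?case .
qed

lemma kernel_map_tensor:
  "kernel_map (tuples (length ws) B) (tensor_kernel K) (tensor ws)
     = tensor (map (kernel_map B K) ws)"
proof
  fix l
  show "kernel_map (tuples (length ws) B) (tensor_kernel K) (tensor ws) l
     = tensor (map (kernel_map B K) ws) l"
  proof (cases "length l = length ws")
    case True
    then show ?thesis
      using sum_tensor_kernel[OF True, of K B] by (simp add: kernel_map_def[abs_def])
  next
    case False
    then show ?thesis
      by (simp add: kernel_map_def tensor_def tensor_kernel_def tuples_def)
  qed
qed

text \<open>On \<open>w \<otimes> \<dots> \<otimes> w\<close>, the polynomial function is the product of the coordinates of \<open>X w\<close>.\<close>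

lemma v_o_apply:
  "v_o m k = (\<Sum>\<sigma> | \<sigma> permutes {..<m}. if k = map \<sigma> [0..<m] then 1 else 0) / fact m"
proof -
  have 1: "sum F A x = (\<Sum>a\<in>A. F a x)" for F :: "(nat \<Rightarrow> nat) \<Rightarrow> nat list \<Rightarrow> complex" and A x
    by (induction A rule: infinite_finite_induct) auto
  have "tensor (map (\<lambda>p. basis_vec (\<sigma> p)) [0..<m]) k = (if k = map \<sigma> [0..<m] then 1 else 0)"
    for \<sigma>
  proof (cases "k = map \<sigma> [0..<m]")
    case True
    then show ?thesis by (simp add: tensor_def basis_vec_def)
  next
    case False
    then have "length k = m \<Longrightarrow> \<exists>p<m. k ! p \<noteq> \<sigma> p"
      by (auto simp: list_eq_iff_nth_eq)
    then show ?thesis using False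
      by (auto simp: tensor_def basis_vec_def)
  qed
  then show ?thesis by (simp add: v_o_def fscale_def 1)
qed

lemma sum_v_o:
  "(\<Sum>k\<in>tuples m {..<m}. v_o m k * F k)
     = (\<Sum>\<sigma> | \<sigma> permutes {..<m}. F (map \<sigma> [0..<m])) / fact m"
proof -
  let ?P = "{\<sigma>. \<sigma> permutes {..<m}}"
  have mem: "map \<sigma> [0..<m] \<in> tuples m {..<m}" if "\<sigma> permutes {..<m}" for \<sigma>
  proof -
    have "set (map \<sigma> [0..<m]) = \<sigma> ` {..<m}" by (simp add: atLeast0LessThan)
    then show ?thesis using permutes_image[OF that] by (simp add: tuples_def)
  qed
  have "v_o m k * F k = (\<Sum>\<sigma>\<in>?P. if k = map \<sigma> [0..<m] then F k else 0) / fact m" for k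
  proof -
    have "v_o m k * F k = (\<Sum>\<sigma>\<in>?P. (if k = map \<sigma> [0..<m] then 1 else 0) * F k) / fact m"
      by (simp only: v_o_apply sum_distrib_right times_divide_eq_left)
    also have "(\<Sum>\<sigma>\<in>?P. (if k = map \<sigma> [0..<m] then 1 else 0) * F k)
        = (\<Sum>\<sigma>\<in>?P. if k = map \<sigma> [0..<m] then F k else 0)"
      by (rule sum.cong) auto
    finally show ?thesis .
  qed
  then have "(\<Sum>k\<in>tuples m {..<m}. v_o m k * F k)
      = (\<Sum>k\<in>tuples m {..<m}. \<Sum>\<sigma>\<in>?P. (if k = map \<sigma> [0..<m] then F k else 0)) / fact m"
    by (simp only: sum_divide_distrib)
  also have "(\<Sum>k\<in>tuples m {..<m}. \<Sum>\<sigma>\<in>?P. (if k = map \<sigma> [0..<m] then F k else 0))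
      = (\<Sum>\<sigma>\<in>?P. \<Sum>k\<in>tuples m {..<m}. (if k = map \<sigma> [0..<m] then F k else 0))"
    by (rule sum.swap)
  also have "\<dots> = (\<Sum>\<sigma>\<in>?P. F (map \<sigma> [0..<m]))"
  proof (rule sum.cong[OF refl])
    fix \<sigma> assume "\<sigma> \<in> ?P"
    then show "(\<Sum>k\<in>tuples m {..<m}. if k = map \<sigma> [0..<m] then F k else 0) = F (map \<sigma> [0..<m])"
      using mem[of \<sigma>] by (subst sum.delta[OF finite_tuples]) auto
  qed
  finally show ?thesis .
qed

lemma v_o_pairing_power:
  assumes X: "X \<in> carrier_mat m i"
  shows "v_o_pairing m i (tensor (replicate m w)) X = (\<Prod>p<m. \<Sum>b<i. X $$ (p, b) * w b)"
proof -
  define y where "y = (\<lambda>p. \<Sum>b<i. mat_kernel X p b * w b)"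
  have inner: "(\<Sum>l\<in>tuples m {..<i}. tensor_kernel (mat_kernel X) k l * tensor (replicate m w) l)
      = (\<Prod>p<m. y (k ! p))" if "length k = m" for k
  proof -
    have "tensor (map (\<lambda>w a. \<Sum>b<i. mat_kernel X a b * w b) (replicate m w)) k = (\<Prod>p<m. y (k ! p))"
      unfolding tensor_def map_replicate length_replicate if_P[OF that]
      by (rule prod.cong) (simp_all add: y_def)
    then show ?thesis
      using sum_tensor_kernel[of k "replicate m w" "mat_kernel X" "{..<i}"] that
      by (simp only: length_replicate)
  qed
  have "v_o_pairing m i (tensor (replicate m w)) X
      = (\<Sum>k\<in>tuples m {..<m}. v_o m k *
          (\<Sum>l\<in>tuples m {..<i}. tensor_kernel (mat_kernel X) k l * tensor (replicate m w) l))"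
    unfolding v_o_pairing_def if_P[OF X] sum_distrib_left
    by (intro sum.cong refl) (simp only: mult_ac)
  also have "\<dots> = (\<Sum>k\<in>tuples m {..<m}. v_o m k * (\<Prod>p<m. y (k ! p)))"
  proof (rule sum.cong[OF refl])
    fix k assume "k \<in> tuples m {..<m}"
    then have "length k = m" by (simp add: tuples_def)
    then show "v_o m k * (\<Sum>l\<in>tuples m {..<i}.
        tensor_kernel (mat_kernel X) k l * tensor (replicate m w) l)
      = v_o m k * (\<Prod>p<m. y (k ! p))" by (simp only: inner)
  qed
  also have "\<dots> = (\<Sum>\<sigma> | \<sigma> permutes {..<m}. \<Prod>p<m. y (\<sigma> p)) / fact m"
    unfolding sum_v_o by (intro arg_cong2[of _ _ _ _ "(/)"] sum.cong prod.cong refl) simp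
  also have "\<dots> = (\<Sum>\<sigma> | \<sigma> permutes {..<m}. \<Prod>p<m. y p) / fact m"
  proof -
    have "(\<Prod>p<m. y (\<sigma> p)) = (\<Prod>p<m. y p)" if "\<sigma> permutes {..<m}" for \<sigma>
      using prod.permute[OF that, of y] by (simp only: comp_def)
    then show ?thesis by (intro arg_cong2[of _ _ _ _ "(/)"] sum.cong refl) blast
  qed
  also have "\<dots> = (\<Prod>p<m. y p)"
    using card_permutations[of "{..<m}" m] by simp
  also have "\<dots> = (\<Prod>p<m. \<Sum>b<i. X $$ (p, b) * w b)"
  proof (rule prod.cong[OF refl])
    fix p assume "p \<in> {..<m}"
    then show "y p = (\<Sum>b<i. X $$ (p, b) * w b)"
      unfolding y_def using X by (intro sum.cong refl) (simp add: mat_kernel_def)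
  qed
  finally show ?thesis .
qed

text \<open>The homomorphism \<open>\<phi>\<close> exists; it is unique since \<open>sym_algebra W\<close> is generated in degree one.\<close>

lemma subspace_support: "fvs.subspace {t. \<forall>x. t x \<noteq> 0 \<longrightarrow> x \<in> B}"
  by (rule fvs.subspaceI) (auto simp: fscale_def, metis add_0)

lemma tensor_power_support:
  assumes W: "\<And>w x. w \<in> W \<Longrightarrow> w x \<noteq> 0 \<Longrightarrow> x \<in> B"
    and t: "t \<in> tensor_power k W" "t l \<noteq> 0"
  shows "l \<in> tuples k B"
proof -
  have "tensor_power k W \<subseteq> {t. \<forall>l. t l \<noteq> 0 \<longrightarrow> l \<in> tuples k B}"
    unfolding tensor_power_def
  proof (rule fvs.span_minimal[OF _ subspace_support], clarify)
    fix ws :: "('a \<Rightarrow> complex) list" and l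
    assume ws: "set ws \<subseteq> W" "k = length ws" and nz: "tensor ws l \<noteq> 0"
    have len: "length l = length ws"
      using nz by (auto simp: tensor_def split: if_splits)
    have "l ! p \<in> B" if "p < length l" for p
    proof (rule W)
      show "ws ! p \<in> W" using that ws len by auto
      show "(ws ! p) (l ! p) \<noteq> 0" using nz that len by (auto simp: tensor_def)
    qed
    then show "l \<in> tuples (length ws) B"
      using len by (auto simp: tuples_def in_set_conv_nth)
  qed
  then show ?thesis using t by blast
qed

definition ev :: "('b \<Rightarrow> complex) \<Rightarrow> ('b \<Rightarrow> complex) \<Rightarrow> complex" where
  "ev q t = (\<Sum>L | t L \<noteq> 0. t L * q L)"

lemma ev_eq:
  assumes "finite A" "\<And>L. t L \<noteq> 0 \<Longrightarrow> L \<in> A"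
  shows "ev q t = (\<Sum>L\<in>A. t L * q L)"
  unfolding ev_def using assms by (intro sum.mono_neutral_left) auto

lemma ev_tensor_mult:
  assumes fs: "finite {L. s L \<noteq> 0}" and ft: "finite {L. t L \<noteq> 0}"
    and q: "\<And>a b. q (a @ b) = q a * q b"
  shows "ev q (tensor_mult s t) = ev q s * ev q t"
proof -
  let ?S = "{L. s L \<noteq> 0}" and ?T = "{L. t L \<noteq> 0}"
  define A where "A = (\<lambda>(a, b). a @ b) ` (?S \<times> ?T)"
  define h where "h = (\<lambda>(a :: 'a list, b). (a @ b, length a))"
  define F where "F = (\<lambda>(L, k). s (take k L) * t (drop k L) * q L)"
  have finA: "finite A" using fs ft by (simp add: A_def)
  have inA: "L \<in> A" if "s (take k L) * t (drop k L) \<noteq> 0" for L k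
  proof -
    have "(take k L, drop k L) \<in> ?S \<times> ?T" using that by auto
    then have "(\<lambda>(a, b). a @ b) (take k L, drop k L) \<in> A" unfolding A_def by (rule imageI)
    then show ?thesis by simp
  qed
  have supp: "L \<in> A" if "tensor_mult s t L \<noteq> 0" for L
  proof -
    have "\<exists>k\<in>{..length L}. s (take k L) * t (drop k L) \<noteq> 0"
      using that sum.not_neutral_contains_not_neutral unfolding tensor_mult_def by blast
    then show ?thesis using inA by blast
  qed
  have inj: "inj_on h (?S \<times> ?T)"
    by (auto simp: inj_on_def h_def)
  have "ev q (tensor_mult s t) = (\<Sum>L\<in>A. \<Sum>k\<le>length L. F (L, k))"
    using ev_eq[of A "tensor_mult s t" q, OF finA supp] by (simp add: tensor_mult_def sum_distrib_right F_def)
  also have "\<dots> = (\<Sum>x\<in>Sigma A (\<lambda>L. {..length L}). F x)"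
    by (subst sum.Sigma) (use finA in auto)
  also have "\<dots> = (\<Sum>x\<in>h ` (?S \<times> ?T). F x)"
  proof (rule sum.mono_neutral_right)
    show "h ` (?S \<times> ?T) \<subseteq> Sigma A (\<lambda>L. {..length L})"
      unfolding A_def h_def by force
    show "\<forall>x\<in>Sigma A (\<lambda>L. {..length L}) - h ` (?S \<times> ?T). F x = 0"
    proof clarify
      fix L k assume "(L, k) \<notin> h ` (?S \<times> ?T)" and k: "k \<le> length L"
      then have "h (take k L, drop k L) \<noteq> (L, k) \<or> (take k L, drop k L) \<notin> ?S \<times> ?T"
        by (metis imageI)
      moreover have "h (take k L, drop k L) = (L, k)" using k by (simp add: h_def)
      ultimately show "F (L, k) = 0" by (auto simp: F_def)
    qed
  qed (use finA in auto)
  also have "\<dots> = (\<Sum>x\<in>?S \<times> ?T. F (h x))"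
    unfolding sum.reindex[OF inj] by (simp add: comp_def)
  also have "\<dots> = (\<Sum>(a, b)\<in>?S \<times> ?T. (s a * q a) * (t b * q b))"
    by (intro sum.cong refl) (auto simp: F_def h_def q)
  also have "\<dots> = ev q s * ev q t"
    unfolding ev_def sum_product sum.cartesian_product ..
  finally show ?thesis .
qed

lemma ev_symmetrise:
  assumes fu: "finite {L. u L \<noteq> 0}"
    and q: "\<And>L L'. mset L = mset L' \<Longrightarrow> q L = q L'"
  shows "ev q (symmetrise u) = ev q u"
proof -
  let ?P = "\<lambda>L :: 'a list. {\<sigma>. \<sigma> permutes {..<length L}}"
  obtain N where N: "\<And>L. u L \<noteq> 0 \<Longrightarrow> length L \<le> N"
    using finite_imageI[OF fu, of length] unfolding finite_nat_set_iff_bounded_le by auto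
  define A where "A = {L. set L \<subseteq> \<Union> (set ` {L. u L \<noteq> 0}) \<and> length L \<le> N}"
  have finA: "finite A"
    unfolding A_def using fu by (intro finite_lists_length_le) auto
  have uA: "L \<in> A" if "u L \<noteq> 0" for L using that N by (auto simp: A_def)
  have permA: "permute_list \<sigma> L \<in> A \<longleftrightarrow> L \<in> A" if "\<sigma> permutes {..<length L}" for \<sigma> L
    using that by (simp add: A_def)
  have supp: "L \<in> A" if "symmetrise u L \<noteq> 0" for L
  proof -
    have "(\<Sum>\<sigma>\<in>?P L. u (permute_list \<sigma> L)) \<noteq> 0" using that by (auto simp: symmetrise_def)
    then obtain \<sigma> where "\<sigma> permutes {..<length L}" "u (permute_list \<sigma> L) \<noteq> 0"
      using sum.not_neutral_contains_not_neutral[of "\<lambda>\<sigma>. u (permute_list \<sigma> L)" "?P L"] by blast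
    then show ?thesis using uA permA by blast
  qed
  define i where "i = (\<lambda>(L :: 'a list, \<sigma> :: nat \<Rightarrow> nat). (permute_list \<sigma> L, inv_into UNIV \<sigma>))"
  have finP: "finite (?P L)" for L by (simp add: finite_permutations)
  have ii: "i (i x) = x" and iS: "i x \<in> Sigma A ?P" if xA: "x \<in> Sigma A ?P" for x
  proof -
    obtain L \<sigma> where x: "x = (L, \<sigma>)" "L \<in> A" "\<sigma> permutes {..<length L}" using xA by auto
    have "permute_list (inv_into UNIV \<sigma>) (permute_list \<sigma> L) = L"
      using permute_list_compose[OF permutes_inv[OF x(3)], of \<sigma>] permutes_inv_o[OF x(3)] by simp
    then show "i (i x) = x" using x(1) permutes_inv_inv[OF x(3)] by (simp add: i_def)
    show "i x \<in> Sigma A ?P" using x(1,2) permA[OF x(3)] permutes_inv[OF x(3)] by (simp add: i_def)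
  qed
  have "ev q (symmetrise u)
      = (\<Sum>L\<in>A. \<Sum>\<sigma>\<in>?P L. u (permute_list \<sigma> L) * q L / fact (length L))"
    using ev_eq[of A "symmetrise u" q, OF finA supp]
    by (simp add: symmetrise_def sum_distrib_right sum_divide_distrib)
  also have "\<dots> = (\<Sum>(L, \<sigma>)\<in>Sigma A ?P. u (permute_list \<sigma> L) * q L / fact (length L))"
    by (subst sum.Sigma) (use finA finP in auto)
  also have "\<dots> = (\<Sum>(L, \<sigma>)\<in>Sigma A ?P. u L * q L / fact (length L))"
  proof (rule sum.reindex_bij_witness[of _ i i])
    fix x assume "x \<in> Sigma A ?P"
    then obtain L \<sigma> where x: "x = (L, \<sigma>)" "\<sigma> permutes {..<length L}" by auto
    then have "q (permute_list \<sigma> L) = q L" by (intro q mset_permute_list)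
    then show "(case i x of (L, \<sigma>) \<Rightarrow> u L * q L / fact (length L))
        = (case x of (L, \<sigma>) \<Rightarrow> u (permute_list \<sigma> L) * q L / fact (length L))"
      by (simp add: x(1) i_def)
  qed (use ii iS in auto)
  also have "\<dots> = (\<Sum>L\<in>A. \<Sum>\<sigma>\<in>?P L. u L * q L / fact (length L))"
    by (subst sum.Sigma) (use finA finP in auto)
  also have "\<dots> = (\<Sum>L\<in>A. u L * q L)"
  proof (rule sum.cong[OF refl])
    fix L
    have "card (?P L) = fact (length L)" using card_permutations[of "{..<length L}"] by simp
    then show "(\<Sum>\<sigma>\<in>?P L. u L * q L / fact (length L)) = u L * q L" by simp
  qed
  also have "\<dots> = ev q u" using ev_eq[of A u q] finA uA by simp
  finally show ?thesis .
qed

lemma tensor_mult_finite_support: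
  assumes fs: "finite {L. s L \<noteq> 0}" and ft: "finite {L. t L \<noteq> 0}"
  shows "finite {L. tensor_mult s t L \<noteq> 0}"
proof (rule finite_subset)
  show "finite ((\<lambda>(a, b). a @ b) ` ({L. s L \<noteq> 0} \<times> {L. t L \<noteq> 0}))" using fs ft by simp
  show "{L. tensor_mult s t L \<noteq> 0} \<subseteq> (\<lambda>(a, b). a @ b) ` ({L. s L \<noteq> 0} \<times> {L. t L \<noteq> 0})"
  proof clarify
    fix L assume "tensor_mult s t L \<noteq> 0"
    then have "\<exists>k\<in>{..length L}. s (take k L) * t (drop k L) \<noteq> 0"
      using sum.not_neutral_contains_not_neutral unfolding tensor_mult_def by blast
    then obtain k where "s (take k L) \<noteq> 0" "t (drop k L) \<noteq> 0" by auto
    then show "L \<in> (\<lambda>(a, b). a @ b) ` ({L. s L \<noteq> 0} \<times> {L. t L \<noteq> 0})"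
      by (intro image_eqI[where x = "(take k L, drop k L)"]) auto
  qed
qed

lemma hom_poly_funs_mult:
  assumes f: "f \<in> hom_poly_funs r c a" and g: "g \<in> hom_poly_funs r c b"
  shows "f * g \<in> hom_poly_funs r c (a + b)"
proof -
  define mon where "mon = (\<lambda>ps X. if X \<in> carrier_mat r c then \<Prod>p\<leftarrow>ps. X $$ p else (0 :: complex))"
  define gens where "gens = (\<lambda>k. {mon ps | ps. length ps = k \<and> set ps \<subseteq> {..<r} \<times> {..<c}})"
  have H: "hom_poly_funs r c k = fvs.span (gens k)" for k
    by (simp add: hom_poly_funs_def gens_def mon_def)
  have sub: "fvs.subspace {f. \<forall>g\<in>Z. f * g \<in> hom_poly_funs r c k}" for Z k
  proof (rule fvs.subspaceI, unfold mem_Collect_eq H)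
    show "\<forall>g\<in>Z. 0 * g \<in> fvs.span (gens k)" by (simp add: fvs.span_zero)
  next
    fix x y assume "\<forall>g\<in>Z. x * g \<in> fvs.span (gens k)" "\<forall>g\<in>Z. y * g \<in> fvs.span (gens k)"
    then show "\<forall>g\<in>Z. (x + y) * g \<in> fvs.span (gens k)"
      by (simp add: distrib_right fvs.span_add)
  next
    fix a x assume x: "\<forall>g\<in>Z. x * g \<in> fvs.span (gens k)"
    have "fscale a x * g = fscale a (x * g)" for g
      by (simp add: fscale_def fun_eq_iff)
    then show "\<forall>g\<in>Z. fscale a x * g \<in> fvs.span (gens k)"
      using x by (simp add: fvs.span_scale)
  qed
  have 1: "mon ps * mon qs = mon (ps @ qs)" for ps qs
    by (auto simp: mon_def fun_eq_iff)
  have "gens a \<subseteq> {f. \<forall>g\<in>gens b. f * g \<in> hom_poly_funs r c (a + b)}"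
  proof clarify
    fix f g assume "f \<in> gens a" "g \<in> gens b"
    then have "f * g \<in> gens (a + b)" by (force simp: gens_def 1)
    then show "f * g \<in> hom_poly_funs r c (a + b)" unfolding H by (rule fvs.span_base)
  qed
  from fvs.span_minimal[OF this sub]
  have 2: "x * g \<in> hom_poly_funs r c (a + b)" if "x \<in> hom_poly_funs r c a" "g \<in> gens b" for x g
    using that unfolding H by auto
  have "gens b \<subseteq> {g. \<forall>x\<in>hom_poly_funs r c a. g * x \<in> hom_poly_funs r c (a + b)}"
  proof (intro subsetI CollectI ballI)
    fix g x assume "g \<in> gens b" "x \<in> hom_poly_funs r c a"
    then show "g * x \<in> hom_poly_funs r c (a + b)" using 2[of x g] by (simp only: mult.commute)
  qed
  from fvs.span_minimal[OF this sub] have "g * f \<in> hom_poly_funs r c (a + b)"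
    using f g unfolding H by blast
  then show ?thesis by (simp only: mult.commute)
qed

lemma hom_poly_funs_one: "(\<lambda>X. if X \<in> carrier_mat r c then 1 else 0) \<in> hom_poly_funs r c 0"
  unfolding hom_poly_funs_def by (intro fvs.span_base) auto

lemma is_phi_exists: "\<exists>\<phi>. is_phi m i \<phi>"
proof -
  define W where "W = sym_power m (coord_space i)"
  define B where "B = tuples m {..<i}"
  have finB: "finite B" by (simp add: B_def finite_tuples)
  have coord: "x \<in> {..<i}" if "w \<in> coord_space i" "w x \<noteq> 0" for w x
    using that by (auto simp: coord_space_def not_less[symmetric])
  have W_supp: "l \<in> B" if "w \<in> W" "w l \<noteq> 0" for w l
    using that tensor_power_support[of "coord_space i" "{..<i}" w m l] coord
    by (auto simp: W_def sym_power_def B_def)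
  have S_supp: "L \<in> tuples j B" if "t \<in> sym_power j W" "t L \<noteq> 0" for t j L
    using that tensor_power_support[of W B t j L] W_supp by (auto simp: sym_power_def)
  define FS :: "(nat list list \<Rightarrow> complex) set" where "FS = {t. finite {L. t L \<noteq> 0}}"
  have FS_sub: "fvs.subspace FS"
  proof (rule fvs.subspaceI)
    fix x y :: "nat list list \<Rightarrow> complex" and c
    assume x: "x \<in> FS"
    then show "fscale c x \<in> FS" by (auto simp: FS_def fscale_def)
    assume "y \<in> FS"
    then show "x + y \<in> FS" using x unfolding FS_def mem_Collect_eq
      by (rule_tac finite_subset[of _ "{L. x L \<noteq> 0} \<union> {L. y L \<noteq> 0}"]) auto
  qed (simp add: FS_def)
  have "sym_power j W \<subseteq> FS" for j
  proof
    fix t assume "t \<in> sym_power j W"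
    then have "{L. t L \<noteq> 0} \<subseteq> tuples j B" using S_supp by blast
    then show "t \<in> FS" unfolding FS_def using finite_tuples[OF finB] finite_subset by blast
  qed
  then have FS: "sym_algebra W \<subseteq> FS"
    unfolding sym_algebra_def by (intro fvs.span_minimal FS_sub) auto
  define \<psi> where "\<psi> = (\<lambda>l X. if X \<in> carrier_mat m i then
     \<Sum>k\<in>tuples m {..<m}. v_o m k * tensor_kernel (mat_kernel X) k l else 0)"
  define q where "q = (\<lambda>X L. if X \<in> carrier_mat m i then \<Prod>l\<leftarrow>L. \<psi> l X else 0)"
  have q_append: "q X (a @ b) = q X a * q X b" for X a b by (simp add: q_def)
  have q_mset: "q X L = q X L'" if "mset L = mset L'" for X L L'
  proof -
    have "mset (map (\<lambda>l. \<psi> l X) L) = mset (map (\<lambda>l. \<psi> l X) L')" using that by simp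
    then have "(\<Prod>l\<leftarrow>L. \<psi> l X) = (\<Prod>l\<leftarrow>L'. \<psi> l X)" by (metis prod_mset_prod_list)
    then show ?thesis by (simp add: q_def)
  qed
  define \<phi> where "\<phi> = (\<lambda>t X. ev (q X) t)"
  have lin: "linear_map_on (sym_algebra W) \<phi>"
    unfolding linear_map_on_def
  proof (intro conjI ballI allI ext)
    fix s t X c assume s: "s \<in> sym_algebra W" 
    then have fs: "finite {L. s L \<noteq> 0}" using FS by (auto simp: FS_def)
    show "\<phi> (fscale c s) X = fscale c (\<phi> s) X"
      using ev_eq[OF fs, of s "q X"] ev_eq[OF fs, of "fscale c s" "q X"]
      by (simp add: \<phi>_def fscale_def sum_distrib_left mult.assoc)
    assume "t \<in> sym_algebra W"
    then have fin: "finite ({L. s L \<noteq> 0} \<union> {L. t L \<noteq> 0})" using FS fs by (auto simp: FS_def)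
    have "ev (q X) (s + t) = ev (q X) s + ev (q X) t"
      by (subst (1 2 3) ev_eq[OF fin]) (auto simp: sum.distrib algebra_simps)
    then show "\<phi> (s + t) X = (\<phi> s + \<phi> t) X" by (simp add: \<phi>_def)
  qed
  have unit: "\<phi> (tensor []) = (\<lambda>X. if X \<in> carrier_mat m i then 1 else 0)"
    by (simp add: \<phi>_def fun_eq_iff tensor_Nil ev_def q_def)
  have mult: "\<phi> (sym_mult s t) = \<phi> s * \<phi> t" if "s \<in> sym_algebra W" "t \<in> sym_algebra W" for s t
  proof
    fix X
    have f: "finite {L. s L \<noteq> 0}" "finite {L. t L \<noteq> 0}" using that FS by (auto simp: FS_def)
    have "ev (q X) (sym_mult s t) = ev (q X) (tensor_mult s t)"
      unfolding sym_mult_def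
      by (rule ev_symmetrise[OF tensor_mult_finite_support[OF f]]) (rule q_mset)
    also have "\<dots> = ev (q X) s * ev (q X) t"
      by (rule ev_tensor_mult[OF f]) (rule q_append)
    finally show "\<phi> (sym_mult s t) X = (\<phi> s * \<phi> t) X" by (simp add: \<phi>_def)
  qed
  have deg1: "\<phi> (tensor [v]) = v_o_pairing m i v" if "v \<in> W" for v
  proof
    fix X
    have supp: "L \<in> (\<lambda>l. [l]) ` B" if "tensor [v] L \<noteq> 0" for L
    proof -
      from that have "length L = 1" by (auto simp: tensor_def split: if_splits)
      then obtain l where L: "L = [l]" by (auto simp: length_Suc_conv)
      then have "v l \<noteq> 0" using that by (simp add: tensor_Cons_Cons tensor_Nil)
      then show ?thesis using W_supp[OF \<open>v \<in> W\<close>] L by auto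
    qed
    have "\<phi> (tensor [v]) X = (\<Sum>l\<in>B. v l * q X [l])"
      unfolding \<phi>_def using ev_eq[OF finite_imageI[OF finB] supp]
      by (simp add: sum.reindex inj_on_def tensor_Cons_Cons tensor_Nil)
    also have "\<dots> = v_o_pairing m i v X"
    proof (cases "X \<in> carrier_mat m i")
      case True
      have "(\<Sum>l\<in>B. v l * q X [l]) = (\<Sum>l\<in>B. \<Sum>k\<in>tuples m {..<m}.
          v_o m k * v l * tensor_kernel (mat_kernel X) k l)"
        by (rule sum.cong[OF refl])
           (simp add: q_def \<psi>_def True sum_distrib_left mult.left_commute mult.assoc)
      also have "\<dots> = (\<Sum>k\<in>tuples m {..<m}. \<Sum>l\<in>B.
          v_o m k * v l * tensor_kernel (mat_kernel X) k l)" by (rule sum.swap)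
      finally show ?thesis by (simp add: v_o_pairing_def True B_def)
    next
      case False
      then show ?thesis by (simp add: q_def v_o_pairing_def)
    qed
    finally show "\<phi> (tensor [v]) X = v_o_pairing m i v X" .
  qed
  have psi: "\<psi> l \<in> hom_poly_funs m i m" if "l \<in> B" for l
  proof -
    define mon where "mon = (\<lambda>ps X. if X \<in> carrier_mat m i then \<Prod>p\<leftarrow>ps. X $$ p else (0 :: complex))"
    have sum_apply: "sum F A x = (\<Sum>a\<in>A. F a x)"
      for F :: "nat list \<Rightarrow> complex mat \<Rightarrow> complex" and A x
      by (induction A rule: infinite_finite_induct) auto
    have mon_in: "mon (zip k l) \<in> hom_poly_funs m i m" if "k \<in> tuples m {..<m}" for k
      unfolding hom_poly_funs_def mon_def
    proof (intro fvs.span_base CollectI exI conjI)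
      show "length (zip k l) = m" using that \<open>l \<in> B\<close> by (simp add: tuples_def B_def)
      show "set (zip k l) \<subseteq> {..<m} \<times> {..<i}"
        using that \<open>l \<in> B\<close> by (auto simp: tuples_def B_def dest: set_zip_leftD set_zip_rightD)
    qed (rule refl)
    have mon_eq: "mon (zip k l) X = tensor_kernel (mat_kernel X) k l"
      if k: "k \<in> tuples m {..<m}" and X: "X \<in> carrier_mat m i" for k X
    proof -
      have len: "length k = m" "length l = m" using k \<open>l \<in> B\<close> by (auto simp: tuples_def B_def)
      have "k ! p < m" "l ! p < i" if "p < m" for p
        using k \<open>l \<in> B\<close> that nth_mem[of p k] nth_mem[of p l] len
        by (auto simp: tuples_def B_def simp del: nth_mem)
      then show ?thesis using X len
        by (simp add: mon_def tensor_kernel_def prod.list_conv_set_nth atLeast0LessThan mat_kernel_def)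
    qed
    have "\<psi> l = (\<Sum>k\<in>tuples m {..<m}. fscale (v_o m k) (mon (zip k l)))"
    proof
      fix X
      show "\<psi> l X = (\<Sum>k\<in>tuples m {..<m}. fscale (v_o m k) (mon (zip k l))) X"
      proof (cases "X \<in> carrier_mat m i")
        case True
        then show ?thesis by (simp add: sum_apply \<psi>_def fscale_def mon_eq)
      next
        case False
        then show ?thesis by (simp add: sum_apply \<psi>_def fscale_def mon_def)
      qed
    qed
    then show ?thesis
      using mon_in unfolding hom_poly_funs_def by (auto intro!: fvs.span_sum fvs.span_scale)
  qed
  have q_in: "(\<lambda>X. q X L) \<in> hom_poly_funs m i (m * length L)" if "set L \<subseteq> B" for L
    using that
  proof (induction L)
    case Nil
    then show ?case using hom_poly_funs_one[of m i] by (simp add: q_def cong: if_cong)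
  next
    case (Cons l L)
    have "(\<lambda>X. q X (l # L)) = \<psi> l * (\<lambda>X. q X L)"
      by (auto simp: fun_eq_iff q_def)
    then show ?case using hom_poly_funs_mult[OF psi Cons.IH] Cons.prems by simp
  qed
  have grade: "\<phi> t \<in> hom_poly_funs m i (m * j)" if t: "t \<in> sym_power j W" for j t
  proof -
    have sum_apply: "sum F A x = (\<Sum>a\<in>A. F a x)"
      for F :: "nat list list \<Rightarrow> complex mat \<Rightarrow> complex" and A x
      by (induction A rule: infinite_finite_induct) auto
    have "\<phi> t = (\<Sum>L\<in>tuples j B. fscale (t L) (\<lambda>X. q X L))"
      using ev_eq[OF finite_tuples[OF finB] S_supp[OF t]]
      by (simp add: \<phi>_def fun_eq_iff sum_apply fscale_def)
    moreover have "(\<lambda>X. q X L) \<in> hom_poly_funs m i (m * j)" if "L \<in> tuples j B" for L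
      using q_in[of L] that by (auto simp: tuples_def)
    ultimately show ?thesis
      unfolding hom_poly_funs_def by (auto intro!: fvs.span_sum fvs.span_scale)
  qed
  have "is_phi m i \<phi>"
    using lin unit mult grade deg1 unfolding is_phi_def Let_def W_def by blast
  then show ?thesis by (intro exI[of "is_phi m i" \<phi>])
qed

end

theory Submission
  imports Defs "HOL-Computational_Algebra.Fundamental_Theorem_Algebra"
begin


text \<open>In coordinates, tensors over V_m and over its dual are the same functions, paired by the
  bilinear form \<open>bil\<close>. Transposition of matrices is adjunction for this form, and
  conjugating one argument turns it into a Hermitian inner product. The contragredient is a
  bijection of GL(m), so the dual action and the standard action have the same stable subspaces
  (\<open>is_submodule_dual_iff\<close>). Write vo for the i-th tensor power of
  \<open>v_o m\<close>, U for the submodule it generates, H for the SL(i)-invariants in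
  S^i(S^m(C^i)), regarded inside S^i(S^m(C^m)), and I for the isotypic component.

  The link with phi: an algebra homomorphism is determined in degree one, so phi(t)(X) is the
  pairing of vo with X applied to t (\<open>phi_eq_bil\<close>). After padding X to a square matrix
  and using density of GL(m), phi(t) = 0 holds iff vo is bilinearly orthogonal to the GL(m)-orbit of
  t (\<open>phi_vanishes_iff\<close>).

  The heart of the proof is that I is the span of the orbits of H. An i x i matrix A acts on an
  invariant by det(A)^m, so for t, u in H the matrix coefficient of g at t, u is the m-th power of
  the leading i x i minor of g, times the pairing of t with u
  (\<open>bil_SL_invariants_act\<close>). The module of highest weight (m,...,m) with highest weight
  vector v carries a functional f whose matrix coefficient against v is that same power
  (\<open>lowest_weight_functional\<close>); f is the limit of a normalised torus action that
  contracts the orbit of the open cell onto the line of v. Proportional matrix coefficients identify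
  the span of the orbit of a nonzero t in H with the dual module
  (\<open>orbit_isomorphic_dual\<close>). Conversely, in any copy of the dual module the image of f
  is fixed by the block matrices diag(A, c) with det A = 1 and c nonzero; this forces it into H
  (\<open>levi_fixed_imp_SL_invariants\<close>), and it generates the copy
  (\<open>dual_submodule_generated_by_invariant\<close>).

  The equivalence follows by orthogonality. If phi(t) is nonzero for some t in H, then the conjugate
  of t is not Hermitian-orthogonal to U. Its orthogonal projection to U is nonzero, is still fixed
  by the block matrices because U is stable under GL(m), and therefore lies in H, hence in I. If phi
  vanishes on H, then U is bilinearly orthogonal to all orbits of H. As H is closed under
  conjugation, an element of U and I is orthogonal to its own conjugate, so it is zero.\<close>

section \<open>Bilinear forms and kernels\<close>

text \<open>Bilinear, not Hermitian, because it represents the pairing of dual coordinates in the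
  definition of phi. The inner product is \<open>bil B x (cnj_fun y)\<close>.\<close>

definition bil :: "'b set \<Rightarrow> ('b \<Rightarrow> complex) \<Rightarrow> ('b \<Rightarrow> complex) \<Rightarrow> complex" where
  "bil B x y = (\<Sum>b\<in>B. x b * y b)"

definition cnj_fun :: "('b \<Rightarrow> complex) \<Rightarrow> 'b \<Rightarrow> complex" where
  "cnj_fun x = (\<lambda>b. cnj (x b))"

definition supported :: "'b set \<Rightarrow> ('b \<Rightarrow> complex) set" where
  "supported B = {x. \<forall>b. x b \<noteq> 0 \<longrightarrow> b \<in> B}"

lemma supported_subspace: "fvs.subspace (supported B)"
  unfolding supported_def by (rule subspace_support)

lemma coord_space_eq_supported: "coord_space n = supported {..<n}"
  by (auto simp: coord_space_def supported_def not_less[symmetric])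

lemma bil_commute: "bil B x y = bil B y x"
  by (simp add: bil_def mult.commute)

lemma bil_add_left: "bil B (x + y) z = bil B x z + bil B y z"
  and bil_add_right: "bil B z (x + y) = bil B z x + bil B z y"
  and bil_diff_left: "bil B (x - y) z = bil B x z - bil B y z"
  and bil_diff_right: "bil B z (x - y) = bil B z x - bil B z y"
  and bil_scale_left: "bil B (fscale c x) z = c * bil B x z"
  and bil_scale_right: "bil B z (fscale c x) = c * bil B z x"
  and bil_zero_left: "bil B 0 z = 0"
  and bil_zero_right: "bil B z 0 = 0"
  by (simp_all add: bil_def fscale_def algebra_simps sum.distrib sum_subtractf sum_distrib_left)

lemmas bil_simps = bil_add_left bil_add_right bil_diff_left bil_diff_right bil_scale_left
  bil_scale_right bil_zero_left bil_zero_right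

lemma cnj_fun_cnj_fun [simp]: "cnj_fun (cnj_fun x) = x"
  by (simp add: cnj_fun_def)

lemma cnj_fun_add: "cnj_fun (x + y) = cnj_fun x + cnj_fun y"
  and cnj_fun_scale: "cnj_fun (fscale c x) = fscale (cnj c) (cnj_fun x)"
  and cnj_fun_zero [simp]: "cnj_fun 0 = 0"
  by (simp_all add: cnj_fun_def fscale_def fun_eq_iff)

lemma cnj_fun_eq_0_iff [simp]: "cnj_fun x = 0 \<longleftrightarrow> x = 0"
  by (simp add: cnj_fun_def fun_eq_iff)

lemma cnj_bil: "cnj (bil B x y) = bil B (cnj_fun x) (cnj_fun y)"
  by (simp add: bil_def cnj_fun_def)

lemma cnj_fun_supported: "x \<in> supported B \<Longrightarrow> cnj_fun x \<in> supported B"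
  by (simp add: supported_def cnj_fun_def)

lemma bil_annihilator_subspace: "fvs.subspace {x. \<forall>y\<in>Y. bil B x y = 0}"
  by (rule fvs.subspaceI) (simp_all add: bil_simps)

lemma bil_positive_definite:
  assumes B: "finite B" and x: "x \<in> supported B" and 0: "bil B x (cnj_fun x) = 0"
  shows "x = 0"
proof -
  have "bil B x (cnj_fun x) = of_real (\<Sum>b\<in>B. (cmod (x b))\<^sup>2)"
    unfolding bil_def of_real_sum
    by (intro sum.cong refl) (metis cnj_fun_def complex_norm_square)
  then have "(\<Sum>b\<in>B. (cmod (x b))\<^sup>2) = 0" using 0 by (metis of_real_eq_0_iff)
  then have "\<forall>b\<in>B. x b = 0" using B by (simp add: sum_nonneg_eq_0_iff)
  then show ?thesis using x by (auto simp: supported_def fun_eq_iff)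
qed

section \<open>Orthogonal projections and annihilators in finite dimension\<close>

lemma supported_span_basis:
  assumes "finite B"
  shows "supported B = fvs.span ((\<lambda>b c. if c = b then 1 else 0) ` B)" (is "_ = fvs.span ?E")
proof
  show "supported B \<subseteq> fvs.span ?E"
  proof
    fix x :: "'a \<Rightarrow> complex" assume x: "x \<in> supported B"
    have sum_apply: "sum F A c = (\<Sum>a\<in>A. F a c)" for F :: "'a \<Rightarrow> 'a \<Rightarrow> complex" and A c
      by (induction A rule: infinite_finite_induct) auto
    have "x = (\<Sum>b\<in>B. fscale (x b) (\<lambda>c. if c = b then 1 else 0))"
      using x assms by (auto simp: fun_eq_iff sum_apply fscale_def supported_def if_distrib cong: if_cong)
    moreover have "\<dots> \<in> fvs.span ?E"
      by (intro fvs.span_sum fvs.span_scale fvs.span_base) auto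
    ultimately show "x \<in> fvs.span ?E" by simp
  qed
  show "fvs.span ?E \<subseteq> supported B"
    by (rule fvs.span_minimal[OF _ supported_subspace]) (auto simp: supported_def split: if_splits)
qed

lemma subspace_finitely_spanned:
  assumes B: "finite B" and U: "fvs.subspace U" "U \<subseteq> supported B"
  obtains S where "finite S" "S \<subseteq> U" "U = fvs.span S"
proof -
  obtain S where S: "S \<subseteq> U" "fvs.independent S" "U \<subseteq> fvs.span S"
    using fvs.maximal_independent_subset[of U] by metis
  have "finite S"
    using fvs.independent_span_bound[of "(\<lambda>b c. if c = b then 1 else 0) ` B" S] S U B
      supported_span_basis[OF B] by auto
  moreover have "U = fvs.span S" using S U fvs.span_minimal by blast
  ultimately show ?thesis using S that by blast
qed

text \<open>Gram-Schmidt: a new generator \<open>a\<close> is replaced by its component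
  \<open>a'\<close> orthogonal to the old span. Either \<open>a'\<close> vanishes and the span does
  not grow, or the projection gains a multiple of \<open>a'\<close>.\<close>

lemma orthogonal_projection_span:
  fixes x :: "'b \<Rightarrow> complex"
  assumes B: "finite B" and "finite S" "S \<subseteq> supported B"
  shows "\<exists>u\<in>fvs.span S. \<forall>w\<in>fvs.span S. bil B (x - u) (cnj_fun w) = 0"
  using assms(2,3)
proof (induction S arbitrary: x rule: finite_induct)
  case empty
  have "bil B (x - 0) (cnj_fun w) = 0" if "w \<in> fvs.span {}" for w
    using that unfolding fvs.span_empty by (metis singletonD cnj_fun_zero bil_zero_right)
  then show ?case using fvs.span_zero by blast
next
  case (insert a S)
  have spanS: "fvs.span S \<subseteq> supported B"
    using insert.prems by (intro fvs.span_minimal supported_subspace) auto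
  obtain p where p: "p \<in> fvs.span S" "\<And>w. w \<in> fvs.span S \<Longrightarrow> bil B (a - p) (cnj_fun w) = 0"
    using insert.IH[of a] insert.prems by (meson insert_subset)
  obtain u where u: "u \<in> fvs.span S" "\<And>w. w \<in> fvs.span S \<Longrightarrow> bil B (x - u) (cnj_fun w) = 0"
    using insert.IH[of x] insert.prems by (meson insert_subset)
  define a' where "a' = a - p"
  have a'_supp: "a' \<in> supported B"
    unfolding a'_def using insert.prems p(1) spanS fvs.subspace_diff[OF supported_subspace] by blast
  show ?case
  proof (cases "bil B a' (cnj_fun a') = 0")
    case True
    then have "a' = 0" using bil_positive_definite[OF B a'_supp] by simp
    then have "a = p" by (simp add: a'_def)
    then have "fvs.span (insert a S) = fvs.span S" using p(1) by (metis fvs.span_redundant)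
    then show ?thesis using u by (metis (lifting))
  next
    case False
    define c where "c = bil B (x - u) (cnj_fun a') / bil B a' (cnj_fun a')"
    define u' where "u' = u + fscale c a'"
    have S_sub: "fvs.span S \<subseteq> fvs.span (insert a S)" by (intro fvs.span_mono) auto
    have "a' \<in> fvs.span (insert a S)"
      unfolding a'_def using p(1) S_sub fvs.span_base[of a "insert a S"] by (intro fvs.span_diff) auto
    then have "u' \<in> fvs.span (insert a S)"
      unfolding u'_def using u(1) S_sub by (intro fvs.span_add fvs.span_scale) auto
    moreover have "bil B (x - u') (cnj_fun w) = 0" if w: "w \<in> fvs.span (insert a S)" for w
    proof -
      obtain k where k: "w - fscale k a \<in> fvs.span S"
        using w by (auto simp: fvs.span_breakdown_eq)
      define s where "s = w - fscale k a + fscale k p"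
      have s: "s \<in> fvs.span S"
        unfolding s_def using k p(1) by (intro fvs.span_add fvs.span_scale)
      have ws: "w = fscale k a' + s"
        by (simp add: s_def a'_def fvs.scale_right_diff_distrib)
      have 1: "bil B (x - u') (cnj_fun a') = 0"
        using False by (simp add: u'_def c_def bil_simps)
      have 2: "bil B (x - u') (cnj_fun s) = 0"
        using u(2)[OF s] p(2)[OF s] by (simp add: u'_def a'_def bil_simps)
      show ?thesis unfolding ws by (simp add: cnj_fun_add cnj_fun_scale bil_add_right bil_scale_right 1 2)
    qed
    ultimately show ?thesis by blast
  qed
qed

lemma orthogonal_projection:
  fixes x :: "'b \<Rightarrow> complex"
  assumes "finite B" "fvs.subspace U" "U \<subseteq> supported B"
  obtains u where "u \<in> U" "\<And>w. w \<in> U \<Longrightarrow> bil B (x - u) (cnj_fun w) = 0"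
proof -
  obtain S where "finite S" "S \<subseteq> U" "U = fvs.span S"
    using subspace_finitely_spanned[OF assms] by blast
  then show ?thesis
    using orthogonal_projection_span[OF assms(1), of S x] assms(3) that by blast
qed

text \<open>The criterion by which orbits are shown to span: a proper subspace would be annihilated
  by a nonzero vector, namely the conjugated residual of a projection.\<close>

lemma subspace_eq_supportedI:
  assumes B: "finite B" and U: "fvs.subspace U" "U \<subseteq> supported B"
    and ann: "\<And>z. z \<in> supported B \<Longrightarrow> (\<And>u. u \<in> U \<Longrightarrow> bil B u z = 0) \<Longrightarrow> z = 0"
  shows "U = supported B"
proof (intro equalityI U(2) subsetI)
  fix x :: "'a \<Rightarrow> complex" assume x: "x \<in> supported B"
  obtain u where u: "u \<in> U" "\<And>w. w \<in> U \<Longrightarrow> bil B (x - u) (cnj_fun w) = 0"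
    using orthogonal_projection[OF B U, of x] by blast
  have "cnj_fun (x - u) = 0"
  proof (rule ann)
    show "cnj_fun (x - u) \<in> supported B"
      using x u(1) U(2) fvs.subspace_diff[OF supported_subspace] by (intro cnj_fun_supported) blast
    show "bil B w (cnj_fun (x - u)) = 0" if "w \<in> U" for w
      using arg_cong[OF u(2)[OF that], of cnj] by (simp add: cnj_bil bil_commute)
  qed
  then have "x - u = 0" by (simp only: cnj_fun_eq_0_iff)
  then show "x \<in> U" using u(1) by (metis right_minus_eq)
qed

section \<open>Linear maps given by kernels, and functoriality of symmetric powers\<close>

lemma kernel_map_add: "kernel_map B K (x + y) = kernel_map B K x + kernel_map B K y"
  and kernel_map_diff: "kernel_map B K (x - y) = kernel_map B K x - kernel_map B K y"
  and kernel_map_scale: "kernel_map B K (fscale c x) = fscale c (kernel_map B K x)"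
  and kernel_map_zero: "kernel_map B K 0 = 0"
  by (simp_all add: kernel_map_def fscale_def fun_eq_iff algebra_simps sum.distrib sum_subtractf
      sum_distrib_left)

lemma bil_kernel_map:
  "bil A (kernel_map B K x) y = bil B x (kernel_map A (\<lambda>b a. K a b) y)"
proof -
  have "bil A (kernel_map B K x) y = (\<Sum>a\<in>A. \<Sum>b\<in>B. K a b * x b * y a)"
    by (simp add: bil_def kernel_map_def sum_distrib_right)
  also have "\<dots> = (\<Sum>b\<in>B. \<Sum>a\<in>A. K a b * x b * y a)" by (rule sum.swap)
  also have "\<dots> = bil B x (kernel_map A (\<lambda>b a. K a b) y)"
    by (simp add: bil_def kernel_map_def sum_distrib_left mult_ac)
  finally show ?thesis .
qed

lemma kernel_map_kernel_map:
  "kernel_map A K (kernel_map B K' x) = kernel_map B (\<lambda>a c. \<Sum>b\<in>A. K a b * K' b c) x"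
proof
  fix a
  have "kernel_map A K (kernel_map B K' x) a = (\<Sum>b\<in>A. \<Sum>c\<in>B. K a b * K' b c * x c)"
    by (simp add: kernel_map_def sum_distrib_left mult_ac)
  also have "\<dots> = (\<Sum>c\<in>B. \<Sum>b\<in>A. K a b * K' b c * x c)" by (rule sum.swap)
  finally show "kernel_map A K (kernel_map B K' x) a = kernel_map B (\<lambda>a c. \<Sum>b\<in>A. K a b * K' b c) x a"
    by (simp add: kernel_map_def sum_distrib_right)
qed

lemma cnj_fun_kernel_map:
  "cnj_fun (kernel_map B K x) = kernel_map B (\<lambda>a b. cnj (K a b)) (cnj_fun x)"
  by (simp add: cnj_fun_def kernel_map_def)

lemma tensor_kernel_compose:
  "(\<Sum>l'\<in>tuples (length l) B. tensor_kernel K l l' * tensor_kernel K' l' l'')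
     = tensor_kernel (\<lambda>a c. \<Sum>b\<in>B. K a b * K' b c) l l''"
proof (cases "length l = length l''")
  case True
  have eq: "tensor_kernel K' l' l'' = tensor (map (\<lambda>c b. K' b c) l'') l'" for l'
    by (auto simp: tensor_kernel_def tensor_def)
  show ?thesis
    using sum_tensor_kernel[of l "map (\<lambda>c b. K' b c) l''" K B] True
    by (simp add: eq) (simp add: tensor_kernel_def tensor_def)
next
  case False
  then show ?thesis
    by (auto simp: tensor_kernel_def tuples_def intro!: sum.neutral)
qed

lemma tensor_kernel_transpose: "tensor_kernel (\<lambda>b a. K a b) = (\<lambda>l' l. tensor_kernel K l l')"
  by (auto simp: tensor_kernel_def fun_eq_iff)

lemma cnj_tensor_kernel: "cnj (tensor_kernel K l l') = tensor_kernel (\<lambda>a b. cnj (K a b)) l l'"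
  by (simp add: tensor_kernel_def)

lemma tensor_kernel_scale:
  "tensor_kernel (\<lambda>a b. c * K a b) l l' = c ^ length l * tensor_kernel K l l'"
  by (simp add: tensor_kernel_def prod.distrib)

lemma tensor_kernel_permute:
  assumes \<sigma>: "\<sigma> permutes {..<length l}" and len: "length l' = length l"
  shows "tensor_kernel K (permute_list \<sigma> l) (permute_list \<sigma> l') = tensor_kernel K l l'"
proof -
  have "(\<Prod>p<length l. K (l ! \<sigma> p) (l' ! \<sigma> p)) = (\<Prod>p<length l. K (l ! p) (l' ! p))"
    using prod.permute[OF \<sigma>, of "\<lambda>p. K (l ! p) (l' ! p)"] by (simp add: comp_def)
  then show ?thesis using \<sigma> len by (simp add: tensor_kernel_def permute_list_nth)
qed

lemma bij_betw_permute_list: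
  assumes \<sigma>: "\<sigma> permutes {..<k}"
  shows "bij_betw (permute_list \<sigma>) (tuples k B) (tuples k B)"
proof (rule bij_betwI[where g = "permute_list (inv_into UNIV \<sigma>)"])
  have i: "inv_into UNIV \<sigma> permutes {..<k}" using permutes_inv[OF \<sigma>] .
  show "permute_list \<sigma> \<in> tuples k B \<rightarrow> tuples k B"
    "permute_list (inv_into UNIV \<sigma>) \<in> tuples k B \<rightarrow> tuples k B"
    using \<sigma> i by (auto simp: tuples_def dest: set_permute_list)
  fix l :: "'a list" assume "l \<in> tuples k B"
  then have len: "length l = k" by (simp add: tuples_def)
  show "permute_list (inv_into UNIV \<sigma>) (permute_list \<sigma> l) = l"
    using permute_list_compose[of "inv_into UNIV \<sigma>" l \<sigma>] i len permutes_inv_o[OF \<sigma>] by simp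
  show "permute_list \<sigma> (permute_list (inv_into UNIV \<sigma>) l) = l"
    using permute_list_compose[of \<sigma> l "inv_into UNIV \<sigma>"] \<sigma> len permutes_inv_o[OF \<sigma>] by simp
qed

text \<open>Symmetry survives because permuting both index lists leaves a tensor kernel unchanged.
  \<open>W\<close> and \<open>W'\<close> are arbitrary so that a second application handles a
  symmetric power of a symmetric power.\<close>

lemma kernel_map_sym_power:
  assumes W: "\<And>w. w \<in> W \<Longrightarrow> kernel_map B K w \<in> W'" and t: "t \<in> sym_power k W"
  shows "kernel_map (tuples k B) (tensor_kernel K) t \<in> sym_power k W'"
proof -
  let ?P = "kernel_map (tuples k B) (tensor_kernel K)"
  have "tensor_power k W \<subseteq> {t. ?P t \<in> tensor_power k W'}"
    unfolding tensor_power_def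
  proof (rule fvs.span_minimal)
    show "{tensor ws |ws. length ws = k \<and> set ws \<subseteq> W}
        \<subseteq> {t. ?P t \<in> fvs.span {tensor ws |ws. length ws = k \<and> set ws \<subseteq> W'}}"
    proof clarify
      fix ws assume ws: "set ws \<subseteq> W" and k: "k = length ws"
      show "kernel_map (tuples (length ws) B) (tensor_kernel K) (tensor ws)
          \<in> fvs.span {tensor wsa |wsa. length wsa = length ws \<and> set wsa \<subseteq> W'}"
        unfolding kernel_map_tensor
      proof (rule fvs.span_base, intro CollectI exI conjI)
        show "set (map (kernel_map B K) ws) \<subseteq> W'" using ws W by fastforce
      qed simp_all
    qed
    show "fvs.subspace {t. ?P t \<in> fvs.span {tensor ws |ws. length ws = k \<and> set ws \<subseteq> W'}}"
      by (rule fvs.subspaceI)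
         (auto simp: kernel_map_zero kernel_map_add kernel_map_scale
           intro: fvs.span_zero fvs.span_add fvs.span_scale)
  qed
  then have "?P t \<in> tensor_power k W'" using t by (auto simp: sym_power_def)
  moreover have "?P t (permute_list \<sigma> l) = ?P t l" if \<sigma>: "\<sigma> permutes {..<k}" and l: "length l = k" for \<sigma> l
  proof -
    have "?P t (permute_list \<sigma> l)
        = (\<Sum>l'\<in>tuples k B. tensor_kernel K (permute_list \<sigma> l) (permute_list \<sigma> l') * t (permute_list \<sigma> l'))"
      unfolding kernel_map_def by (rule sum.reindex_bij_betw[OF bij_betw_permute_list[OF \<sigma>], symmetric])
    also have "\<dots> = ?P t l"
      unfolding kernel_map_def
      using \<sigma> l t by (intro sum.cong refl) (auto simp: tensor_kernel_permute tuples_def sym_power_def)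
    finally show ?thesis .
  qed
  ultimately show ?thesis by (auto simp: sym_power_def)
qed

lemma cnj_fun_sym_power:
  assumes W: "\<And>w. w \<in> W \<Longrightarrow> cnj_fun w \<in> W'" and t: "t \<in> sym_power k W"
  shows "cnj_fun t \<in> sym_power k W'"
proof -
  have "tensor_power k W \<subseteq> {t. cnj_fun t \<in> tensor_power k W'}"
    unfolding tensor_power_def
  proof (rule fvs.span_minimal)
    show "{tensor ws |ws. length ws = k \<and> set ws \<subseteq> W}
        \<subseteq> {t. cnj_fun t \<in> fvs.span {tensor ws |ws. length ws = k \<and> set ws \<subseteq> W'}}"
    proof clarify
      fix ws assume ws: "set ws \<subseteq> W" and k: "k = length ws"
      have "cnj_fun (tensor ws) = tensor (map cnj_fun ws)"
        by (auto simp: cnj_fun_def tensor_def fun_eq_iff)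
      then show "cnj_fun (tensor ws)
          \<in> fvs.span {tensor wsa |wsa. length wsa = length ws \<and> set wsa \<subseteq> W'}"
        using ws W by (intro fvs.span_base) (force intro!: exI[of _ "map cnj_fun ws"])
    qed
    show "fvs.subspace {t. cnj_fun t \<in> fvs.span {tensor ws |ws. length ws = k \<and> set ws \<subseteq> W'}}"
      by (rule fvs.subspaceI)
         (auto simp: cnj_fun_add cnj_fun_scale intro: fvs.span_zero fvs.span_add fvs.span_scale)
  qed
  then show ?thesis using t by (auto simp: sym_power_def cnj_fun_def)
qed

lemma sym_power_subspace: "fvs.subspace (sym_power k W)"
  unfolding sym_power_def tensor_power_def
  by (rule fvs.subspaceI) (auto intro: fvs.span_zero fvs.span_add fvs.span_scale, simp add: fscale_def)

lemma sym_power_mono: "W \<subseteq> W' \<Longrightarrow> sym_power k W \<subseteq> sym_power k W'"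
proof -
  assume "W \<subseteq> W'"
  then have "tensor_power k W \<subseteq> tensor_power k W'"
    unfolding tensor_power_def by (intro fvs.span_mono) blast
  then show ?thesis by (auto simp: sym_power_def)
qed

lemma sym_power_supported: "W \<subseteq> supported B \<Longrightarrow> sym_power k W \<subseteq> supported (tuples k B)"
  using tensor_power_support[of W B _ k] by (auto simp: sym_power_def supported_def subset_eq)


section \<open>Evaluating phi by pairing with powers of \<open>v_o m\<close>\<close>

section \<open>The homomorphism as a pairing\<close>

text \<open>Decomposable tensors pair factor by factor. Taking \<open>f\<close> constant gives the
  pairing with a power of one fixed vector.\<close>

lemma bil_tensor:
  "bil (tuples (length ws) A) (tensor (map f ws)) (tensor (map g ws)) = (\<Prod>w\<leftarrow>ws. bil A (f w) (g w))"
proof (induction ws)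
  case Nil
  have "tuples 0 A = {[]}" by (auto simp: tuples_def)
  then show ?case by (simp add: bil_def tensor_Nil)
next
  case (Cons w ws)
  have inj: "inj_on (\<lambda>(b, l). b # l) (A \<times> tuples (length ws) A)"
    by (auto simp: inj_on_def)
  have "bil (tuples (length (w # ws)) A) (tensor (map f (w # ws))) (tensor (map g (w # ws)))
      = (\<Sum>(b, l)\<in>A \<times> tuples (length ws) A.
          (f w b * g w b) * (tensor (map f ws) l * tensor (map g ws) l))"
    unfolding bil_def length_Cons tuples_Suc sum.reindex[OF inj]
    by (intro sum.cong refl) (simp add: case_prod_beta tensor_Cons_Cons)
  also have "\<dots> = bil A (f w) (g w) * bil (tuples (length ws) A) (tensor (map f ws)) (tensor (map g ws))"
    unfolding bil_def sum_product sum.cartesian_product ..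
  finally show ?case by (simp add: Cons.IH)
qed

lemma v_o_pairing_eq_bil:
  assumes "X \<in> carrier_mat m i"
  shows "v_o_pairing m i w X
    = bil (tuples m {..<m}) (v_o m) (kernel_map (tuples m {..<i}) (tensor_kernel (mat_kernel X)) w)"
  using assms by (simp add: v_o_pairing_def bil_def kernel_map_def sum_distrib_left mult_ac)

section \<open>Symmetrisation and the product of the symmetric algebra\<close>

lemma tensor_mult_singleton:
  "tensor_mult (tensor [w]) b [] = 0" "tensor_mult (tensor [w]) b (x # l) = w x * b l"
proof -
  show "tensor_mult (tensor [w]) b [] = 0" by (simp add: tensor_mult_def tensor_Cons_Nil)
  have "tensor [w] (take k (x # l)) * b (drop k (x # l)) = (if k = 1 then w x * b l else 0)"
    if "k \<le> length (x # l)" for k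
    using that by (cases k) (auto simp: tensor_def min_def)
  then have "tensor_mult (tensor [w]) b (x # l) = (\<Sum>k\<le>length (x # l). if k = 1 then w x * b l else 0)"
    unfolding tensor_mult_def by (intro sum.cong) auto
  also have "\<dots> = w x * b l" by (subst sum.delta) auto
  finally show "tensor_mult (tensor [w]) b (x # l) = w x * b l" .
qed

lemma tensor_mult_singleton_tensor: "tensor_mult (tensor [w]) (tensor ws) = tensor (w # ws)"
proof
  fix l show "tensor_mult (tensor [w]) (tensor ws) l = tensor (w # ws) l"
    by (cases l) (simp_all add: tensor_mult_singleton tensor_Cons_Cons tensor_Cons_Nil)
qed

lemma symmetrise_mset_cong:
  assumes "mset L = mset L'"
  shows "symmetrise u L = symmetrise u L'"
proof -
  obtain \<tau> where \<tau>: "\<tau> permutes {..<length L'}" "permute_list \<tau> L' = L"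
    using mset_eq_permutation[OF assms] .
  have "(\<Sum>\<sigma> | \<sigma> permutes {..<length L'}. u (permute_list \<sigma> L'))
      = (\<Sum>\<sigma> | \<sigma> permutes {..<length L'}. u (permute_list (\<tau> \<circ> \<sigma>) L'))"
    by (rule setum_permutations_compose_left[OF \<tau>(1)])
  also have "\<dots> = (\<Sum>\<sigma> | \<sigma> permutes {..<length L'}. u (permute_list \<sigma> L))"
    by (intro sum.cong refl) (use \<tau>(2) in \<open>auto simp: permute_list_compose\<close>)
  finally show ?thesis
    using mset_eq_length[OF assms] by (simp add: symmetrise_def)
qed

lemma symmetrise_supported:
  assumes "u \<in> supported (tuples n B)"
  shows "symmetrise u \<in> supported (tuples n B)"
  unfolding supported_def
proof (intro CollectI allI impI)
  fix L assume "symmetrise u L \<noteq> 0"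
  then have "(\<Sum>\<sigma> | \<sigma> permutes {..<length L}. u (permute_list \<sigma> L)) \<noteq> 0"
    by (auto simp: symmetrise_def)
  then obtain \<sigma> where "\<sigma> permutes {..<length L}" "u (permute_list \<sigma> L) \<noteq> 0"
    using sum.not_neutral_contains_not_neutral
      [of "\<lambda>\<sigma>. u (permute_list \<sigma> L)" "{\<sigma>. \<sigma> permutes {..<length L}}"] by blast
  moreover from this have "permute_list \<sigma> L \<in> tuples n B"
    using assms unfolding supported_def by blast
  ultimately show "L \<in> tuples n B" by (simp add: tuples_def)
qed

text \<open>The indicator functions \<open>q\<close> of rearrangement classes recover the coefficients of a symmetrisation.\<close>

lemma symmetrise_eqI:
  fixes u u' :: "'b list \<Rightarrow> complex"
  assumes B: "finite B" and u: "u \<in> supported (tuples n B)" and u': "u' \<in> supported (tuples n B)"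
    and ev: "\<And>q. (\<And>L L'. mset L = mset L' \<Longrightarrow> q L = q L') \<Longrightarrow> ev q u = ev q u'"
  shows "symmetrise u = symmetrise u'"
proof
  fix L :: "'b list"
  define C where "C = {L'. mset L' = mset L}"
  define q :: "'b list \<Rightarrow> complex" where "q = (\<lambda>L'. if L' \<in> C then 1 else 0)"
  have "C \<subseteq> {L'. set L' \<subseteq> set L \<and> length L' = length L}"
    unfolding C_def using mset_eq_setD mset_eq_length by blast
  then have finC: "finite C" using finite_lists_length_eq[of "set L" "length L"] finite_subset by blast
  have q: "q L' = q L''" if "mset L' = mset L''" for L' L'' using that by (simp add: q_def C_def)
  have key: "ev q v = of_nat (card C) * symmetrise v L" if v: "v \<in> supported (tuples n B)" for v
  proof -
    have fin: "finite (C \<union> tuples n B)" using finC B by (simp add: finite_tuples)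
    have "finite {L. v L \<noteq> 0}"
      using v by (intro finite_subset[OF _ finite_tuples[OF B]]) (auto simp: supported_def)
    then have "ev q v = ev q (symmetrise v)" using ev_symmetrise q by metis
    also have "\<dots> = (\<Sum>L'\<in>C \<union> tuples n B. symmetrise v L' * q L')"
      using symmetrise_supported[OF v] by (intro ev_eq fin) (auto simp: supported_def)
    also have "\<dots> = (\<Sum>L'\<in>C. symmetrise v L' * q L')"
      using fin by (intro sum.mono_neutral_right) (auto simp: q_def)
    also have "\<dots> = (\<Sum>L'\<in>C. symmetrise v L)"
      by (intro sum.cong refl) (auto simp: q_def C_def intro: symmetrise_mset_cong)
    finally show ?thesis by simp
  qed
  have "C \<noteq> {}" by (auto simp: C_def)
  then show "symmetrise u L = symmetrise u' L"
    using key[OF u] key[OF u'] ev[OF q] finC by simp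
qed

lemma ev_tensor_mult_singleton:
  assumes w: "w \<in> supported B" "finite B" and b: "b \<in> supported (tuples n B)"
  shows "ev q (tensor_mult (tensor [w]) b) = (\<Sum>x\<in>B. w x * ev (\<lambda>l. q (x # l)) b)"
proof -
  have inj: "inj_on (\<lambda>(x, l). x # l) (B \<times> tuples n B)" by (auto simp: inj_on_def)
  have "ev q (tensor_mult (tensor [w]) b)
      = (\<Sum>L\<in>(\<lambda>(x, l). x # l) ` (B \<times> tuples n B). tensor_mult (tensor [w]) b L * q L)"
  proof (rule ev_eq)
    fix L assume "tensor_mult (tensor [w]) b L \<noteq> 0"
    then show "L \<in> (\<lambda>(x, l). x # l) ` (B \<times> tuples n B)"
      using w b by (cases L) (auto simp: tensor_mult_singleton supported_def)
  qed (use w finite_tuples in auto)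
  also have "\<dots> = (\<Sum>(x, l)\<in>B \<times> tuples n B. w x * b l * q (x # l))"
    unfolding sum.reindex[OF inj] by (intro sum.cong refl) (auto simp: tensor_mult_singleton)
  also have "\<dots> = (\<Sum>x\<in>B. \<Sum>l\<in>tuples n B. w x * (b l * q (x # l)))"
    by (simp add: sum.cartesian_product mult.assoc)
  also have "\<dots> = (\<Sum>x\<in>B. w x * ev (\<lambda>l. q (x # l)) b)"
    using ev_eq[OF finite_tuples[OF w(2)], of b n] b
    by (simp add: supported_def sum_distrib_left)
  finally show ?thesis .
qed

lemma tensor_supported:
  assumes "set ws \<subseteq> supported B"
  shows "tensor ws \<in> supported (tuples (length ws) B)"
proof -
  have "tensor ws \<in> tensor_power (length ws) (supported B)"
    unfolding tensor_power_def using assms by (intro fvs.span_base) auto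
  then show ?thesis
    using tensor_power_support[of "supported B" B "tensor ws" "length ws"] by (auto simp: supported_def)
qed

text \<open>Symmetrising the tail first makes no difference to the final symmetrisation: a
  permutation-invariant test function stays invariant after fixing its first index, so it does not
  see the inner symmetrisation. This exhibits symmetrised tensors as products of elements of degree
  one.\<close>

lemma symmetrise_tensor_Cons:
  assumes B: "finite B" and ws: "set (w # ws) \<subseteq> supported B"
  shows "symmetrise (tensor (w # ws)) = sym_mult (tensor [w]) (symmetrise (tensor ws))"
proof -
  have t: "tensor ws \<in> supported (tuples (length ws) B)" using ws by (intro tensor_supported) auto
  have fin: "finite {l. tensor ws l \<noteq> 0}"
    using t by (intro finite_subset[OF _ finite_tuples[OF B]]) (auto simp: supported_def)
  have supp: "tensor_mult (tensor [w]) b \<in> supported (tuples (Suc (length ws)) B)"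
    if "b \<in> supported (tuples (length ws) B)" for b
    unfolding supported_def
  proof (intro CollectI allI impI)
    fix L assume "tensor_mult (tensor [w]) b L \<noteq> 0"
    then show "L \<in> tuples (Suc (length ws)) B"
      using that ws by (cases L) (auto simp: tensor_mult_singleton supported_def tuples_def)
  qed
  have "symmetrise (tensor_mult (tensor [w]) (tensor ws))
      = symmetrise (tensor_mult (tensor [w]) (symmetrise (tensor ws)))"
  proof (rule symmetrise_eqI[OF B supp[OF t] supp[OF symmetrise_supported[OF t]]])
    fix q :: "'a list \<Rightarrow> complex" assume q: "\<And>L L'. mset L = mset L' \<Longrightarrow> q L = q L'"
    have "ev (\<lambda>l. q (x # l)) (symmetrise (tensor ws)) = ev (\<lambda>l. q (x # l)) (tensor ws)" for x
      by (rule ev_symmetrise[OF fin]) (auto intro: q)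
    then show "ev q (tensor_mult (tensor [w]) (tensor ws))
        = ev q (tensor_mult (tensor [w]) (symmetrise (tensor ws)))"
      using ws ev_tensor_mult_singleton[OF _ B t] ev_tensor_mult_singleton[OF _ B symmetrise_supported[OF t]]
      by simp
  qed
  then show ?thesis by (simp add: sym_mult_def tensor_mult_singleton_tensor)
qed

lemma symmetrise_add: "symmetrise (s + t) = symmetrise s + symmetrise t"
  and symmetrise_scale: "symmetrise (fscale c s) = fscale c (symmetrise s)"
  and symmetrise_zero: "symmetrise 0 = 0"
  by (simp_all add: symmetrise_def fscale_def fun_eq_iff sum.distrib add_divide_distrib sum_distrib_left)

lemma symmetrise_sym_power:
  assumes "t \<in> sym_power k (W :: ('b \<Rightarrow> complex) set)"
  shows "symmetrise t = t"
proof
  fix l :: "'b list"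
  show "symmetrise t l = t l"
  proof (cases "length l = k")
    case True
    then have "symmetrise t l = (\<Sum>\<sigma> | \<sigma> permutes {..<k}. t l) / fact k"
      unfolding symmetrise_def
      using assms by (intro arg_cong2[of _ _ _ _ "(/)"] sum.cong) (auto simp: sym_power_def)
    then show ?thesis using card_permutations[of "{..<k}" k] by simp
  next
    case False
    have "t l' = 0" if "length l' \<noteq> k" for l'
      using tensor_power_support[of W UNIV t k l'] assms that by (auto simp: sym_power_def tuples_def)
    then show ?thesis using False by (simp add: symmetrise_def)
  qed
qed

text \<open>Permuting the indices by a permutation amounts to permuting the factors by its inverse,
  and the sum over the symmetric group absorbs the inversion.\<close>

lemma symmetrise_tensor:
  "symmetrise (tensor ws) = fscale (1 / fact (length ws))
     (\<Sum>\<sigma> | \<sigma> permutes {..<length ws}. tensor (permute_list \<sigma> ws))"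
proof
  let ?n = "length ws" and ?P = "{\<sigma>. \<sigma> permutes {..<length ws}}"
  have sum_apply: "sum F A l = (\<Sum>a\<in>A. F a l)"
    for F :: "(nat \<Rightarrow> nat) \<Rightarrow> 'a list \<Rightarrow> complex" and A l
    by (induction A rule: infinite_finite_induct) auto
  have eq: "tensor (permute_list (inv_into UNIV \<sigma>) ws) l = tensor ws (permute_list \<sigma> l)"
    if \<sigma>: "\<sigma> permutes {..<?n}" and l: "length l = ?n" for \<sigma> l
  proof -
    have i: "inv_into UNIV \<sigma> permutes {..<?n}" using permutes_inv[OF \<sigma>] .
    have "(\<Prod>p<?n. (ws ! inv_into UNIV \<sigma> p) (l ! p))
        = (\<Prod>p<?n. (ws ! inv_into UNIV \<sigma> (\<sigma> p)) (l ! \<sigma> p))"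
      using prod.permute[OF \<sigma>, of "\<lambda>p. (ws ! inv_into UNIV \<sigma> p) (l ! p)"] by (simp add: comp_def)
    then show ?thesis
      using l i \<sigma> by (simp add: tensor_def permute_list_nth permutes_inverses(2)[OF \<sigma>])
  qed
  fix l
  show "symmetrise (tensor ws) l = fscale (1 / fact ?n) (\<Sum>\<sigma>\<in>?P. tensor (permute_list \<sigma> ws)) l"
  proof (cases "length l = ?n")
    case True
    have "(\<Sum>\<sigma>\<in>?P. tensor (permute_list \<sigma> ws) l)
        = (\<Sum>\<sigma>\<in>?P. tensor (permute_list (inv_into UNIV \<sigma>) ws) l)"
      by (rule sum_permutations_inverse)
    also have "\<dots> = (\<Sum>\<sigma>\<in>?P. tensor ws (permute_list \<sigma> l))"
      using eq True by (intro sum.cong refl) blast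
    finally show ?thesis using True by (simp add: symmetrise_def fscale_def sum_apply)
  next
    case False
    then show ?thesis by (simp add: symmetrise_def fscale_def sum_apply tensor_def)
  qed
qed

lemma symmetrise_tensor_in_sym_power:
  assumes "set ws \<subseteq> W"
  shows "symmetrise (tensor ws) \<in> sym_power (length ws) W"
proof -
  have "symmetrise (tensor ws) \<in> tensor_power (length ws) W"
    unfolding symmetrise_tensor tensor_power_def
  proof (intro fvs.span_scale fvs.span_sum fvs.span_base CollectI exI conjI)
    fix \<sigma> assume "\<sigma> \<in> {\<sigma>. \<sigma> permutes {..<length ws}}"
    then show "set (permute_list \<sigma> ws) \<subseteq> W" using assms by simp
  qed simp_all
  then show ?thesis
    by (auto simp: sym_power_def intro!: symmetrise_mset_cong mset_permute_list)
qed

lemma tensor_replicate_in_sym_power: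
  assumes "w \<in> W"
  shows "tensor (replicate k w) \<in> sym_power k W"
proof -
  have "permute_list \<sigma> (replicate k w) = replicate k w" if "\<sigma> permutes {..<k}" for \<sigma>
    using that permutes_in_image[OF that] by (intro nth_equalityI) (auto simp: permute_list_nth)
  then have 1: "(\<Sum>\<sigma> | \<sigma> permutes {..<k}. tensor (permute_list \<sigma> (replicate k w)))
      = (\<Sum>\<sigma> | \<sigma> permutes {..<k}. tensor (replicate k w))"
    by (intro sum.cong) auto
  have 2: "card {\<sigma>. \<sigma> permutes {..<k}} = fact k" using card_permutations[of "{..<k}" k] by simp
  have 3: "(\<Sum>\<sigma>\<in>P. t) = fscale (of_nat (card P)) t" for P :: "(nat \<Rightarrow> nat) set" and t :: "'a list \<Rightarrow> complex"
    by (induction P rule: infinite_finite_induct)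
       (simp_all add: fscale_def fun_eq_iff algebra_simps)
  have "symmetrise (tensor (replicate k w)) = fscale (1 / fact k) (fscale (fact k) (tensor (replicate k w)))"
    by (simp only: symmetrise_tensor length_replicate 1 2 3 of_nat_fact)
  also have "\<dots> = tensor (replicate k w)" by (simp add: fscale_def)
  finally have "symmetrise (tensor (replicate k w)) = tensor (replicate k w)" .
  moreover have "set (replicate k w) \<subseteq> W" using assms by auto
  ultimately show ?thesis using symmetrise_tensor_in_sym_power[of "replicate k w" W] by simp
qed

text \<open>\<open>v_o m\<close> is the symmetrisation of the tensor product of the basis
  vectors.\<close>

lemma v_o_in_sym_power: "v_o m \<in> sym_power m (coord_space m)"
proof -
  have "permute_list \<sigma> (map basis_vec [0..<m]) = map (\<lambda>p. basis_vec (\<sigma> p)) [0..<m]"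
    if "\<sigma> permutes {..<m}" for \<sigma>
    using that permutes_in_image[OF that] by (intro nth_equalityI) (auto simp: permute_list_nth)
  then have "v_o m = symmetrise (tensor (map basis_vec [0..<m]))"
    unfolding symmetrise_tensor v_o_def by (auto intro!: arg_cong2[of _ _ _ _ fscale] sum.cong)
  moreover have "set (map basis_vec [0..<m]) \<subseteq> coord_space m"
    by (auto simp: basis_vec_def coord_space_def)
  ultimately show ?thesis using symmetrise_tensor_in_sym_power[of "map basis_vec [0..<m]"] by auto
qed

lemma symmetrise_tensor_short:
  assumes "length ws \<le> 1"
  shows "symmetrise (tensor ws) = tensor ws"
proof
  fix l
  show "symmetrise (tensor ws) l = tensor ws l"
  proof (cases "length l = length ws")
    case True
    then consider "length l = 0" | "length l = 1" using assms by linarith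
    then show ?thesis
    proof cases
      case 1
      have "{\<sigma>. \<sigma> permutes {..<0 :: nat}} = {id}" by (simp only: lessThan_0 permutes_empty) simp
      then show ?thesis by (simp only: symmetrise_def 1) simp
    next
      case 2
      have "{\<sigma>. \<sigma> permutes {..<1 :: nat}} = {id}"
        by (simp only: lessThan_Suc lessThan_0 permutes_sing One_nat_def) simp
      then show ?thesis by (simp only: symmetrise_def 2) simp
    qed
  next
    case False
    then show ?thesis by (simp add: symmetrise_def tensor_def)
  qed
qed

lemma sym_power_subset_sym_algebra: "sym_power k W \<subseteq> sym_algebra W"
  unfolding sym_algebra_def by (intro subsetI fvs.span_base UN_I[OF UNIV_I])

text \<open>Multiplicativity reduces phi on a symmetrised tensor to the product of its degree-one
  values, and the pairing with a power of \<open>v_o m\<close> factors in the same way. Linearity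
  extends the agreement to all tensors, and symmetrisation fixes \<open>t\<close>.\<close>

lemma phi_eq_bil:
  assumes phi: "is_phi m i \<phi>" and t: "t \<in> sym_power j (sym_power m (coord_space i))"
    and X: "X \<in> carrier_mat m i"
  shows "\<phi> t X = bil (tuples j (tuples m {..<m})) (tensor (replicate j (v_o m)))
    (kernel_map (tuples j (tuples m {..<i})) (tensor_kernel (tensor_kernel (mat_kernel X))) t)"
    (is "_ = ?\<Psi> t")
proof -
  define W where "W = sym_power m (coord_space i)"
  define B where "B = tuples m {..<i}"
  have finB: "finite B" by (simp add: B_def finite_tuples)
  have W_supp: "W \<subseteq> supported B"
    unfolding W_def B_def by (intro sym_power_supported) (simp add: coord_space_eq_supported)
  have lin: "linear_map_on (sym_algebra W) \<phi>"
    and unit: "\<phi> (tensor []) X = 1"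
    and mult: "\<And>s t. s \<in> sym_algebra W \<Longrightarrow> t \<in> sym_algebra W \<Longrightarrow> \<phi> (sym_mult s t) = \<phi> s * \<phi> t"
    and deg1: "\<And>v. v \<in> W \<Longrightarrow> \<phi> (tensor [v]) = v_o_pairing m i v"
    using phi X unfolding is_phi_def Let_def W_def by simp_all
  have gen: "\<phi> (symmetrise (tensor ws)) X = (\<Prod>w\<leftarrow>ws. v_o_pairing m i w X)" if "set ws \<subseteq> W" for ws
    using that
  proof (induction ws)
    case Nil
    show ?case using unit by (simp add: symmetrise_tensor_short)
  next
    case (Cons w ws)
    have "symmetrise (tensor [w]) \<in> sym_power 1 W"
      using symmetrise_tensor_in_sym_power[of "[w]" W] Cons.prems by simp
    moreover have "symmetrise (tensor [w]) = tensor [w]"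
      by (simp add: symmetrise_tensor_short)
    ultimately have "tensor [w] \<in> sym_algebra W" using sym_power_subset_sym_algebra by auto
    moreover have "symmetrise (tensor ws) \<in> sym_algebra W"
      using symmetrise_tensor_in_sym_power[of ws W] Cons.prems sym_power_subset_sym_algebra by auto
    moreover have "symmetrise (tensor (w # ws)) = sym_mult (tensor [w]) (symmetrise (tensor ws))"
      using Cons.prems W_supp by (intro symmetrise_tensor_Cons[OF finB]) auto
    ultimately have "\<phi> (symmetrise (tensor (w # ws))) X = \<phi> (tensor [w]) X * \<phi> (symmetrise (tensor ws)) X"
      by (simp only: mult times_fun_apply)
    then show ?case using Cons deg1[of w] by (simp only: list.set list.map prod_list.Cons insert_subset)
  qed
  \<comment> \<open>Membership of the symmetrisation is part of the set because phi is linear only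
    on the symmetric algebra; without it the set could not be shown to be a subspace.\<close>
  have "tensor_power j W \<subseteq> {s. symmetrise s \<in> sym_power j W \<and> \<phi> (symmetrise s) X = ?\<Psi> s}"
    unfolding tensor_power_def
  proof (rule fvs.span_minimal)
    show "{tensor ws |ws. length ws = j \<and> set ws \<subseteq> W}
        \<subseteq> {s. symmetrise s \<in> sym_power j W \<and> \<phi> (symmetrise s) X = ?\<Psi> s}"
    proof clarify
      fix ws assume ws: "set ws \<subseteq> W" and j: "j = length ws"
      have "?\<Psi> (tensor ws) = (\<Prod>w\<leftarrow>ws. v_o_pairing m i w X)"
        using bil_tensor[of ws "tuples m {..<m}" "\<lambda>_. v_o m" "kernel_map B (tensor_kernel (mat_kernel X))"]
          v_o_pairing_eq_bil[OF X]
        by (simp add: j kernel_map_tensor B_def map_replicate_const)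
      then show "symmetrise (tensor ws) \<in> sym_power (length ws) W
          \<and> \<phi> (symmetrise (tensor ws)) X = bil (tuples (length ws) (tuples m {..<m})) (tensor (replicate (length ws) (v_o m)))
    (kernel_map (tuples (length ws) (tuples m {..<i})) (tensor_kernel (tensor_kernel (mat_kernel X))) (tensor ws))"
        using symmetrise_tensor_in_sym_power[OF ws] gen[OF ws] by (simp add: j)
    qed
    have sub: "x \<in> sym_power j W \<Longrightarrow> x \<in> sym_algebra W" for x
      using sym_power_subset_sym_algebra by auto
    have add: "\<phi> (x + y) = \<phi> x + \<phi> y" if "x \<in> sym_power j W" "y \<in> sym_power j W" for x y
      using lin sub[OF that(1)] sub[OF that(2)] by (simp only: linear_map_on_def)
    have scale: "\<phi> (fscale c x) = fscale c (\<phi> x)" if "x \<in> sym_power j W" for c x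
      using lin sub[OF that] by (simp only: linear_map_on_def)
    show "fvs.subspace {s. symmetrise s \<in> sym_power j W \<and> \<phi> (symmetrise s) X = ?\<Psi> s}"
      unfolding fvs.subspace_def mem_Collect_eq symmetrise_zero symmetrise_add symmetrise_scale
          kernel_map_zero kernel_map_add kernel_map_scale bil_simps
    proof (intro conjI ballI allI; (unfold mem_Collect_eq)?, (elim conjE)?)
      show 0: "0 \<in> sym_power j W" by (rule fvs.subspace_0[OF sym_power_subspace])
      show "\<phi> 0 X = 0" using scale[OF 0, of 0] by (simp add: fscale_def zero_fun_def)
    next
      fix x y assume *: "symmetrise x \<in> sym_power j W" "\<phi> (symmetrise x) X = ?\<Psi> x"
        "symmetrise y \<in> sym_power j W" "\<phi> (symmetrise y) X = ?\<Psi> y"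
      show "symmetrise x + symmetrise y \<in> sym_power j W"
        by (rule fvs.subspace_add[OF sym_power_subspace *(1,3)])
      show "\<phi> (symmetrise x + symmetrise y) X = ?\<Psi> x + ?\<Psi> y"
        unfolding add[OF *(1,3)] plus_fun_apply *(2,4) ..
    next
      fix c x assume *: "symmetrise x \<in> sym_power j W" "\<phi> (symmetrise x) X = ?\<Psi> x"
      show "fscale c (symmetrise x) \<in> sym_power j W"
        by (rule fvs.subspace_scale[OF sym_power_subspace *(1)])
      show "\<phi> (fscale c (symmetrise x)) X = c * ?\<Psi> x"
        by (subst scale[OF *(1)], subst fscale_def, subst *(2), rule refl)
    qed
  qed
  then have *: "\<phi> (symmetrise s) X = ?\<Psi> s" if "s \<in> tensor_power j W" for s
    using that by blast
  have "t \<in> tensor_power j W" using t by (simp add: sym_power_def W_def)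
  from *[OF this] show ?thesis unfolding symmetrise_sym_power[OF t] .
qed

text \<open>Needed because \<open>\<phi> t = 0\<close> is an equality of functions on matrices of
  all sizes.\<close>

lemma phi_eq_0_outside:
  assumes phi: "is_phi m i \<phi>" and t: "t \<in> sym_power j (sym_power m (coord_space i))"
    and X: "X \<notin> carrier_mat m i"
  shows "\<phi> t X = 0"
proof -
  have "\<phi> t \<in> hom_poly_funs m i (m * j)" using phi t by (auto simp: is_phi_def Let_def)
  also have "\<dots> \<subseteq> supported (carrier_mat m i)"
    unfolding hom_poly_funs_def
    by (rule fvs.span_minimal[OF _ supported_subspace]) (auto simp: supported_def split: if_splits)
  finally show ?thesis using X by (auto simp: supported_def)
qed


section \<open>GL(n) and its stability under transposition and conjugation\<close>

section \<open>The general linear group\<close>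

lemma carrier_GL: "g \<in> carrier (GL n) \<longleftrightarrow> g \<in> carrier_mat n n \<and> det g \<noteq> 0"
proof
  assume "g \<in> carrier (GL n)"
  then have g: "g \<in> Units (ring_mat TYPE(complex) n ())" by (simp add: GL_def units_of_def)
  then show "g \<in> carrier_mat n n \<and> det g \<noteq> 0"
    using unit_imp_det_non_zero[OF g] by (auto simp: Units_def ring_mat_def)
next
  assume "g \<in> carrier_mat n n \<and> det g \<noteq> 0"
  then show "g \<in> carrier (GL n)" by (auto simp: GL_def units_of_def intro: det_non_zero_imp_unit)
qed

lemma mult_GL: "g \<otimes>\<^bsub>GL n\<^esub> h = g * h"
  and one_GL: "\<one>\<^bsub>GL n\<^esub> = 1\<^sub>m n"
  by (simp_all add: GL_def units_of_def ring_mat_def)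

lemma group_GL: "group (GL n)"
  unfolding GL_def by (rule monoid.units_group) (rule ring.is_monoid, rule ring_mat)

lemma mult_in_GL: "g \<in> carrier (GL n) \<Longrightarrow> h \<in> carrier (GL n) \<Longrightarrow> g * h \<in> carrier (GL n)"
  using monoid.m_closed[OF group.is_monoid[OF group_GL]] by (simp add: mult_GL)

lemma one_in_GL: "1\<^sub>m n \<in> carrier (GL n)"
  by (simp add: carrier_GL)

lemma transpose_in_GL: "g \<in> carrier (GL n) \<Longrightarrow> transpose_mat g \<in> carrier (GL n)"
  by (auto simp: carrier_GL det_transpose)

lemma cnj_in_GL: "g \<in> carrier (GL n) \<Longrightarrow> map_mat cnj g \<in> carrier (GL n)"
proof -
  assume g: "g \<in> carrier (GL n)"
  interpret comm_ring_hom cnj by unfold_locales simp_all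
  have "det (map_mat cnj g) = cnj (det g)" by (rule hom_det)
  then show ?thesis using g by (auto simp: carrier_GL)
qed

section \<open>Diagonal maps, and passage to fewer coordinates\<close>

section \<open>Diagonal kernels and restriction of kernels\<close>

text \<open>The row index is unrestricted, so that images also vanish outside
  \<open>B\<close>.\<close>

definition diag_kernel :: "'b set \<Rightarrow> ('b \<Rightarrow> complex) \<Rightarrow> ('b \<Rightarrow> 'b \<Rightarrow> complex) \<Rightarrow> bool" where
  "diag_kernel B \<chi> K \<longleftrightarrow> (\<forall>a. \<forall>b\<in>B. K a b = (if a = b then \<chi> b else 0))"

lemma diag_kernel_tensor:
  assumes "diag_kernel B \<chi> K"
  shows "diag_kernel (tuples k B) (\<lambda>l. \<Prod>b\<leftarrow>l. \<chi> b) (tensor_kernel K)"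
  unfolding diag_kernel_def
proof (intro allI ballI)
  fix l l' :: "'a list" assume l': "l' \<in> tuples k B"
  show "tensor_kernel K l l' = (if l = l' then \<Prod>b\<leftarrow>l'. \<chi> b else 0)"
    using l'
  proof (induction l' arbitrary: l k)
    case Nil
    then show ?case by (simp add: tensor_kernel_def)
  next
    case (Cons b l')
    then have b: "b \<in> B" "l' \<in> tuples (length l') B" by (auto simp: tuples_def)
    show ?case
    proof (cases l)
      case Nil
      then show ?thesis by (simp add: tensor_kernel_def)
    next
      case (Cons a l0)
      then show ?thesis
        using assms b Cons.IH[OF b(2), of l0] by (simp add: tensor_kernel_Cons diag_kernel_def)
    qed
  qed
qed

lemma kernel_map_diag:
  assumes "finite B" "diag_kernel B \<chi> K" "t \<in> supported B"
  shows "kernel_map B K t = (\<lambda>a. \<chi> a * t a)"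
proof
  fix a
  have "kernel_map B K t a = (\<Sum>b\<in>B. if a = b then \<chi> b * t b else 0)"
    unfolding kernel_map_def using assms(2) by (intro sum.cong) (auto simp: diag_kernel_def)
  also have "\<dots> = \<chi> a * t a" using assms(1,3) by (auto simp: supported_def)
  finally show "kernel_map B K t a = \<chi> a * t a" .
qed

lemma tensor_kernel_cong:
  assumes "\<And>a b. a \<in> A \<Longrightarrow> b \<in> B \<Longrightarrow> K a b = K' a b" and "l \<in> tuples k A" "l' \<in> tuples k' B"
  shows "tensor_kernel K l l' = tensor_kernel K' l l'"
proof (cases "length l = length l'")
  case True
  have "l ! p \<in> A" "l' ! p \<in> B" if "p < length l" for p
    using assms(2,3) that True by (auto simp: tuples_def)
  then show ?thesis using True assms(1) by (simp add: tensor_kernel_def)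
qed (simp add: tensor_kernel_def)

lemma tensor_kernel_cong_right:
  assumes "\<And>a b. b \<in> B \<Longrightarrow> K a b = K' a b" and "l' \<in> tuples k' B"
  shows "tensor_kernel K l l' = tensor_kernel K' l l'"
  using assms by (intro tensor_kernel_cong[of UNIV B _ _ _ "length l"]) (auto simp: tuples_def)

text \<open>Stated at a single row \<open>a\<close>, so that the two kernels may be compared on
  selected rows only.\<close>

lemma kernel_map_restrict:
  assumes "finite B" "D \<subseteq> B" "t \<in> supported D" "\<And>b. b \<in> D \<Longrightarrow> K a b = K' a b"
  shows "kernel_map B K t a = kernel_map D K' t a"
proof -
  have "kernel_map B K t a = (\<Sum>b\<in>D. K a b * t b)"
    unfolding kernel_map_def
    using assms(1-3) by (intro sum.mono_neutral_right) (auto simp: supported_def)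
  then show ?thesis unfolding kernel_map_def using assms(4) by simp
qed

lemma bil_restrict:
  assumes "finite B" "D \<subseteq> B" "x \<in> supported D"
  shows "bil B x y = bil D x y"
  unfolding bil_def using assms by (intro sum.mono_neutral_right) (auto simp: supported_def)

lemma tuples_mono: "D \<subseteq> B \<Longrightarrow> tuples k D \<subseteq> tuples k B"
  by (auto simp: tuples_def)

section \<open>GL(n) acting on S^j(S^m(C^n)): composition, adjoints, conjugation\<close>

section \<open>The action on iterated symmetric powers\<close>

abbreviation idx :: "nat \<Rightarrow> nat \<Rightarrow> nat \<Rightarrow> nat list list set" where
  "idx j m n \<equiv> tuples j (tuples m {..<n})"

abbreviation mat_kernel2 :: "complex mat \<Rightarrow> nat list list \<Rightarrow> nat list list \<Rightarrow> complex" where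
  "mat_kernel2 g \<equiv> tensor_kernel (tensor_kernel (mat_kernel g))"

abbreviation sym_sym :: "nat \<Rightarrow> nat \<Rightarrow> nat \<Rightarrow> (nat list list \<Rightarrow> complex) set" where
  "sym_sym j m n \<equiv> sym_power j (sym_power m (coord_space n))"

lemma finite_idx: "finite (idx j m n)"
  by (intro finite_tuples) simp

lemma idx_mono: "n \<le> n' \<Longrightarrow> idx j m n \<subseteq> idx j m n'"
  by (intro tuples_mono) auto

lemma sym_sym_supported: "sym_sym j m n \<subseteq> supported (idx j m n)"
  by (intro sym_power_supported) (simp add: coord_space_eq_supported)

lemma sym_sym_mono:
  assumes "n \<le> n'"
  shows "sym_sym j m n \<subseteq> sym_sym j m n'"
  using assms by (intro sym_power_mono) (auto simp: coord_space_def)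

lemma cnj_fun_sym_sym: "t \<in> sym_sym j m n \<Longrightarrow> cnj_fun t \<in> sym_sym j m n"
  by (erule cnj_fun_sym_power[rotated])+ (auto simp: coord_space_def cnj_fun_def)

lemma mat_kernel_transpose: "mat_kernel (transpose_mat A) = (\<lambda>b a. mat_kernel A a b)"
  by (auto simp: mat_kernel_def fun_eq_iff)

lemma mat_kernel_cnj: "mat_kernel (map_mat cnj A) = (\<lambda>a b. cnj (mat_kernel A a b))"
  by (auto simp: mat_kernel_def fun_eq_iff)

lemma mat_kernel_mult:
  assumes "A \<in> carrier_mat r n" "B \<in> carrier_mat n c"
  shows "mat_kernel (A * B) = (\<lambda>a c. \<Sum>b<n. mat_kernel A a b * mat_kernel B b c)"
  using assms
  by (auto simp: fun_eq_iff mat_kernel_def scalar_prod_def atLeast0LessThan intro!: sum.cong)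

lemma sym_sym_act_mult:
  assumes "A \<in> carrier_mat n n" "B \<in> carrier_mat n n"
  shows "sym_sym_act j m n A (sym_sym_act j m n B t) = sym_sym_act j m n (A * B) t"
proof -
  have 1: "(\<Sum>l'\<in>tuples m {..<n}. tensor_kernel (mat_kernel A) l l' * tensor_kernel (mat_kernel B) l' l'')
      = tensor_kernel (mat_kernel (A * B)) l l''" if "length l'' = m" for l l''
  proof (cases "length l = m")
    case True
    then show ?thesis using tensor_kernel_compose[where l = l and l'' = l'' and B = "{..<n}"
          and K = "mat_kernel A" and K' = "mat_kernel B"]
      by (simp add: mat_kernel_mult[OF assms])
  next
    case False
    then show ?thesis using that by (auto simp: tensor_kernel_def tuples_def intro!: sum.neutral)
  qed
  have 2: "(\<Sum>L'\<in>idx j m n. mat_kernel2 A L L' * mat_kernel2 B L' L'') = mat_kernel2 (A * B) L L''"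
    if L'': "L'' \<in> idx j m n" for L L''
  proof (cases "length L = j")
    case True
    have "(\<Sum>L'\<in>idx j m n. mat_kernel2 A L L' * mat_kernel2 B L' L'')
        = tensor_kernel (\<lambda>l l''. \<Sum>l'\<in>tuples m {..<n}.
            tensor_kernel (mat_kernel A) l l' * tensor_kernel (mat_kernel B) l' l'') L L''"
      using tensor_kernel_compose[where l = L and B = "tuples m {..<n}"] True by simp
    also have "\<dots> = mat_kernel2 (A * B) L L''"
      by (rule tensor_kernel_cong_right[OF _ L'']) (rule 1, simp add: tuples_def)
    finally show ?thesis .
  next
    case False
    then show ?thesis using that by (auto simp: tensor_kernel_def tuples_def intro!: sum.neutral)
  qed
  show ?thesis
    unfolding sym_sym_act_def kernel_map_kernel_map
    by (auto simp: kernel_map_def fun_eq_iff 2 intro!: sum.cong)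
qed

lemma sym_sym_act_one:
  assumes "t \<in> supported (idx j m n)"
  shows "sym_sym_act j m n (1\<^sub>m n) t = t"
proof -
  have "diag_kernel {..<n} (\<lambda>_. 1) (mat_kernel (1\<^sub>m n))"
    by (auto simp: diag_kernel_def mat_kernel_def)
  then have "diag_kernel (idx j m n) (\<lambda>L. \<Prod>l\<leftarrow>L. \<Prod>b\<leftarrow>l. 1) (mat_kernel2 (1\<^sub>m n))"
    by (intro diag_kernel_tensor)
  from kernel_map_diag[OF finite_idx this assms] show ?thesis
    by (simp add: sym_sym_act_def map_replicate_const)
qed

lemma bil_sym_sym_act:
  "bil (idx j m n) (sym_sym_act j m n A x) y = bil (idx j m n) x (sym_sym_act j m n (transpose_mat A) y)"
proof -
  have "mat_kernel2 (transpose_mat A) = (\<lambda>L' L. mat_kernel2 A L L')"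
    unfolding tensor_kernel_transpose[symmetric] mat_kernel_transpose ..
  then show ?thesis by (simp only: sym_sym_act_def bil_kernel_map)
qed

lemma cnj_fun_sym_sym_act:
  "cnj_fun (sym_sym_act j m n A t) = sym_sym_act j m n (map_mat cnj A) (cnj_fun t)"
  by (simp add: sym_sym_act_def cnj_fun_kernel_map cnj_tensor_kernel mat_kernel_cnj)

lemma sym_sym_act_add: "sym_sym_act j m n A (x + y) = sym_sym_act j m n A x + sym_sym_act j m n A y"
  and sym_sym_act_diff: "sym_sym_act j m n A (x - y) = sym_sym_act j m n A x - sym_sym_act j m n A y"
  and sym_sym_act_scale: "sym_sym_act j m n A (fscale c x) = fscale c (sym_sym_act j m n A x)"
  and sym_sym_act_zero: "sym_sym_act j m n A 0 = 0"
  unfolding sym_sym_act_def by (rule kernel_map_add kernel_map_diff kernel_map_scale kernel_map_zero)+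

lemma sym_sym_act_closed:
  assumes "A \<in> carrier_mat n n" "t \<in> sym_sym j m n"
  shows "sym_sym_act j m n A t \<in> sym_sym j m n"
  unfolding sym_sym_act_def
  by (intro kernel_map_sym_power[OF kernel_map_sym_power assms(2)])
     (use assms(1) in \<open>auto simp: coord_space_def kernel_map_def mat_kernel_def\<close>)

text \<open>The coordinate projection onto the first \<open>n\<close> coordinates maps into the
  smaller space by functoriality, while it fixes a tensor with indices below
  \<open>n\<close>.\<close>

lemma sym_sym_restrict:
  assumes t: "t \<in> sym_sym j m n'" "t \<in> supported (idx j m n)" and n: "n \<le> n'"
  shows "t \<in> sym_sym j m n"
proof -
  define K :: "nat \<Rightarrow> nat \<Rightarrow> complex" where "K = (\<lambda>a b. if a = b \<and> a < n then 1 else 0)"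
  have "diag_kernel {..<n} (\<lambda>_. 1) K" by (auto simp: diag_kernel_def K_def)
  then have d: "diag_kernel (idx j m n) (\<lambda>L. \<Prod>l\<leftarrow>L. \<Prod>b\<leftarrow>l. 1) (tensor_kernel (tensor_kernel K))"
    by (intro diag_kernel_tensor)
  have "kernel_map (idx j m n') (tensor_kernel (tensor_kernel K)) t \<in> sym_sym j m n"
    by (intro kernel_map_sym_power[OF kernel_map_sym_power t(1)])
       (auto simp: coord_space_def kernel_map_def K_def intro!: sum.neutral)
  also have "kernel_map (idx j m n') (tensor_kernel (tensor_kernel K)) t
      = kernel_map (idx j m n) (tensor_kernel (tensor_kernel K)) t"
    using kernel_map_restrict[OF finite_idx idx_mono[OF n] t(2)] by blast
  also have "\<dots> = t"
    using kernel_map_diag[OF finite_idx d t(2)] by (simp add: map_replicate_const)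
  finally show ?thesis .
qed

lemma sym_sym_act_smult:
  assumes A: "A \<in> carrier_mat n n"
  shows "sym_sym_act j m n (c \<cdot>\<^sub>m A) t = fscale (c ^ (j * m)) (sym_sym_act j m n A t)"
proof -
  have K: "mat_kernel (c \<cdot>\<^sub>m A) = (\<lambda>a b. c * mat_kernel A a b)"
    by (auto simp: mat_kernel_def fun_eq_iff)
  have "mat_kernel2 (c \<cdot>\<^sub>m A) L L' = c ^ (j * m) * mat_kernel2 A L L'" if L': "L' \<in> idx j m n" for L L'
  proof (cases "length L = j")
    case True
    have "tensor_kernel (mat_kernel (c \<cdot>\<^sub>m A)) l l' = c ^ m * tensor_kernel (mat_kernel A) l l'"
      if "l' \<in> tuples m {..<n}" for l l'
      unfolding K tensor_kernel_scale using that by (auto simp: tensor_kernel_def tuples_def)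
    then have "mat_kernel2 (c \<cdot>\<^sub>m A) L L'
        = tensor_kernel (\<lambda>l l'. c ^ m * tensor_kernel (mat_kernel A) l l') L L'"
      by (rule tensor_kernel_cong_right[OF _ L'])
    then show ?thesis by (simp add: tensor_kernel_scale True mult.commute flip: power_mult)
  next
    case False
    then show ?thesis using L' by (auto simp: tensor_kernel_def tuples_def)
  qed
  then show ?thesis
    by (auto simp: sym_sym_act_def kernel_map_def fscale_def fun_eq_iff sum_distrib_left mult.assoc
        intro!: sum.cong)
qed


section \<open>Density arguments through one-variable polynomials\<close>

section \<open>Functions that are polynomial along polynomial curves\<close>

definition poly_fun :: "(complex \<Rightarrow> complex) \<Rightarrow> bool" where
  "poly_fun f \<longleftrightarrow> (\<exists>p. f = poly p)"

lemma poly_fun_const: "poly_fun (\<lambda>s. c)"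
  unfolding poly_fun_def by (intro exI[of _ "[:c:]"]) (simp add: fun_eq_iff)

lemma poly_fun_id: "poly_fun (\<lambda>s. s)"
  unfolding poly_fun_def by (intro exI[of _ "[:0, 1:]"]) (simp add: fun_eq_iff)

lemma poly_fun_add: "poly_fun f \<Longrightarrow> poly_fun g \<Longrightarrow> poly_fun (\<lambda>s. f s + g s)"
  unfolding poly_fun_def by (elim exE, rule_tac x = "p + pa" in exI) (simp add: fun_eq_iff)

lemma poly_fun_diff: "poly_fun f \<Longrightarrow> poly_fun g \<Longrightarrow> poly_fun (\<lambda>s. f s - g s)"
  unfolding poly_fun_def by (elim exE, rule_tac x = "p - pa" in exI) (simp add: fun_eq_iff)

lemma poly_fun_mult: "poly_fun f \<Longrightarrow> poly_fun g \<Longrightarrow> poly_fun (\<lambda>s. f s * g s)"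
  unfolding poly_fun_def by (elim exE, rule_tac x = "p * pa" in exI) (simp add: fun_eq_iff)

lemma poly_fun_sum: "(\<And>a. a \<in> A \<Longrightarrow> poly_fun (f a)) \<Longrightarrow> poly_fun (\<lambda>s. \<Sum>a\<in>A. f a s)"
  by (induction A rule: infinite_finite_induct) (auto intro: poly_fun_const poly_fun_add)

lemma poly_fun_prod: "(\<And>a. a \<in> A \<Longrightarrow> poly_fun (f a)) \<Longrightarrow> poly_fun (\<lambda>s. \<Prod>a\<in>A. f a s)"
  by (induction A rule: infinite_finite_induct) (auto intro: poly_fun_const poly_fun_mult)

lemma poly_fun_prod_list: "(\<And>a. a \<in> set as \<Longrightarrow> poly_fun (f a)) \<Longrightarrow> poly_fun (\<lambda>s. \<Prod>a\<leftarrow>as. f a s)"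
  by (induction as) (auto intro: poly_fun_const poly_fun_mult)

lemma poly_fun_power: "poly_fun f \<Longrightarrow> poly_fun (\<lambda>s. f s ^ k)"
  by (induction k) (auto intro: poly_fun_const poly_fun_mult)

lemma poly_fun_eq_0:
  assumes "poly_fun f" "poly_fun g" "f s0 \<noteq> 0" "\<And>s. f s \<noteq> 0 \<Longrightarrow> g s = 0"
  shows "g s = 0"
proof -
  obtain p q where pq: "f = poly p" "g = poly q" using assms(1,2) by (auto simp: poly_fun_def)
  have "poly (p * q) s = 0" for s using assms(4)[of s] pq by auto
  then have "p * q = 0" using poly_all_0_iff_0 by blast
  then show ?thesis using pq assms(3) by auto
qed

definition poly_curve :: "nat \<Rightarrow> (complex \<Rightarrow> complex mat) \<Rightarrow> bool" where
  "poly_curve n C \<longleftrightarrow> (\<forall>s. C s \<in> carrier_mat n n) \<and> (\<forall>a<n. \<forall>b<n. poly_fun (\<lambda>s. C s $$ (a, b)))"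

text \<open>Polynomiality is tested on one-parameter curves only. Straight lines suffice for
  density, and the curve \<open>contract u\<close> later gives the torus limit.\<close>

definition poly_along :: "nat \<Rightarrow> (complex mat \<Rightarrow> complex) \<Rightarrow> bool" where
  "poly_along n f \<longleftrightarrow> (\<forall>C. poly_curve n C \<longrightarrow> poly_fun (\<lambda>s. f (C s)))"

lemma poly_along_const: "poly_along n (\<lambda>X. c)"
  by (simp add: poly_along_def poly_fun_const)

lemma poly_along_add: "poly_along n f \<Longrightarrow> poly_along n g \<Longrightarrow> poly_along n (\<lambda>X. f X + g X)"
  by (simp add: poly_along_def poly_fun_add)

lemma poly_along_diff: "poly_along n f \<Longrightarrow> poly_along n g \<Longrightarrow> poly_along n (\<lambda>X. f X - g X)"
  by (simp add: poly_along_def poly_fun_diff)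

lemma poly_along_mult: "poly_along n f \<Longrightarrow> poly_along n g \<Longrightarrow> poly_along n (\<lambda>X. f X * g X)"
  by (simp add: poly_along_def poly_fun_mult)

lemma poly_along_power: "poly_along n f \<Longrightarrow> poly_along n (\<lambda>X. f X ^ k)"
  by (simp add: poly_along_def poly_fun_power)

lemma poly_along_sum:
  "(\<And>a. a \<in> A \<Longrightarrow> poly_along n (F a)) \<Longrightarrow> poly_along n (\<lambda>X. \<Sum>a\<in>A. F a X)"
  unfolding poly_along_def by (rule allI, rule impI, rule poly_fun_sum) simp

lemma poly_along_prod:
  "(\<And>a. a \<in> A \<Longrightarrow> poly_along n (F a)) \<Longrightarrow> poly_along n (\<lambda>X. \<Prod>a\<in>A. F a X)"
  unfolding poly_along_def by (rule allI, rule impI, rule poly_fun_prod) simp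

lemma poly_along_entry:
  assumes "a < n" "b < n"
  shows "poly_along n (\<lambda>X. X $$ (a, b))"
  using assms by (simp add: poly_along_def poly_curve_def)

text \<open>On the line from \<open>A\<close> to \<open>X\<close>, \<open>P\<close> restricts to a
  polynomial that is nonzero at the start, and \<open>f\<close> vanishes wherever \<open>P\<close>
  does not; a product of two nonzero polynomials would not vanish identically.\<close>

lemma poly_along_dense:
  assumes f: "poly_along n f" and P: "poly_along n P"
    and A: "A \<in> carrier_mat n n" "P A \<noteq> 0"
    and 0: "\<And>X. X \<in> carrier_mat n n \<Longrightarrow> P X \<noteq> 0 \<Longrightarrow> f X = 0"
    and X: "X \<in> carrier_mat n n"
  shows "f X = 0"
proof -
  define C where "C = (\<lambda>s. A + s \<cdot>\<^sub>m (X - A))"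
  have C: "C s \<in> carrier_mat n n" for s
    unfolding C_def using A(1) by (intro add_carrier_mat smult_carrier_mat minus_carrier_mat)
  have "poly_fun (\<lambda>s. C s $$ (a, b))" if "a < n" "b < n" for a b
  proof -
    have "(\<lambda>s. C s $$ (a, b)) = (\<lambda>s. A $$ (a, b) + s * (X $$ (a, b) - A $$ (a, b)))"
      using that A X by (simp add: C_def fun_eq_iff)
    then show ?thesis
      by (simp add: poly_fun_add poly_fun_mult poly_fun_const poly_fun_id)
  qed
  then have curve: "poly_curve n C" using C by (simp add: poly_curve_def)
  have C0: "C 0 = A" and C1: "C 1 = X"
    unfolding C_def by (rule eq_matI; use A X in simp)+
  have pf: "poly_fun (\<lambda>s. P (C s))" "poly_fun (\<lambda>s. f (C s))"
    using f P curve by (simp_all add: poly_along_def)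
  have "P (C 0) \<noteq> 0" using A(2) C0 by metis
  from poly_fun_eq_0[OF pf this 0[OF C], of 1] show ?thesis unfolding C1 .
qed

lemma poly_along_cong:
  assumes "\<And>X. X \<in> carrier_mat n n \<Longrightarrow> f X = g X" "poly_along n g"
  shows "poly_along n f"
  using assms by (simp add: poly_along_def poly_curve_def)

definition leading_block :: "nat \<Rightarrow> complex mat \<Rightarrow> complex mat" where
  "leading_block k A = mat k k (\<lambda>(p, q). A $$ (p, q))"

lemma leading_block_carrier [simp]: "leading_block k A \<in> carrier_mat k k"
  by (simp add: leading_block_def)

lemma poly_along_leading_minor:
  assumes "k \<le> n"
  shows "poly_along n (\<lambda>X. det (leading_block k X))"
proof (rule poly_along_cong)
  fix X :: "complex mat"
  show "det (leading_block k X)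
      = (\<Sum>p | p permutes {0..<k}. of_int (sign p) * (\<Prod>a = 0..<k. X $$ (a, p a)))"
    unfolding det_def leading_block_def
    by (auto intro!: sum.cong prod.cong simp: permutes_in_image)
next
  show "poly_along n (\<lambda>X. \<Sum>p | p permutes {0..<k}. of_int (sign p) * (\<Prod>a = 0..<k. X $$ (a, p a)))"
  proof (intro poly_along_sum poly_along_mult poly_along_const poly_along_prod poly_along_entry)
    fix p a assume "p \<in> {p. p permutes {0..<k}}" "a \<in> {0..<k}"
    then have "p a \<in> {0..<k}" "a < k" using permutes_in_image[of p "{0..<k}" a] by auto
    then show "a < n" "p a < n" using assms by auto
  qed
qed

lemma leading_block_self: "A \<in> carrier_mat n n \<Longrightarrow> leading_block n A = A"
  by (auto simp: leading_block_def)

lemma poly_along_det: "poly_along n det"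
  by (rule poly_along_cong[OF _ poly_along_leading_minor[of n n]])
     (simp_all only: leading_block_self order_refl)

lemma poly_along_mat_kernel: "poly_along n (\<lambda>X. mat_kernel X a b)"
proof (rule poly_along_cong)
  show "poly_along n (\<lambda>X. if a < n \<and> b < n then X $$ (a, b) else 0)"
    by (cases "a < n \<and> b < n") (auto simp: poly_along_entry poly_along_const)
qed (auto simp: mat_kernel_def)

lemma poly_along_tensor_kernel:
  assumes "\<And>a b. poly_along n (\<lambda>X. K X a b)"
  shows "poly_along n (\<lambda>X. tensor_kernel (K X) l l')"
  using assms unfolding tensor_kernel_def
  by (cases "length l = length l'") (simp_all add: poly_along_const poly_along_prod)

lemma poly_along_sym_sym_act: "poly_along n (\<lambda>X. sym_sym_act j m n X t L)"
  unfolding sym_sym_act_def kernel_map_def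
  by (intro poly_along_sum poly_along_mult poly_along_const poly_along_tensor_kernel poly_along_mat_kernel)

lemma poly_along_poly_funs:
  assumes "f \<in> poly_funs n n"
  shows "poly_along n f"
proof -
  have sub: "fvs.subspace {f. poly_along n f}"
  proof (rule fvs.subspaceI, unfold mem_Collect_eq)
    show "poly_along n 0" unfolding zero_fun_def by (rule poly_along_const)
    show "poly_along n (f + g)" if "poly_along n f" "poly_along n g" for f g
      unfolding plus_fun_def using that by (rule poly_along_add)
    show "poly_along n (fscale c f)" if "poly_along n f" for c f
      unfolding fscale_def using poly_along_const that by (rule poly_along_mult)
  qed
  have "hom_poly_funs n n k \<subseteq> {f. poly_along n f}" for k
    unfolding hom_poly_funs_def
  proof (rule fvs.span_minimal[OF _ sub], clarify)
    fix ps :: "(nat \<times> nat) list" assume ps: "set ps \<subseteq> {..<n} \<times> {..<n}"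
    have "poly_along n (\<lambda>X. \<Prod>p\<leftarrow>ps. X $$ p)"
      unfolding poly_along_def
    proof (rule allI, rule impI, rule poly_fun_prod_list)
      fix C p assume C: "poly_curve n C" and "p \<in> set ps"
      then obtain a b where "p = (a, b)" "a < n" "b < n" using ps by auto
      then show "poly_fun (\<lambda>s. C s $$ p)" using C by (simp add: poly_curve_def)
    qed
    then show "poly_along n (\<lambda>X. if X \<in> carrier_mat n n then \<Prod>p\<leftarrow>ps. X $$ p else 0)"
      by (rule poly_along_cong[rotated]) simp
  qed
  then have "(\<Union>k. hom_poly_funs n n k) \<subseteq> {f. poly_along n f}" by (rule UN_least)
  from subsetD[OF fvs.span_minimal[OF this sub] assms[unfolded poly_funs_def]]
  show ?thesis by (rule CollectD)
qed

section \<open>Invariants inside S^i(S^m(C^n)) and the block matrices fixing them\<close>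

section \<open>Invariants of the special linear group\<close>

text \<open>Singular matrices are reached by density, the other ones are multiples of unimodular matrices.\<close>

lemma SL_invariants_act:
  assumes t: "t \<in> SL_invariants i m i" and A: "A \<in> carrier_mat i i" and i: "0 < i"
  shows "sym_sym_act i m i A t = fscale (det A ^ m) t"
proof -
  have nonsing: "sym_sym_act i m i A t = fscale (det A ^ m) t"
    if A: "A \<in> carrier_mat i i" and d: "det A \<noteq> 0" for A
  proof -
    \<comment> \<open>Dividing by an \<open>i\<close>-th root of the determinant lands in SL(i); the
      scalar \<open>c\<close> acts in total degree \<open>i * m\<close>, which yields
      \<open>det A ^ m\<close>.\<close>
    obtain c where c: "c ^ i = det A" using nth_root_exists[OF i, of "det A"] by blast
    have c0: "c \<noteq> 0" using c d i by (metis zero_power)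
    define S where "S = inverse c \<cdot>\<^sub>m A"
    have S_carrier: "S \<in> carrier_mat i i" using A by (simp add: S_def)
    have "det S = inverse (c ^ i) * det A"
      using A by (simp add: S_def power_inverse)
    then have S: "S \<in> SL i" using S_carrier d unfolding c SL_def by simp
    have "A = c \<cdot>\<^sub>m S"
      by (rule eq_matI) (use A c0 in \<open>simp_all add: S_def\<close>)
    then have "sym_sym_act i m i A t = fscale (c ^ (i * m)) (sym_sym_act i m i S t)"
      using sym_sym_act_smult[of S i i m c t] S by (simp add: SL_def)
    also have "sym_sym_act i m i S t = t" using t S by (simp add: SL_invariants_def)
    finally show ?thesis using c by (simp add: power_mult)
  qed
  show ?thesis
  proof
    fix L
    have "sym_sym_act i m i A t L - det A ^ m * t L = 0"
    proof (rule poly_along_dense[where P = det and A = "1\<^sub>m i" and n = i])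
      show "poly_along i (\<lambda>X. sym_sym_act i m i X t L - det X ^ m * t L)"
        by (intro poly_along_diff poly_along_mult poly_along_power poly_along_det poly_along_const
            poly_along_sym_sym_act)
    qed (use A nonsing in \<open>auto simp: poly_along_det fscale_def\<close>)
    then show "sym_sym_act i m i A t L = fscale (det A ^ m) t L" by (simp add: fscale_def)
  qed
qed

lemma SL_invariants_sym_sym: "SL_invariants j m n \<subseteq> sym_sym j m n"
  by (auto simp: SL_invariants_def)

lemma SL_invariants_supported: "SL_invariants j m n \<subseteq> supported (idx j m n)"
  using SL_invariants_sym_sym sym_sym_supported by blast

lemma cnj_fun_SL_invariants:
  assumes "t \<in> SL_invariants j m n"
  shows "cnj_fun t \<in> SL_invariants j m n"
proof -
  interpret comm_ring_hom cnj by unfold_locales simp_all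
  have "sym_sym_act j m n g (cnj_fun t) = cnj_fun t" if "g \<in> SL n" for g
  proof -
    have "det (map_mat cnj g) = cnj (det g)" by (rule hom_det)
    then have "map_mat cnj g \<in> SL n" using that by (simp add: SL_def)
    then have "cnj_fun (sym_sym_act j m n (map_mat cnj g) t) = cnj_fun t"
      using assms by (simp add: SL_invariants_def)
    moreover have "map_mat cnj (map_mat cnj g) = g" by auto
    ultimately show ?thesis by (simp add: cnj_fun_sym_sym_act)
  qed
  then show ?thesis using assms by (auto simp: SL_invariants_def intro: cnj_fun_sym_sym)
qed

text \<open>\<open>t\<close> involves only the first \<open>i\<close> columns of \<open>g\<close>
  and pairing with \<open>u\<close> only the first \<open>i\<close> rows, so \<open>g\<close> acts
  through its leading block, that is, by a power of the determinant. This is the matrix coefficient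
  to be matched in the highest weight module.\<close>

lemma bil_SL_invariants_act:
  assumes t: "t \<in> SL_invariants i m i" and u: "u \<in> SL_invariants i m i"
    and g: "g \<in> carrier_mat n n" and i: "0 < i" "i \<le> n"
  shows "bil (idx i m n) u (sym_sym_act i m n g t) = det (leading_block i g) ^ m * bil (idx i m n) u t"
proof -
  note supp = subsetD[OF SL_invariants_supported] and mono = idx_mono[OF i(2), of i m]
  have "sym_sym_act i m n g t L = sym_sym_act i m i (leading_block i g) t L" if L: "L \<in> idx i m i" for L
    unfolding sym_sym_act_def
  proof (rule kernel_map_restrict[OF finite_idx mono supp[OF t]])
    fix L' assume L': "L' \<in> idx i m i"
    show "mat_kernel2 g L L' = mat_kernel2 (leading_block i g) L L'"
      using g i(2)
      by (intro tensor_kernel_cong[OF _ L L'] tensor_kernel_cong[of "{..<i}" "{..<i}" _ _ _ m _ m])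
         (auto simp: mat_kernel_def leading_block_def)
  qed
  then have "bil (idx i m i) u (sym_sym_act i m n g t)
      = bil (idx i m i) u (sym_sym_act i m i (leading_block i g) t)"
    by (simp add: bil_def)
  also have "\<dots> = det (leading_block i g) ^ m * bil (idx i m i) u t"
    by (simp add: SL_invariants_act[OF t _ i(1)] bil_simps)
  finally show ?thesis
    by (simp only: bil_restrict[OF finite_idx mono supp[OF u]])
qed

text \<open>Elements of the Levi subgroup GL(i) x GL(n - i) with scalar second block. The scalar
  detects indices at or above \<open>i\<close>, the first block detects SL(i)-invariance.\<close>

definition levi :: "nat \<Rightarrow> nat \<Rightarrow> complex mat \<Rightarrow> complex \<Rightarrow> complex mat" where
  "levi i n A c = four_block_mat A (0\<^sub>m i (n - i)) (0\<^sub>m (n - i) i) (c \<cdot>\<^sub>m 1\<^sub>m (n - i))"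

lemma levi_carrier: "A \<in> carrier_mat i i \<Longrightarrow> i \<le> n \<Longrightarrow> levi i n A c \<in> carrier_mat n n"
  unfolding levi_def
  using four_block_carrier_mat[of A i i "c \<cdot>\<^sub>m 1\<^sub>m (n - i)" "n - i" "n - i"] by simp

lemma det_levi: "A \<in> carrier_mat i i \<Longrightarrow> i \<le> n \<Longrightarrow> det (levi i n A c) = det A * c ^ (n - i)"
  unfolding levi_def
  by (subst det_four_block_mat_lower_left_zero[of _ i _ "n - i"]) auto

lemma levi_in_GL: "A \<in> SL i \<Longrightarrow> i \<le> n \<Longrightarrow> c \<noteq> 0 \<Longrightarrow> levi i n A c \<in> carrier (GL n)"
  by (auto simp: carrier_GL SL_def levi_carrier det_levi)

lemma levi_index:
  assumes "A \<in> carrier_mat i i" "i \<le> n" "a < n" "b < n"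
  shows "levi i n A c $$ (a, b) = (if b < i then (if a < i then A $$ (a, b) else 0) else if a = b then c else 0)"
  using assms by (auto simp: levi_def)

lemma SL_invariants_levi:
  assumes t: "t \<in> SL_invariants i m i" and A: "A \<in> SL i" and i: "i \<le> n"
  shows "sym_sym_act i m n (levi i n A c) t = t"
proof -
  have A': "A \<in> carrier_mat i i" using A by (simp add: SL_def)
  have "sym_sym_act i m n (levi i n A c) t L = sym_sym_act i m i A t L" for L
    unfolding sym_sym_act_def
  proof (rule kernel_map_restrict[OF finite_idx idx_mono[OF i] subsetD[OF SL_invariants_supported t]])
    fix L' assume L': "L' \<in> idx i m i"
    show "mat_kernel2 (levi i n A c) L L' = mat_kernel2 A L L'"
      using A' i levi_carrier[OF A' i, of c]
      by (intro tensor_kernel_cong_right[OF _ L'] tensor_kernel_cong_right[of "{..<i}" _ _ _ m])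
         (auto simp: mat_kernel_def levi_index[OF A' i])
  qed
  then show ?thesis using t A by (simp add: SL_invariants_def fun_eq_iff)
qed

lemma prod_list_nat_eq_1: "(\<Prod>x\<leftarrow>xs. f x :: nat) = 1 \<longleftrightarrow> (\<forall>x\<in>set xs. f x = 1)"
  by (induction xs) auto

text \<open>The block scalar 2 multiplies a coordinate by a power of 2, which is 1 only if all indices
  are below \<open>i\<close>; so a fixed tensor is supported there.\<close>

lemma levi_fixed_imp_SL_invariants:
  assumes w: "w \<in> sym_sym i m n" and i: "i \<le> n"
    and fixed: "\<And>A c. A \<in> SL i \<Longrightarrow> c \<noteq> 0 \<Longrightarrow> sym_sym_act i m n (levi i n A c) w = w"
  shows "w \<in> SL_invariants i m i"
proof -
  have w_supp: "w \<in> supported (idx i m n)" using w sym_sym_supported by blast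
  define f :: "nat \<Rightarrow> nat" where "f = (\<lambda>a. if a < i then 1 else 2)"
  have one: "1\<^sub>m i \<in> SL i" by (simp add: SL_def)
  have "diag_kernel {..<n} (\<lambda>a. of_nat (f a)) (mat_kernel (levi i n (1\<^sub>m i) 2))"
    using i levi_carrier[of "1\<^sub>m i" i n 2]
    by (auto simp: diag_kernel_def mat_kernel_def levi_index f_def)
  then have d: "diag_kernel (idx i m n) (\<lambda>L. \<Prod>l\<leftarrow>L. \<Prod>a\<leftarrow>l. of_nat (f a))
      (mat_kernel2 (levi i n (1\<^sub>m i) 2))"
    by (intro diag_kernel_tensor)
  have of_nat_prod_list: "(\<Prod>x\<leftarrow>xs. of_nat (h x)) = (of_nat (\<Prod>x\<leftarrow>xs. h x) :: complex)"
    for xs :: "'z list" and h by (induction xs) auto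
  have supp: "w \<in> supported (idx i m i)"
    unfolding supported_def
  proof (intro CollectI allI impI)
    fix L assume L: "w L \<noteq> 0"
    have "w = sym_sym_act i m n (levi i n (1\<^sub>m i) 2) w" using fixed[OF one, of 2] by simp
    also have "\<dots> = (\<lambda>L. (\<Prod>l\<leftarrow>L. \<Prod>a\<leftarrow>l. of_nat (f a)) * w L)"
      unfolding sym_sym_act_def by (rule kernel_map_diag[OF finite_idx d w_supp])
    finally have "w L = (\<Prod>l\<leftarrow>L. \<Prod>a\<leftarrow>l. of_nat (f a)) * w L" by (rule fun_cong)
    then have "(\<Prod>l\<leftarrow>L. \<Prod>a\<leftarrow>l. of_nat (f a)) = (1 :: complex)" using L by simp
    then have "of_nat (\<Prod>l\<leftarrow>L. \<Prod>a\<leftarrow>l. f a) = (1 :: complex)" by (simp only: of_nat_prod_list)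
    then have "(\<Prod>l\<leftarrow>L. \<Prod>a\<leftarrow>l. f a) = 1" by (simp only: of_nat_eq_1_iff)
    then have "\<forall>l\<in>set L. \<forall>a\<in>set l. f a = 1" by (simp only: prod_list_nat_eq_1)
    then have "\<forall>l\<in>set L. \<forall>a\<in>set l. a < i" by (auto simp: f_def split: if_splits)
    moreover have "L \<in> idx i m n" using w_supp L by (auto simp: supported_def)
    ultimately show "L \<in> idx i m i" by (auto simp: tuples_def)
  qed
  have "sym_sym_act i m i A w = w" if A: "A \<in> SL i" for A
  proof -
    have A': "A \<in> carrier_mat i i" using A by (simp add: SL_def)
    have "sym_sym_act i m n (levi i n A 1) w L = sym_sym_act i m i A w L" for L
      unfolding sym_sym_act_def
    proof (rule kernel_map_restrict[OF finite_idx idx_mono[OF i] supp])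
      fix L' assume L': "L' \<in> idx i m i"
      show "mat_kernel2 (levi i n A 1) L L' = mat_kernel2 A L L'"
        using A' i levi_carrier[OF A' i, of 1]
        by (intro tensor_kernel_cong_right[OF _ L'] tensor_kernel_cong_right[of "{..<i}" _ _ _ m])
           (auto simp: mat_kernel_def levi_index[OF A' i])
    qed
    then show ?thesis using fixed[OF A, of 1] by (simp add: fun_eq_iff)
  qed
  then show ?thesis
    using sym_sym_restrict[OF w supp i] by (simp add: SL_invariants_def)
qed


section \<open>The open cell: lower unipotent times upper triangular matrices\<close>

section \<open>Gaussian decomposition\<close>

definition lower_unipotent :: "nat \<Rightarrow> complex mat \<Rightarrow> bool" where
  "lower_unipotent n u \<longleftrightarrow> u \<in> carrier_mat n n \<and> (\<forall>p<n. u $$ (p, p) = 1) \<and>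
     (\<forall>p q. p < q \<longrightarrow> q < n \<longrightarrow> u $$ (p, q) = 0)"

lemma mult_index_sum:
  assumes "A \<in> carrier_mat n n" "B \<in> carrier_mat n n" "p < n" "q < n"
  shows "(A * B) $$ (p, q) = (\<Sum>r<n. A $$ (p, r) * B $$ (r, q))"
  using assms by (simp add: scalar_prod_def atLeast0LessThan)

text \<open>Only the upper right block of \<open>u\<close> has to vanish, so this covers lower
  unipotent matrices as well as transposed \<open>levi\<close> matrices.\<close>

lemma leading_block_mult_lower:
  assumes u: "u \<in> carrier_mat n n" "\<And>p q. p < k \<Longrightarrow> k \<le> q \<Longrightarrow> q < n \<Longrightarrow> u $$ (p, q) = 0"
    and A: "A \<in> carrier_mat n n" and k: "k \<le> n"
  shows "leading_block k (u * A) = leading_block k u * leading_block k A"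
proof (rule eq_matI)
  fix p q assume "p < dim_row (leading_block k u * leading_block k A)"
    "q < dim_col (leading_block k u * leading_block k A)"
  then have pq: "p < k" "q < k" by (simp_all add: leading_block_def)
  have "(\<Sum>r<n. u $$ (p, r) * A $$ (r, q)) = (\<Sum>r<k. u $$ (p, r) * A $$ (r, q))"
    using k pq u(2)[of p] by (intro sum.mono_neutral_right) (auto simp: not_less)
  then show "leading_block k (u * A) $$ (p, q) = (leading_block k u * leading_block k A) $$ (p, q)"
    using pq k mult_index_sum[OF u(1) A, of p q]
      mult_index_sum[of "leading_block k u" k "leading_block k A" p q]
    by (simp add: leading_block_def)
qed (simp_all add: leading_block_def)

lemma det_leading_block_lower_unipotent:
  assumes u: "lower_unipotent n u" and k: "k \<le> n"
  shows "det (leading_block k u) = 1"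
proof -
  have "det (leading_block k u) = prod_list (diag_mat (leading_block k u))"
    using u k by (intro det_lower_triangular[of k]) (auto simp: leading_block_def lower_unipotent_def)
  also have "\<dots> = (\<Prod>p = 0..<k. leading_block k u $$ (p, p))"
    by (simp add: prod_list_diag_prod leading_block_def)
  also have "\<dots> = 1"
    using u k by (intro prod.neutral) (auto simp: leading_block_def lower_unipotent_def)
  finally show ?thesis .
qed

lemma det_leading_block_upper:
  assumes b: "b \<in> carrier_mat n n" "\<And>p q. q < p \<Longrightarrow> p < k \<Longrightarrow> b $$ (p, q) = 0" and k: "k \<le> n"
  shows "det (leading_block k b) = (\<Prod>p<k. b $$ (p, p))"
proof -
  have "det (leading_block k b) = prod_list (diag_mat (leading_block k b))"
    using b k by (intro det_upper_triangular[of _ k]) (auto simp: leading_block_def)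
  also have "\<dots> = (\<Prod>p<k. b $$ (p, p))"
    by (simp add: prod_list_diag_prod leading_block_def atLeast0LessThan)
  finally show ?thesis .
qed

lemma det_leading_block_lower_unipotent_mult:
  assumes u: "lower_unipotent n u" and A: "A \<in> carrier_mat n n" and k: "k \<le> n"
  shows "det (leading_block k (u * A)) = det (leading_block k A)"
proof -
  have "leading_block k (u * A) = leading_block k u * leading_block k A"
    using u by (intro leading_block_mult_lower[OF _ _ A k]) (auto simp: lower_unipotent_def)
  then show ?thesis
    using det_leading_block_lower_unipotent[OF u k]
      det_mult[of "leading_block k u" k "leading_block k A"] by simp
qed

lemma lower_unipotent_one: "lower_unipotent n (1\<^sub>m n)"
  by (simp add: lower_unipotent_def)

lemma lower_unipotent_mult:
  assumes "lower_unipotent n u" "lower_unipotent n u'"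
  shows "lower_unipotent n (u * u')"
proof -
  have c: "u \<in> carrier_mat n n" "u' \<in> carrier_mat n n" using assms by (auto simp: lower_unipotent_def)
  have z: "u $$ (p, r) * u' $$ (r, q) = 0" if "p < r \<or> r < q" "p < n" "q < n" "r < n" for p q r
    using that assms by (auto simp: lower_unipotent_def)
  have "(u * u') $$ (p, p) = 1" if p: "p < n" for p
  proof -
    have "(u * u') $$ (p, p) = (\<Sum>r<n. if r = p then u $$ (p, p) * u' $$ (p, p) else 0)"
      unfolding mult_index_sum[OF c p p] using p z by (intro sum.cong) (auto simp: nat_neq_iff)
    then show ?thesis using p assms by (simp add: lower_unipotent_def)
  qed
  moreover have "(u * u') $$ (p, q) = 0" if pq: "p < q" "q < n" for p q
  proof -
    have "p < n" using pq by simp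
    then show ?thesis
      unfolding mult_index_sum[OF c \<open>p < n\<close> pq(2)]
      using pq by (intro sum.neutral ballI z) auto
  qed
  moreover have "u * u' \<in> carrier_mat n n" using c by simp
  ultimately show ?thesis by (simp add: lower_unipotent_def)
qed

text \<open>A Gauss transform: the identity with multipliers below the diagonal in column
  \<open>k\<close>. Negating the multipliers inverts it.\<close>

definition elimination_mat :: "nat \<Rightarrow> nat \<Rightarrow> (nat \<Rightarrow> complex) \<Rightarrow> complex mat" where
  "elimination_mat n k c = mat n n (\<lambda>(p, q). if p = q then 1 else if q = k \<and> k < p then c p else 0)"

lemma elimination_mat_lower_unipotent: "lower_unipotent n (elimination_mat n k c)"
  by (simp add: elimination_mat_def lower_unipotent_def)

lemma elimination_mat_mult:
  assumes A: "A \<in> carrier_mat n n" and "k < n" "p < n" "q < n"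
  shows "(elimination_mat n k c * A) $$ (p, q)
    = A $$ (p, q) + (if k < p then c p * A $$ (k, q) else 0)"
proof -
  have "(elimination_mat n k c * A) $$ (p, q) = (\<Sum>r<n. elimination_mat n k c $$ (p, r) * A $$ (r, q))"
    using assms by (intro mult_index_sum) (auto simp: elimination_mat_def)
  also have "\<dots> = (\<Sum>r<n. (if r = p then A $$ (p, q) else 0)
      + (if r = k then (if k < p then c p * A $$ (k, q) else 0) else 0))"
    using assms by (intro sum.cong) (auto simp: elimination_mat_def)
  finally show ?thesis using assms by (simp add: sum.distrib)
qed

text \<open>Column-by-column elimination without row exchanges; the inverses of the elimination
  matrices accumulate in \<open>u\<close>.\<close>

lemma gauss_decomposition:
  assumes g: "g \<in> carrier_mat n n" and minors: "\<And>k. k \<le> n \<Longrightarrow> det (leading_block k g) \<noteq> 0"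
  obtains u b where "lower_unipotent n u" "b \<in> carrier (GL n)" "upper_triangular b" "g = u * b"
proof -
  have "\<exists>u A. lower_unipotent n u \<and> A \<in> carrier_mat n n \<and> g = u * A \<and>
      (\<forall>p q. q < k \<longrightarrow> q < p \<longrightarrow> p < n \<longrightarrow> A $$ (p, q) = 0)" if "k \<le> n" for k
    using that
  proof (induction k)
    case 0
    then show ?case using lower_unipotent_one g by (intro exI[of _ "1\<^sub>m n"] exI[of _ g]) auto
  next
    case (Suc k)
    then obtain u A where u: "lower_unipotent n u" and A: "A \<in> carrier_mat n n" "g = u * A"
      and z: "\<And>p q. q < k \<Longrightarrow> q < p \<Longrightarrow> p < n \<Longrightarrow> A $$ (p, q) = 0" by auto
    have k: "k < n" using Suc.prems by simp
    \<comment> \<open>Lower unipotent factors on the left preserve leading minors. The minor of the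
      partly reduced matrix is the product of its pivots, so the next pivot is nonzero.\<close>
    have "det (leading_block (Suc k) A) \<noteq> 0"
      using minors[OF Suc.prems] det_leading_block_lower_unipotent_mult[OF u A(1) Suc.prems]
      by (simp add: A(2))
    moreover have "det (leading_block (Suc k) A) = (\<Prod>p<Suc k. A $$ (p, p))"
      using z k by (intro det_leading_block_upper[OF A(1) _ Suc.prems]) auto
    ultimately have akk: "A $$ (k, k) \<noteq> 0" by auto
    define c where "c = (\<lambda>p. A $$ (p, k) / A $$ (k, k))"
    define A' where "A' = elimination_mat n k (\<lambda>p. - c p) * A"
    have A': "A' \<in> carrier_mat n n"
      unfolding A'_def using A(1) by (intro mult_carrier_mat[of _ n n]) (simp add: elimination_mat_def)
    have idx: "A' $$ (p, q) = A $$ (p, q) - (if k < p then c p * A $$ (k, q) else 0)"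
      if "p < n" "q < n" for p q
      unfolding A'_def using elimination_mat_mult[OF A(1) k that] by simp
    have "elimination_mat n k c * A' = A"
    proof (rule eq_matI)
      fix p q assume "p < dim_row A" "q < dim_col A"
      then have pq: "p < n" "q < n" using A(1) by auto
      show "(elimination_mat n k c * A') $$ (p, q) = A $$ (p, q)"
        using elimination_mat_mult[OF A' k pq, of c] idx[OF pq] idx[OF k pq(2)] by simp
    qed (use A(1) A' in \<open>auto simp: elimination_mat_def\<close>)
    moreover have "u * (elimination_mat n k c * A') = (u * elimination_mat n k c) * A'"
      using u A' by (intro assoc_mult_mat[symmetric, of _ n n _ n _ n])
        (auto simp: lower_unipotent_def elimination_mat_def)
    ultimately have "g = (u * elimination_mat n k c) * A'" using A(2) by simp
    moreover have "lower_unipotent n (u * elimination_mat n k c)"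
      by (rule lower_unipotent_mult[OF u elimination_mat_lower_unipotent])
    moreover have "A' $$ (p, q) = 0" if "q < Suc k" "q < p" "p < n" for p q
    proof (cases "q = k")
      case True
      then show ?thesis using idx[of p q] that akk by (simp add: c_def)
    next
      case False
      then show ?thesis using idx[of p q] that k z[of q p] z[of q k] by simp
    qed
    ultimately show ?case using A' by blast
  qed
  from this[OF order_refl] obtain u b where u: "lower_unipotent n u" and b: "b \<in> carrier_mat n n"
    and gub: "g = u * b" and z: "\<And>p q. q < n \<Longrightarrow> q < p \<Longrightarrow> p < n \<Longrightarrow> b $$ (p, q) = 0" by blast
  have "upper_triangular b" using z b by (auto simp: upper_triangular_def)
  moreover have "det b \<noteq> 0"
    using minors[of n] det_leading_block_lower_unipotent_mult[OF u b order_refl] b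
    by (simp add: gub leading_block_self)
  ultimately show ?thesis using that u b gub by (auto simp: carrier_GL)
qed

lemma lower_unipotent_in_GL: "lower_unipotent n u \<Longrightarrow> u \<in> carrier (GL n)"
  using det_leading_block_lower_unipotent[of n u n]
  by (auto simp: carrier_GL lower_unipotent_def leading_block_self)

text \<open>The cell contains the locus where the product of the leading minors is nonzero, and that
  locus contains the identity.\<close>

lemma poly_along_dense_cell:
  assumes f: "poly_along n f"
    and 0: "\<And>u b. lower_unipotent n u \<Longrightarrow> b \<in> carrier (GL n) \<Longrightarrow> upper_triangular b \<Longrightarrow> f (u * b) = 0"
    and X: "X \<in> carrier_mat n n"
  shows "f X = 0"
proof (rule poly_along_dense[OF f _ _ _ _ X])
  show "poly_along n (\<lambda>X. \<Prod>k\<le>n. det (leading_block k X))"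
    by (intro poly_along_prod poly_along_leading_minor) simp
  show "1\<^sub>m n \<in> carrier_mat n n" by simp
  show "(\<Prod>k\<le>n. det (leading_block k (1\<^sub>m n))) \<noteq> 0"
    using det_leading_block_lower_unipotent[OF lower_unipotent_one, of _ n] by simp
  fix Y assume Y: "Y \<in> carrier_mat n n" and P: "(\<Prod>k\<le>n. det (leading_block k Y)) \<noteq> 0"
  have "det (leading_block k Y) \<noteq> 0" if "k \<le> n" for k using P that by auto
  from gauss_decomposition[OF Y this] show "f Y = 0" using 0 by metis
qed

lemma det_leading_block_cell:
  assumes "lower_unipotent n u" "b \<in> carrier (GL n)" "upper_triangular b" "k \<le> n"
  shows "det (leading_block k (u * b)) = (\<Prod>p<k. b $$ (p, p))"
proof -
  have b: "b \<in> carrier_mat n n" using assms(2) by (simp add: carrier_GL)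
  have "det (leading_block k b) = (\<Prod>p<k. b $$ (p, p))"
    using assms b by (intro det_leading_block_upper[OF b]) (auto simp: upper_triangular_def)
  then show ?thesis using det_leading_block_lower_unipotent_mult[OF assms(1) b assms(4)] by simp
qed


section \<open>A functional whose matrix coefficient is a power of a leading minor\<close>

section \<open>The lowest weight functional\<close>

lemma vec_act_mult:
  assumes "A \<in> carrier_mat d d" "B \<in> carrier_mat d d"
  shows "vec_act d A (vec_act d B x) = vec_act d (A * B) x"
  unfolding vec_act_def kernel_map_kernel_map mat_kernel_mult[OF assms] ..

lemma vec_act_one:
  assumes "x \<in> coord_space d"
  shows "vec_act d (1\<^sub>m d) x = x"
proof -
  have "diag_kernel {..<d} (\<lambda>_. 1) (mat_kernel (1\<^sub>m d))"
    by (auto simp: diag_kernel_def mat_kernel_def)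
  from kernel_map_diag[OF _ this, of x] show ?thesis
    using assms by (simp add: vec_act_def coord_space_eq_supported)
qed

lemma bil_vec_act: "bil {..<d} (vec_act d A x) y = bil {..<d} x (vec_act d (transpose_mat A) y)"
  unfolding vec_act_def bil_kernel_map mat_kernel_transpose ..

lemma vec_act_add: "vec_act d A (x + y) = vec_act d A x + vec_act d A y"
  and vec_act_scale: "vec_act d A (fscale c x) = fscale c (vec_act d A x)"
  and vec_act_zero: "vec_act d A 0 = 0"
  unfolding vec_act_def by (rule kernel_map_add kernel_map_scale kernel_map_zero)+

lemma vec_act_closed: "A \<in> carrier_mat d d \<Longrightarrow> vec_act d A x \<in> coord_space d"
  by (auto simp: coord_space_def vec_act_def kernel_map_def mat_kernel_def)

lemma coord_space_subspace: "fvs.subspace (coord_space d)"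
  unfolding coord_space_eq_supported by (rule supported_subspace)

text \<open>The highest weight is (k,...,k) with \<open>i\<close> parts. Its character is written as
  a power of a product, which on upper triangular matrices is a power of the leading
  \<open>i\<close> x \<open>i\<close> minor.\<close>

locale highest_weight_module =
  fixes n i k d :: nat and \<rho> :: "complex mat \<Rightarrow> complex mat" and v :: "nat \<Rightarrow> complex"
  assumes i: "i \<le> n"
    and rational: "rational_rep n d \<rho>"
    and irreducible: "irreducible_module (carrier (GL n)) (\<lambda>g. vec_act d (\<rho> g)) (coord_space d)"
    and v: "v \<in> coord_space d" "v \<noteq> 0"
    and weight: "\<And>b. b \<in> carrier (GL n) \<Longrightarrow> upper_triangular b \<Longrightarrow>
      vec_act d (\<rho> b) v = fscale ((\<Prod>j<i. b $$ (j, j)) ^ k) v"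
begin

abbreviation R :: "complex mat \<Rightarrow> (nat \<Rightarrow> complex) \<Rightarrow> nat \<Rightarrow> complex" where
  "R g \<equiv> vec_act d (\<rho> g)"

lemma rho_GL: "g \<in> carrier (GL n) \<Longrightarrow> \<rho> g \<in> carrier (GL d)"
  and rho_mult: "g \<in> carrier (GL n) \<Longrightarrow> h \<in> carrier (GL n) \<Longrightarrow> \<rho> (g * h) = \<rho> g * \<rho> h"
  using rational by (auto simp: rational_rep_def hom_def mult_GL)

lemma rho_carrier: "g \<in> carrier (GL n) \<Longrightarrow> \<rho> g \<in> carrier_mat d d"
  using rho_GL by (simp add: carrier_GL)

lemma rho_one: "\<rho> (1\<^sub>m n) = 1\<^sub>m d"
  using hom_one[OF _ group_GL group_GL, of \<rho> n d] rational
  by (simp add: rational_rep_def one_GL)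

lemma R_mult: "g \<in> carrier (GL n) \<Longrightarrow> h \<in> carrier (GL n) \<Longrightarrow> R g (R h x) = R (g * h) x"
  by (simp add: rho_mult vec_act_mult rho_carrier)

lemma R_closed: "g \<in> carrier (GL n) \<Longrightarrow> R g x \<in> coord_space d"
  by (rule vec_act_closed[OF rho_carrier])

lemma submodule_trivial:
  assumes "fvs.subspace U" "U \<subseteq> coord_space d"
    and "\<And>g x. g \<in> carrier (GL n) \<Longrightarrow> x \<in> U \<Longrightarrow> R g x \<in> U"
  shows "U = {0} \<or> U = coord_space d"
proof -
  have "is_submodule (carrier (GL n)) (\<lambda>g. vec_act d (\<rho> g)) (coord_space d) U"
    unfolding is_submodule_def using assms by auto
  then show ?thesis using irreducible by (auto simp only: irreducible_module_def)
qed

lemma orbit_span: "fvs.span {R g v |g. g \<in> carrier (GL n)} = coord_space d"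
proof -
  let ?O = "{R g v |g. g \<in> carrier (GL n)}"
  have "fvs.span ?O = {0} \<or> fvs.span ?O = coord_space d"
  proof (rule submodule_trivial)
    show "fvs.span ?O \<subseteq> coord_space d"
      using R_closed by (intro fvs.span_minimal coord_space_subspace) auto
    fix g x assume g: "g \<in> carrier (GL n)" and x: "x \<in> fvs.span ?O"
    have "fvs.span ?O \<subseteq> {x. R g x \<in> fvs.span ?O}"
    proof (rule fvs.span_minimal)
      show "?O \<subseteq> {x. R g x \<in> fvs.span ?O}"
        using g R_mult mult_in_GL by (auto intro!: fvs.span_base)
      show "fvs.subspace {x. R g x \<in> fvs.span ?O}"
        by (rule fvs.subspaceI)
           (simp_all add: vec_act_add vec_act_scale vec_act_zero fvs.span_add fvs.span_scale fvs.span_zero)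
    qed
    then show "R g x \<in> fvs.span ?O" using x by blast
  qed simp
  moreover have "v \<in> fvs.span ?O"
    using v(1) by (intro fvs.span_base CollectI exI[of _ "1\<^sub>m n"])
      (simp add: one_in_GL rho_one vec_act_one)
  ultimately show ?thesis using v(2) by auto
qed

lemma orbit_separates:
  assumes "z \<in> coord_space d" "\<And>g. g \<in> carrier (GL n) \<Longrightarrow> bil {..<d} z (R g v) = 0"
  shows "z = 0"
proof -
  have "fvs.span {R g v |g. g \<in> carrier (GL n)} \<subseteq> {x. \<forall>y\<in>{z}. bil {..<d} x y = 0}"
    using assms(2) by (intro fvs.span_minimal bil_annihilator_subspace) (auto simp: bil_commute)
  moreover have "cnj_fun z \<in> coord_space d"
    using assms(1) unfolding coord_space_eq_supported by (rule cnj_fun_supported)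
  ultimately have "bil {..<d} (cnj_fun z) z = 0" unfolding orbit_span by blast
  then show ?thesis
    using bil_positive_definite[of "{..<d}" z] assms(1)
    by (simp add: coord_space_eq_supported bil_commute)
qed

lemma rational_entries:
  "\<exists>N f. (\<forall>a<d. \<forall>b<d. poly_along n (f a b)) \<and>
     (\<forall>a<d. \<forall>b<d. \<forall>g\<in>carrier (GL n). det g ^ N * \<rho> g $$ (a, b) = f a b g)"
proof -
  from rational obtain N where N: "\<forall>a<d. \<forall>b<d. \<exists>f\<in>poly_funs n n. \<forall>g\<in>carrier (GL n). det g ^ N * \<rho> g $$ (a, b) = f g"
    unfolding rational_rep_def by blast
  define f where "f = (\<lambda>a b. SOME f. f \<in> poly_funs n n \<and> (\<forall>g\<in>carrier (GL n). det g ^ N * \<rho> g $$ (a, b) = f g))"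
  have f: "f a b \<in> poly_funs n n \<and> (\<forall>g\<in>carrier (GL n). det g ^ N * \<rho> g $$ (a, b) = f a b g)"
    if "a < d" "b < d" for a b
  proof -
    have "\<exists>f. f \<in> poly_funs n n \<and> (\<forall>g\<in>carrier (GL n). det g ^ N * \<rho> g $$ (a, b) = f g)"
      using N[rule_format, OF that] by (simp only: Bex_def)
    from someI_ex[OF this] show ?thesis unfolding f_def .
  qed
  show ?thesis
  proof (rule exI[of _ N], rule exI[of _ f], intro conjI allI impI ballI)
    show "poly_along n (f a b)" if "a < d" "b < d" for a b
      using f[OF that] poly_along_poly_funs by simp
    show "det g ^ N * \<rho> g $$ (a, b) = f a b g" if "a < d" "b < d" "g \<in> carrier (GL n)" for a b g
      using f[OF that(1,2)] that(3) by simp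
  qed
qed

text \<open>Clearing the determinant denominators makes density arguments available for matrix
  coefficients.\<close>

lemma matrix_coefficient_poly:
  "\<exists>N F. poly_along n F \<and> (\<forall>g\<in>carrier (GL n). det g ^ N * bil {..<d} y (R g x) = F g)"
proof -
  obtain N f where f: "\<forall>a<d. \<forall>b<d. poly_along n (f a b)"
    "\<forall>a<d. \<forall>b<d. \<forall>g\<in>carrier (GL n). det g ^ N * \<rho> g $$ (a, b) = f a b g"
    using rational_entries by (elim exE conjE)
  have "poly_along n (\<lambda>g. \<Sum>a<d. \<Sum>b<d. y a * x b * f a b g)"
    using f(1) by (auto intro!: poly_along_sum poly_along_mult[OF poly_along_const])
  moreover have "det g ^ N * bil {..<d} y (R g x) = (\<Sum>a<d. \<Sum>b<d. y a * x b * f a b g)"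
    if g: "g \<in> carrier (GL n)" for g
  proof -
    have "det g ^ N * bil {..<d} y (R g x)
        = (\<Sum>a<d. \<Sum>b<d. y a * x b * (det g ^ N * \<rho> g $$ (a, b)))"
      unfolding bil_def vec_act_def kernel_map_def sum_distrib_left
      using rho_carrier[OF g] by (intro sum.cong refl) (auto simp: mat_kernel_def)
    also have "\<dots> = (\<Sum>a<d. \<Sum>b<d. y a * x b * f a b g)"
      using f(2) g by (intro sum.cong refl) simp
    finally show ?thesis .
  qed
  ultimately show ?thesis by (intro exI conjI ballI)
qed

lemma cell_in_GL: "lower_unipotent n u \<Longrightarrow> b \<in> carrier (GL n) \<Longrightarrow> u * b \<in> carrier (GL n)"
  by (rule mult_in_GL[OF lower_unipotent_in_GL])

text \<open>A vector annihilating the cell part of the orbit has a matrix coefficient that vanishes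
  on a dense set, hence on the whole group, and the full orbit spans by irreducibility.\<close>

lemma cell_orbit_span:
  "fvs.span {R (u * b) v |u b. lower_unipotent n u \<and> b \<in> carrier (GL n) \<and> upper_triangular b} = coord_space d"
    (is "fvs.span ?O = _")
  unfolding coord_space_eq_supported
proof (rule subspace_eq_supportedI)
  show "fvs.span ?O \<subseteq> supported {..<d}"
    unfolding coord_space_eq_supported[symmetric]
    by (rule fvs.span_minimal[OF _ coord_space_subspace])
       (auto simp only: R_closed[OF mult_in_GL[OF lower_unipotent_in_GL]])
  fix z :: "nat \<Rightarrow> complex"
  assume z: "z \<in> supported {..<d}" and ann: "\<And>x. x \<in> fvs.span ?O \<Longrightarrow> bil {..<d} x z = 0"
  obtain N F where F: "poly_along n F"
    "\<forall>g\<in>carrier (GL n). det g ^ N * bil {..<d} z (R g v) = F g"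
    using matrix_coefficient_poly[of z v] by (elim exE conjE)
  have F0: "F g = 0" if "g \<in> carrier_mat n n" for g
  proof (rule poly_along_dense_cell[OF F(1) _ that])
    fix u b assume ub: "lower_unipotent n u" "b \<in> carrier (GL n)" "upper_triangular b"
    then have "bil {..<d} z (R (u * b) v) = 0"
      unfolding bil_commute[of _ z] by (intro ann fvs.span_base) auto
    then show "F (u * b) = 0" using F(2)[rule_format, OF cell_in_GL[OF ub(1,2)]] by simp
  qed
  show "z = 0"
  proof (rule orbit_separates)
    fix g assume g: "g \<in> carrier (GL n)"
    then show "bil {..<d} z (R g v) = 0" using F(2)[rule_format, OF g] F0[of g] by (simp add: carrier_GL)
  qed (use z in \<open>simp add: coord_space_eq_supported\<close>)
qed simp_all

text \<open>With increasing exponents, conjugation multiplies the entry at (p, q) by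
  \<open>s ^ (p - q)\<close> for p at least q, so entries below the diagonal tend to 0 with
  \<open>s\<close>.\<close>

definition torus :: "complex \<Rightarrow> complex mat" where
  "torus s = mat n n (\<lambda>(p, q). if p = q then s ^ p else 0)"

definition torus_weight :: "complex \<Rightarrow> complex" where
  "torus_weight s = (\<Prod>j<i. s ^ j) ^ k"

text \<open>\<open>contract u s\<close> is the conjugate of \<open>u\<close> by \<open>torus s\<close>, extended to \<open>s = 0\<close>. Truncation of \<open>p - q\<close> is
  harmless because \<open>u\<close> is lower triangular.\<close>

definition contract :: "complex mat \<Rightarrow> complex \<Rightarrow> complex mat" where
  "contract u s = mat n n (\<lambda>(p, q). u $$ (p, q) * s ^ (p - q))"

lemma torus_in_GL:
  assumes "s \<noteq> 0"
  shows "torus s \<in> carrier (GL n)" "upper_triangular (torus s)" "torus_weight s \<noteq> 0"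
proof -
  show up: "upper_triangular (torus s)" by (auto simp: torus_def upper_triangular_def)
  have c: "torus s \<in> carrier_mat n n" by (simp add: torus_def)
  have "det (torus s) = (\<Prod>p = 0..<n. torus s $$ (p, p))"
    using det_upper_triangular[OF up c] by (simp add: prod_list_diag_prod torus_def)
  also have "\<dots> \<noteq> 0" using assms by (simp add: torus_def)
  finally show "torus s \<in> carrier (GL n)" using c by (simp add: carrier_GL)
  show "torus_weight s \<noteq> 0" using assms by (simp add: torus_weight_def)
qed

lemma R_torus: "s \<noteq> 0 \<Longrightarrow> R (torus s) v = fscale (torus_weight s) v"
proof -
  assume s: "s \<noteq> 0"
  have "(\<Prod>j<i. torus s $$ (j, j)) = (\<Prod>j<i. s ^ j)"
    using i by (intro prod.cong) (auto simp: torus_def)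
  then show ?thesis using weight[OF torus_in_GL(1,2)[OF s]] by (simp add: torus_weight_def)
qed

lemma contract_lower_unipotent: "lower_unipotent n u \<Longrightarrow> lower_unipotent n (contract u s)"
  by (auto simp: lower_unipotent_def contract_def)

lemma contract_0: "lower_unipotent n u \<Longrightarrow> contract u 0 = 1\<^sub>m n"
  by (rule eq_matI) (auto simp: lower_unipotent_def contract_def power_0_left nat_neq_iff)

lemma torus_mult:
  assumes "lower_unipotent n u"
  shows "torus s * u = contract u s * torus s"
proof (rule eq_matI)
  have u: "u \<in> carrier_mat n n" using assms by (simp add: lower_unipotent_def)
  have c: "torus s \<in> carrier_mat n n" "contract u s \<in> carrier_mat n n"
    by (simp_all add: torus_def contract_def)
  fix p q assume "p < dim_row (contract u s * torus s)" "q < dim_col (contract u s * torus s)"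
  then have pq: "p < n" "q < n" by (simp_all add: torus_def contract_def)
  have "(torus s * u) $$ (p, q) = (\<Sum>r<n. if r = p then s ^ p * u $$ (p, q) else 0)"
    unfolding mult_index_sum[OF c(1) u pq] using pq by (intro sum.cong) (auto simp: torus_def)
  moreover have "(contract u s * torus s) $$ (p, q)
      = (\<Sum>r<n. if r = q then u $$ (p, q) * s ^ (p - q) * s ^ q else 0)"
    unfolding mult_index_sum[OF c(2,1) pq] using pq
    by (intro sum.cong) (auto simp: torus_def contract_def)
  moreover have "s ^ p * u $$ (p, q) = u $$ (p, q) * s ^ (p - q) * s ^ q"
  proof (cases "p < q")
    case True
    then show ?thesis using assms pq by (simp add: lower_unipotent_def)
  next
    case False
    then show ?thesis by (simp add: mult.assoc flip: power_add)
  qed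
  ultimately show "(torus s * u) $$ (p, q) = (contract u s * torus s) $$ (p, q)" using pq by simp
qed (use assms in \<open>auto simp: torus_def contract_def lower_unipotent_def\<close>)

lemma R_cell:
  assumes "lower_unipotent n u" "b \<in> carrier (GL n)" "upper_triangular b"
  shows "R (u * b) v = fscale (det (leading_block i (u * b)) ^ k) (R u v)"
  using assms R_mult[OF lower_unipotent_in_GL[OF assms(1)] assms(2), of v]
  by (simp add: weight vec_act_scale det_leading_block_cell i)

text \<open>As the torus element degenerates, its normalised action contracts the cell orbit onto the
  highest weight line; the limit is the lowest weight functional.\<close>

lemma torus_limit_cell:
  assumes "lower_unipotent n u" "b \<in> carrier (GL n)" "upper_triangular b" and a: "a < d"
  shows "((\<lambda>s. R (torus s) (R (u * b) v) a / torus_weight s)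
    \<longlongrightarrow> det (leading_block i (u * b)) ^ k * v a) (at 0)"
proof -
  let ?D = "det (leading_block i (u * b)) ^ k"
  have u: "u \<in> carrier (GL n)" by (rule lower_unipotent_in_GL[OF assms(1)])
  have cu: "contract u s \<in> carrier (GL n)" for s
    by (rule lower_unipotent_in_GL[OF contract_lower_unipotent[OF assms(1)]])
  have "R (torus s) (R (u * b) v) a / torus_weight s = ?D * R (contract u s) v a" if s: "s \<noteq> 0" for s
  proof -
    have "R (torus s) (R u v) = R (contract u s) (R (torus s) v)"
      using R_mult[OF torus_in_GL(1)[OF s] u] R_mult[OF cu torus_in_GL(1)[OF s]]
      by (simp add: torus_mult[OF assms(1)])
    also have "\<dots> = fscale (torus_weight s) (R (contract u s) v)"
      by (simp add: R_torus[OF s] vec_act_scale)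
    finally have "R (torus s) (R (u * b) v) = fscale ?D (fscale (torus_weight s) (R (contract u s) v))"
      unfolding R_cell[OF assms(1-3)] vec_act_scale by simp
    then show ?thesis using torus_in_GL(3)[OF s] by (simp add: fscale_def)
  qed
  moreover have "((\<lambda>s. ?D * R (contract u s) v a) \<longlongrightarrow> ?D * v a) (at 0)"
  proof (intro tendsto_mult tendsto_const)
    obtain N f where f: "\<forall>a<d. \<forall>b<d. poly_along n (f a b)"
      "\<forall>a<d. \<forall>b<d. \<forall>g\<in>carrier (GL n). det g ^ N * \<rho> g $$ (a, b) = f a b g"
      using rational_entries by (elim exE conjE)
    \<comment> \<open>Determinant 1 removes the denominator of the representation, so its entries
      are polynomial in \<open>s\<close>, including at 0 where the curve reaches the
      identity.\<close>
    have d1: "det (contract u s) = 1" for s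
      using det_leading_block_lower_unipotent[OF contract_lower_unipotent[OF assms(1)] order_refl, of s]
        cu[of s] by (simp add: carrier_GL leading_block_self)
    have expand: "R (contract u s) v a = (\<Sum>b<d. f a b (contract u s) * v b)" for s
      unfolding vec_act_def kernel_map_def
      using rho_carrier[OF cu[of s]] a f(2)[rule_format, OF a _ cu[of s]]
      by (intro sum.cong refl) (auto simp: mat_kernel_def d1)
    have "poly_fun (\<lambda>s. f a b (contract u s))" if "b < d" for b
    proof -
      have "poly_curve n (contract u)"
        unfolding poly_curve_def
      proof (intro conjI allI impI)
        fix p q assume "p < n" "q < n"
        then have "(\<lambda>s. contract u s $$ (p, q)) = (\<lambda>s. u $$ (p, q) * s ^ (p - q))"
          by (simp add: contract_def)
        then show "poly_fun (\<lambda>s. contract u s $$ (p, q))"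
          by (simp add: poly_fun_mult poly_fun_const poly_fun_power poly_fun_id)
      qed (simp add: contract_def)
      then show ?thesis using f(1)[rule_format, OF a that] by (simp add: poly_along_def)
    qed
    then have "poly_fun (\<lambda>s. R (contract u s) v a)"
      unfolding expand by (intro poly_fun_sum poly_fun_mult[OF _ poly_fun_const]) simp
    then obtain p where p: "(\<lambda>s. R (contract u s) v a) = poly p" by (auto simp: poly_fun_def)
    have "poly p 0 = v a"
      using fun_cong[OF p, of 0] by (simp add: contract_0[OF assms(1)] rho_one vec_act_one v(1))
    then show "((\<lambda>s. R (contract u s) v a) \<longlongrightarrow> v a) (at 0)"
      using poly_isCont[of 0 p] unfolding p isCont_def by simp
  qed
  ultimately show ?thesis
    by (subst tendsto_cong[where g = "\<lambda>s. ?D * R (contract u s) v a"])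
       (auto simp: eventually_at intro!: exI[of _ 1])
qed

text \<open>The normalised torus action has a limit in coordinate \<open>a\<close> on the spanning
  cell orbit, hence on every vector. The limit is linear, so it is given by a vector, and its values
  on the cell orbit extend to GL(n) by density.\<close>

lemma lowest_weight_functional:
  "\<exists>f\<in>coord_space d. \<forall>g\<in>carrier (GL n). bil {..<d} f (R g v) = det (leading_block i g) ^ k"
proof -
  obtain a where a: "v a \<noteq> 0" using v(2) by (auto simp: fun_eq_iff)
  then have a_d: "a < d" using v(1) by (auto simp: coord_space_def not_less[symmetric])
  define E where "E = (\<lambda>x s. R (torus s) x a / torus_weight s)"
  define C where "C = {x. \<exists>l. (E x \<longlongrightarrow> l) (at 0)}"
  have E0: "E 0 = (\<lambda>s. 0)" and E_add: "E (x + y) = (\<lambda>s. E x s + E y s)" for x y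
    by (simp_all add: E_def vec_act_zero vec_act_add add_divide_distrib)
  have E_scale: "E (fscale c x) = (\<lambda>s. c * E x s)" for x c
    unfolding E_def vec_act_scale by (simp add: fscale_def)
  have "fvs.subspace C"
    unfolding C_def
  proof (rule fvs.subspaceI, unfold mem_Collect_eq E0 E_add E_scale)
    show "\<exists>l. ((\<lambda>s. 0) \<longlongrightarrow> (l :: complex)) (at (0 :: complex))" by (rule exI[of _ 0]) simp
    show "\<exists>l. ((\<lambda>s. E x s + E y s) \<longlongrightarrow> l) (at 0)"
      if "\<exists>l. (E x \<longlongrightarrow> l) (at 0)" "\<exists>l. (E y \<longlongrightarrow> l) (at 0)" for x y
      using that tendsto_add by blast
    show "\<exists>l. ((\<lambda>s. c * E x s) \<longlongrightarrow> l) (at 0)" if "\<exists>l. (E x \<longlongrightarrow> l) (at 0)" for c x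
      using that tendsto_mult_left by blast
  qed
  moreover have "{R (u * b) v |u b. lower_unipotent n u \<and> b \<in> carrier (GL n) \<and> upper_triangular b} \<subseteq> C"
  proof clarify
    fix u b assume "lower_unipotent n u" "b \<in> carrier (GL n)" "upper_triangular b"
    from torus_limit_cell[OF this a_d] show "R (u * b) v \<in> C"
      unfolding C_def E_def mem_Collect_eq by (rule exI)
  qed
  ultimately have "coord_space d \<subseteq> C"
    unfolding cell_orbit_span[symmetric] by (rule fvs.span_minimal[rotated])
  moreover have "basis_vec j \<in> coord_space d" if "j < d" for j
    using that by (auto simp: coord_space_def basis_vec_def)
  ultimately have "basis_vec j \<in> C" if "j < d" for j
    using that by (auto simp only: subset_eq)
  then have ex: "\<exists>l. (E (basis_vec j) \<longlongrightarrow> l) (at 0)" if "j < d" for j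
    using that by (simp only: C_def mem_Collect_eq)
  define l where "l = (\<lambda>j. SOME l. (E (basis_vec j) \<longlongrightarrow> l) (at 0))"
  have l: "(E (basis_vec j) \<longlongrightarrow> l j) (at 0)" if "j < d" for j
    using someI_ex[OF ex[OF that]] by (simp only: l_def)
  \<comment> \<open>Division by \<open>v a\<close> normalises the value at \<open>v\<close> to 1;
    the zeros from \<open>d\<close> on put \<open>f\<close> into
    \<open>coord_space d\<close>.\<close>
  define f where "f = (\<lambda>j. if j < d then l j / v a else 0)"
  have E_expand: "E x = (\<lambda>s. \<Sum>j<d. x j * E (basis_vec j) s)" for x
  proof
    fix s
    have "R (torus s) (basis_vec j) a = mat_kernel (\<rho> (torus s)) a j" if "j < d" for j
      using that by (simp add: vec_act_def kernel_map_def basis_vec_def if_distrib[of "(*) _"] cong: if_cong)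
    then have "(\<Sum>j<d. x j * E (basis_vec j) s)
        = (\<Sum>j<d. x j * (mat_kernel (\<rho> (torus s)) a j / torus_weight s))"
      by (intro sum.cong refl) (simp add: E_def)
    also have "\<dots> = E x s"
      by (simp add: E_def vec_act_def kernel_map_def sum_divide_distrib mult.commute)
    finally show "E x s = (\<Sum>j<d. x j * E (basis_vec j) s)" ..
  qed
  have lim: "(E x \<longlongrightarrow> bil {..<d} f x * v a) (at 0)" for x
  proof -
    have "(E x \<longlongrightarrow> (\<Sum>j<d. x j * l j)) (at 0)"
      unfolding E_expand[of x] using l by (intro tendsto_sum tendsto_mult tendsto_const) auto
    also have "(\<Sum>j<d. x j * l j) = bil {..<d} f x * v a"
      unfolding bil_def sum_distrib_right using a by (intro sum.cong refl) (simp add: f_def)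
    finally show ?thesis .
  qed
  have cell: "bil {..<d} f (R (u * b) v) = det (leading_block i (u * b)) ^ k"
    if "lower_unipotent n u" "b \<in> carrier (GL n)" "upper_triangular b" for u b
  proof -
    have "(E (R (u * b) v) \<longlongrightarrow> det (leading_block i (u * b)) ^ k * v a) (at 0)"
      using torus_limit_cell[OF that a_d] by (simp only: E_def)
    from tendsto_unique[OF _ lim this] show ?thesis using a by simp
  qed
  obtain N F where F: "poly_along n F"
    "\<forall>g\<in>carrier (GL n). det g ^ N * bil {..<d} f (R g v) = F g"
    using matrix_coefficient_poly[of f v] by (elim exE conjE)
  \<comment> \<open>The power of the determinant keeps the identity polynomial for the density
    argument; it is cancelled afterwards on GL(n).\<close>
  have G: "F g - det g ^ N * det (leading_block i g) ^ k = 0" if "g \<in> carrier_mat n n" for g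
  proof (rule poly_along_dense_cell[OF _ _ that])
    show "poly_along n (\<lambda>g. F g - det g ^ N * det (leading_block i g) ^ k)"
      by (intro poly_along_diff poly_along_mult poly_along_power poly_along_det
          poly_along_leading_minor F(1) i)
    fix u b assume ub: "lower_unipotent n u" "b \<in> carrier (GL n)" "upper_triangular b"
    then have "u * b \<in> carrier (GL n)" by (intro cell_in_GL)
    from F(2)[rule_format, OF this] show "F (u * b) - det (u * b) ^ N * det (leading_block i (u * b)) ^ k = 0"
      by (simp add: cell[OF ub])
  qed
  have "bil {..<d} f (R g v) = det (leading_block i g) ^ k" if g: "g \<in> carrier (GL n)" for g
    using G[of g] F(2)[rule_format, OF g] g by (auto simp: carrier_GL)
  moreover have "f \<in> coord_space d" by (simp add: f_def coord_space_def)
  ultimately show ?thesis by (intro bexI[of _ f] ballI)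
qed

end


section \<open>The isotypic component and the orbits of invariants\<close>

section \<open>The isotypic component\<close>

lemma inv_GL_closed: "g \<in> carrier (GL n) \<Longrightarrow> inv\<^bsub>GL n\<^esub> g \<in> carrier (GL n)"
  and inv_GL_inv: "g \<in> carrier (GL n) \<Longrightarrow> inv\<^bsub>GL n\<^esub> (inv\<^bsub>GL n\<^esub> g) = g"
  using group.inv_closed[OF group_GL] group.inv_inv[OF group_GL] by auto

lemma contragredient_inv: "h \<in> carrier (GL n) \<Longrightarrow> contragredient n (inv\<^bsub>GL n\<^esub> h) = transpose_mat h"
  by (simp add: contragredient_def inv_GL_inv)

lemma contragredient_in_GL: "g \<in> carrier (GL n) \<Longrightarrow> contragredient n g \<in> carrier (GL n)"
  by (simp add: contragredient_def transpose_in_GL inv_GL_closed)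

text \<open>Every group element is the contragredient of another one, so stability under the dual
  action can be checked with the standard action.\<close>

lemma is_submodule_dual_iff:
  "is_submodule (carrier (GL n)) (sym_sym_dual_act j m n) M U \<longleftrightarrow>
     U \<subseteq> M \<and> fvs.subspace U \<and> (\<forall>g\<in>carrier (GL n). \<forall>u\<in>U. sym_sym_act j m n g u \<in> U)"
proof -
  have "(\<forall>g\<in>carrier (GL n). \<forall>u\<in>U. sym_sym_act j m n (contragredient n g) u \<in> U)
      \<longleftrightarrow> (\<forall>g\<in>carrier (GL n). \<forall>u\<in>U. sym_sym_act j m n g u \<in> U)" (is "?l \<longleftrightarrow> ?r")
  proof
    assume l: ?l
    show ?r
    proof (intro ballI)
      fix g u assume g: "g \<in> carrier (GL n)" and u: "u \<in> U"
      have "contragredient n (inv\<^bsub>GL n\<^esub> (transpose_mat g)) = g"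
        using g by (simp add: contragredient_inv transpose_in_GL)
      then show "sym_sym_act j m n g u \<in> U"
        using l u inv_GL_closed[OF transpose_in_GL[OF g]] by metis
    qed
  qed (simp add: contragredient_in_GL)
  then show ?thesis by (simp add: is_submodule_def sym_sym_dual_act_def)
qed

text \<open>Transposition exchanges the two sides of the bilinear form, and complex conjugation turns
  that form into a Hermitian one; hence orthogonal projections onto submodules are equivariant.\<close>

lemma orthogonal_projection_levi_fixed:
  assumes U: "fvs.subspace U" "U \<subseteq> supported (idx j m n)"
    and closed: "\<And>h x. h \<in> carrier (GL n) \<Longrightarrow> x \<in> U \<Longrightarrow> sym_sym_act j m n h x \<in> U"
    and u: "u \<in> U" "\<And>w. w \<in> U \<Longrightarrow> bil (idx j m n) (t - u) (cnj_fun w) = 0"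
    and g: "g \<in> carrier (GL n)" and fixed: "sym_sym_act j m n g t = t"
  shows "sym_sym_act j m n g u = u"
proof -
  let ?B = "idx j m n" and ?A = "sym_sym_act j m n"
  define z where "z = ?A g u - u"
  have z: "z \<in> U" unfolding z_def by (intro fvs.subspace_diff U(1) closed g u(1))
  have gT: "transpose_mat g \<in> carrier (GL n)" by (rule transpose_in_GL[OF g])
  have "map_mat cnj (map_mat cnj (transpose_mat g)) = transpose_mat g" by (rule eq_matI) auto
  then have "?A (transpose_mat g) (cnj_fun z) = cnj_fun (?A (map_mat cnj (transpose_mat g)) z)"
    by (simp only: cnj_fun_sym_sym_act)
  moreover have "?A (map_mat cnj (transpose_mat g)) z \<in> U" by (intro closed cnj_in_GL gT z)
  ultimately have "bil ?B (?A g (t - u)) (cnj_fun z) = 0"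
    unfolding bil_sym_sym_act using u(2) by simp
  moreover have "z = (t - u) - ?A g (t - u)"
    unfolding z_def sym_sym_act_diff fixed by simp
  ultimately have "bil ?B z (cnj_fun z) = 0"
    using u(2)[OF z] by (metis bil_diff_left diff_zero)
  then have "z = 0" using bil_positive_definite[OF finite_idx] z U(2) by blast
  then show ?thesis by (simp add: z_def)
qed

definition sym_sym_orbit :: "nat \<Rightarrow> nat \<Rightarrow> nat \<Rightarrow> (nat list list \<Rightarrow> complex) \<Rightarrow> (nat list list \<Rightarrow> complex) set" where
  "sym_sym_orbit j m n t = fvs.span {sym_sym_act j m n g t |g. g \<in> carrier (GL n)}"

lemma sym_sym_orbit_base:
  "g \<in> carrier (GL n) \<Longrightarrow> sym_sym_act j m n g t \<in> sym_sym_orbit j m n t"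
  unfolding sym_sym_orbit_def by (rule fvs.span_base) blast

lemma sym_sym_orbit_minimal:
  assumes "fvs.subspace S" "\<And>g. g \<in> carrier (GL n) \<Longrightarrow> sym_sym_act j m n g t \<in> S"
  shows "sym_sym_orbit j m n t \<subseteq> S"
  unfolding sym_sym_orbit_def by (rule fvs.span_minimal[OF _ assms(1)]) (use assms(2) in auto)

lemma sym_sym_orbit_subspace: "fvs.subspace (sym_sym_orbit j m n t)"
  unfolding sym_sym_orbit_def by (rule fvs.subspace_span)

lemma sym_sym_orbit_subset:
  assumes "t \<in> sym_sym j m n"
  shows "sym_sym_orbit j m n t \<subseteq> sym_sym j m n"
  by (rule sym_sym_orbit_minimal[OF sym_power_subspace])
     (use assms in \<open>simp add: carrier_GL sym_sym_act_closed\<close>)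

lemma sym_sym_act_vimage_subspace:
  "fvs.subspace S \<Longrightarrow> fvs.subspace {x. sym_sym_act j m n h x \<in> S}"
  by (rule fvs.subspaceI)
     (simp_all add: sym_sym_act_zero sym_sym_act_add sym_sym_act_scale fvs.subspace_0
       fvs.subspace_add fvs.subspace_scale)

lemma sym_sym_orbit_closed:
  assumes h: "h \<in> carrier (GL n)" and x: "x \<in> sym_sym_orbit j m n t"
  shows "sym_sym_act j m n h x \<in> sym_sym_orbit j m n t"
proof -
  have "sym_sym_orbit j m n t \<subseteq> {x. sym_sym_act j m n h x \<in> sym_sym_orbit j m n t}"
  proof (rule sym_sym_orbit_minimal[OF sym_sym_act_vimage_subspace[OF sym_sym_orbit_subspace]], rule CollectI)
    fix g assume g: "g \<in> carrier (GL n)"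
    have "sym_sym_act j m n h (sym_sym_act j m n g t) = sym_sym_act j m n (h * g) t"
      using h g by (intro sym_sym_act_mult) (auto simp: carrier_GL)
    then show "sym_sym_act j m n h (sym_sym_act j m n g t) \<in> sym_sym_orbit j m n t"
      using sym_sym_orbit_base[OF mult_in_GL[OF h g]] by simp
  qed
  then show ?thesis using x by auto
qed

lemma cnj_fun_sym_sym_orbit:
  assumes "x \<in> sym_sym_orbit j m n t"
  shows "cnj_fun x \<in> sym_sym_orbit j m n (cnj_fun t)"
proof -
  let ?S = "{x. cnj_fun x \<in> sym_sym_orbit j m n (cnj_fun t)}"
  have "fvs.subspace ?S"
    by (rule fvs.subspaceI)
       (simp_all add: cnj_fun_add cnj_fun_scale fvs.subspace_0[OF sym_sym_orbit_subspace]
         fvs.subspace_add[OF sym_sym_orbit_subspace] fvs.subspace_scale[OF sym_sym_orbit_subspace])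
  then have "sym_sym_orbit j m n t \<subseteq> ?S"
    by (rule sym_sym_orbit_minimal) (simp add: cnj_fun_sym_sym_act sym_sym_orbit_base cnj_in_GL)
  then show ?thesis using assms by auto
qed

context highest_weight_module
begin

text \<open>Parametrising group elements as inverses turns the dual action into a transposed action,
  which is adjoint for \<open>bil\<close>.\<close>

lemma dual_rep_act_inv:
  assumes "h \<in> carrier (GL n)"
  shows "dual_rep_act d \<rho> (inv\<^bsub>GL n\<^esub> h) = vec_act d (transpose_mat (\<rho> h))"
proof -
  interpret group_hom "GL n" "GL d" \<rho>
    using group_GL group_GL rational by (simp add: group_hom_def group_hom_axioms_def rational_rep_def)
  show ?thesis
    using assms by (simp add: dual_rep_act_def contragredient_inv rho_GL)
qed

text \<open>\<open>f\<close> generates the dual module: the vectors killed by all its translates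
  form a submodule that misses \<open>v\<close>, because \<open>f\<close> pairs to 1 with
  \<open>v\<close>; by irreducibility it is zero.\<close>

lemma transpose_orbit_span:
  assumes f: "f \<in> coord_space d"
    "\<And>g. g \<in> carrier (GL n) \<Longrightarrow> bil {..<d} f (R g v) = det (leading_block i g) ^ k"
  shows "fvs.span {vec_act d (transpose_mat (\<rho> g)) f |g. g \<in> carrier (GL n)} = coord_space d"
    (is "fvs.span ?O = _")
  unfolding coord_space_eq_supported
proof (rule subspace_eq_supportedI)
  show "fvs.span ?O \<subseteq> supported {..<d}"
    unfolding coord_space_eq_supported[symmetric]
    by (rule fvs.span_minimal[OF _ coord_space_subspace])
       (auto intro!: vec_act_closed simp: rho_carrier)
  fix z :: "nat \<Rightarrow> complex"
  assume z: "z \<in> supported {..<d}" and ann: "\<And>x. x \<in> fvs.span ?O \<Longrightarrow> bil {..<d} x z = 0"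
  define Z where "Z = {x \<in> coord_space d. \<forall>g\<in>carrier (GL n). bil {..<d} f (R g x) = 0}"
  have "bil {..<d} f (R g z) = 0" if g: "g \<in> carrier (GL n)" for g
  proof -
    have "bil {..<d} (vec_act d (transpose_mat (\<rho> g)) f) z = 0"
      using g by (intro ann fvs.span_base) auto
    then show ?thesis by (simp add: bil_vec_act)
  qed
  then have "z \<in> Z" using z by (simp add: Z_def coord_space_eq_supported)
  moreover have "Z = {0} \<or> Z = coord_space d"
  proof (rule submodule_trivial)
    show "fvs.subspace Z"
      unfolding Z_def
      by (rule fvs.subspaceI)
         (simp_all add: vec_act_zero vec_act_add vec_act_scale bil_simps
           fvs.subspace_0[OF coord_space_subspace] fvs.subspace_add[OF coord_space_subspace]
           fvs.subspace_scale[OF coord_space_subspace])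
    show "R g x \<in> Z" if "g \<in> carrier (GL n)" "x \<in> Z" for g x
      using that by (simp add: Z_def R_closed R_mult mult_in_GL)
  qed (simp add: Z_def)
  moreover have "v \<notin> Z"
  proof
    assume "v \<in> Z"
    then have "det (leading_block i (1\<^sub>m n)) ^ k = 0" using f(2)[OF one_in_GL] one_in_GL by (simp add: Z_def)
    then show False
      using det_leading_block_lower_unipotent[OF lower_unipotent_one i] by simp
  qed
  ultimately show "z = 0" using v(1) by auto
qed simp_all

text \<open>The orbit of a nonzero invariant is matched with the dual module through matrix coefficients:
  \<open>x\<close> corresponds to \<open>y\<close> if pairing \<open>x\<close> with the conjugate orbit and pairing \<open>y\<close> with the orbit of the
  highest weight vector give proportional functions on the group.\<close>

lemma orbit_isomorphic_dual:
  assumes t: "t \<in> SL_invariants i k i" "t \<noteq> 0" and i0: "0 < i"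
  shows "modules_isomorphic (carrier (GL n)) (dual_rep_act d \<rho>) (coord_space d)
    (sym_sym_dual_act i k n) (sym_sym_orbit i k n t)"
proof -
  let ?B = "idx i k n" and ?A = "sym_sym_act i k n" and ?L = "sym_sym_orbit i k n t"
  obtain f where f1: "f \<in> coord_space d"
    and f2: "\<forall>g\<in>carrier (GL n). bil {..<d} f (R g v) = det (leading_block i g) ^ k"
    using lowest_weight_functional by (elim bexE)
  note f = f1 f2[rule_format]
  have t_M: "t \<in> sym_sym i k n"
    using t(1) SL_invariants_sym_sym sym_sym_mono[OF i] by blast
  have L_supp: "?L \<subseteq> supported ?B"
    using sym_sym_orbit_subset[OF t_M] sym_sym_supported by blast
  have t': "cnj_fun t \<in> SL_invariants i k i" by (rule cnj_fun_SL_invariants[OF t(1)])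
  define \<kappa> where "\<kappa> = bil ?B t (cnj_fun t)"
  have \<kappa>: "\<kappa> \<noteq> 0"
    using bil_positive_definite[OF finite_idx, of t] t(2) t_M sym_sym_supported
    unfolding \<kappa>_def by blast
  \<comment> \<open>The isomorphism is built as a linear relation and then shown to be a bijection.
    The factor \<open>\<kappa>\<close> makes \<open>t\<close> correspond to
    \<open>f\<close>.\<close>
  define Q where "Q = (\<lambda>x y. x \<in> ?L \<and>
    (\<forall>h\<in>carrier (GL n). bil ?B x (?A h (cnj_fun t)) = \<kappa> * bil {..<d} y (R h v)))"
  have A_mult: "?A g (?A h x) = ?A (g * h) x" if "g \<in> carrier (GL n)" "h \<in> carrier (GL n)" for g h x
    using that by (intro sym_sym_act_mult) (auto simp: carrier_GL)
  have Q_0: "Q 0 0" by (simp add: Q_def bil_simps fvs.subspace_0[OF sym_sym_orbit_subspace])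
  have Q_add: "Q (x + x') (y + y')" if "Q x y" "Q x' y'" for x x' y y'
    using that by (simp add: Q_def bil_simps fvs.subspace_add[OF sym_sym_orbit_subspace] distrib_left)
  have Q_scale: "Q (fscale c x) (fscale c y)" if "Q x y" for c x y
    using that by (simp add: Q_def bil_simps fvs.subspace_scale[OF sym_sym_orbit_subspace])
  have Q_diff: "Q (x - x') (y - y')" if "Q x y" "Q x' y'" for x x' y y'
    using that by (simp add: Q_def bil_simps fvs.subspace_diff[OF sym_sym_orbit_subspace] right_diff_distrib)
  have Q_base: "Q (?A (transpose_mat g) t) (vec_act d (transpose_mat (\<rho> g)) f)"
    if g: "g \<in> carrier (GL n)" for g
    unfolding Q_def
  proof (intro conjI ballI sym_sym_orbit_base transpose_in_GL g)
    fix h assume h: "h \<in> carrier (GL n)"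
    have "bil ?B (?A (transpose_mat g) t) (?A h (cnj_fun t)) = bil ?B t (?A (g * h) (cnj_fun t))"
      by (simp add: bil_sym_sym_act A_mult[OF g h])
    also have "\<dots> = det (leading_block i (g * h)) ^ k * \<kappa>"
      unfolding \<kappa>_def using mult_in_GL[OF g h]
      by (intro bil_SL_invariants_act[OF t' t(1) _ i0 i]) (simp add: carrier_GL)
    also have "det (leading_block i (g * h)) ^ k = bil {..<d} (vec_act d (transpose_mat (\<rho> g)) f) (R h v)"
      by (simp add: bil_vec_act R_mult[OF g h] f(2)[OF mult_in_GL[OF g h]])
    finally show "bil ?B (?A (transpose_mat g) t) (?A h (cnj_fun t))
        = \<kappa> * bil {..<d} (vec_act d (transpose_mat (\<rho> g)) f) (R h v)" by simp
  qed
  have Q_act: "Q (?A (transpose_mat g) x) (vec_act d (transpose_mat (\<rho> g)) y)"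
    if g: "g \<in> carrier (GL n)" and Q: "Q x y" for g x y
    unfolding Q_def
  proof (intro conjI ballI)
    show "?A (transpose_mat g) x \<in> ?L"
      using Q by (intro sym_sym_orbit_closed transpose_in_GL g) (simp add: Q_def)
    fix h assume h: "h \<in> carrier (GL n)"
    show "bil ?B (?A (transpose_mat g) x) (?A h (cnj_fun t))
        = \<kappa> * bil {..<d} (vec_act d (transpose_mat (\<rho> g)) y) (R h v)"
      using Q mult_in_GL[OF g h] by (simp add: Q_def bil_sym_sym_act A_mult[OF g h] bil_vec_act R_mult[OF g h])
  qed
  \<comment> \<open>Here \<open>x\<close> is orthogonal to the orbit of the conjugate of
    \<open>t\<close>, which contains the conjugate of \<open>x\<close> itself.\<close>
  have Q_zero_left: "x = 0" if "Q x 0" for x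
  proof -
    have x: "x \<in> ?L" using that by (simp add: Q_def)
    have "sym_sym_orbit i k n (cnj_fun t) \<subseteq> {y. \<forall>z\<in>{x}. bil ?B y z = 0}"
      by (rule sym_sym_orbit_minimal[OF bil_annihilator_subspace])
         (use that in \<open>simp add: Q_def bil_simps bil_commute\<close>)
    then have "bil ?B x (cnj_fun x) = 0"
      using cnj_fun_sym_sym_orbit[OF x] by (auto simp: bil_commute)
    then show "x = 0" using bil_positive_definite[OF finite_idx] x L_supp by blast
  qed
  have Q_zero_right: "y = 0" if "Q 0 y" "y \<in> coord_space d" for y
    using that(1) \<kappa> by (intro orbit_separates[OF that(2)]) (simp add: Q_def bil_simps)
  have Q_unique: "x = x'" if "Q x y" "Q x' y" for x x' y
    using Q_zero_left[of "x - x'"] Q_diff[OF that] by simp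
  have Q_inj: "y = y'" if "Q x y" "Q x y'" "y \<in> coord_space d" "y' \<in> coord_space d" for x y y'
    using Q_zero_right[of "y - y'"] Q_diff[OF that(1,2)] fvs.subspace_diff[OF coord_space_subspace that(3,4)]
    by simp
  have "fvs.span {vec_act d (transpose_mat (\<rho> g)) f |g. g \<in> carrier (GL n)} \<subseteq> {y. \<exists>x. Q x y}"
  proof (rule fvs.span_minimal)
    show "{vec_act d (transpose_mat (\<rho> g)) f |g. g \<in> carrier (GL n)} \<subseteq> {y. \<exists>x. Q x y}"
      using Q_base by blast
    show "fvs.subspace {y. \<exists>x. Q x y}"
      using Q_0 Q_add Q_scale by (intro fvs.subspaceI) blast+
  qed
  then have V_Q: "coord_space d \<subseteq> {y. \<exists>x. Q x y}" by (simp only: transpose_orbit_span[OF f])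
  have Q_ex: "\<exists>x. Q x y" if "y \<in> coord_space d" for y
    using subsetD[OF V_Q that] by simp
  have L_Q: "?L \<subseteq> {x. \<exists>y\<in>coord_space d. Q x y}"
  proof (rule sym_sym_orbit_minimal)
    show "fvs.subspace {x. \<exists>y\<in>coord_space d. Q x y}"
    proof (rule fvs.subspaceI)
      show "0 \<in> {x. \<exists>y\<in>coord_space d. Q x y}"
        using Q_0 fvs.subspace_0[OF coord_space_subspace] by auto
      show "x + x' \<in> {x. \<exists>y\<in>coord_space d. Q x y}"
        if "x \<in> {x. \<exists>y\<in>coord_space d. Q x y}" "x' \<in> {x. \<exists>y\<in>coord_space d. Q x y}" for x x'
        using that Q_add fvs.subspace_add[OF coord_space_subspace] by blast
      show "fscale c x \<in> {x. \<exists>y\<in>coord_space d. Q x y}"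
        if "x \<in> {x. \<exists>y\<in>coord_space d. Q x y}" for c x
        using that Q_scale fvs.subspace_scale[OF coord_space_subspace] by blast
    qed
    fix g assume g: "g \<in> carrier (GL n)"
    have "vec_act d (transpose_mat (\<rho> (transpose_mat g))) f \<in> coord_space d"
      using rho_carrier[OF transpose_in_GL[OF g]] by (intro vec_act_closed) simp
    then show "?A g t \<in> {x. \<exists>y\<in>coord_space d. Q x y}"
      using Q_base[OF transpose_in_GL[OF g]] by auto
  qed
  have Q_surj: "\<exists>y\<in>coord_space d. Q x y" if "x \<in> ?L" for x
    using subsetD[OF L_Q that] by simp
  define T where "T = (\<lambda>y. THE x. Q x y)"
  have T: "T y = x" if "Q x y" for x y
    unfolding T_def by (rule the_equality[where P = "\<lambda>x. Q x y", OF that Q_unique[OF _ that]])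
  have Q_T: "Q (T y) y" if y: "y \<in> coord_space d" for y
  proof -
    obtain x where "Q x y" using Q_ex[OF y] by blast
    then show ?thesis by (simp only: T)
  qed
  have "linear_map_on (coord_space d) T"
    unfolding linear_map_on_def by (intro conjI ballI allI T Q_add Q_scale Q_T)
  moreover have "bij_betw T (coord_space d) ?L"
    unfolding bij_betw_def
  proof
    show "inj_on T (coord_space d)"
    proof (rule inj_onI)
      fix y y' assume *: "y \<in> coord_space d" "y' \<in> coord_space d" "T y = T y'"
      then show "y = y'" using Q_inj[of "T y" y y'] Q_T[of y] Q_T[of y'] by simp
    qed
    show "T ` coord_space d = ?L"
    proof
      show "T ` coord_space d \<subseteq> ?L" using Q_T by (auto simp: Q_def)
      show "?L \<subseteq> T ` coord_space d" using Q_surj T by blast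
    qed
  qed
  moreover have "T (dual_rep_act d \<rho> g y) = sym_sym_dual_act i k n g (T y)"
    if g: "g \<in> carrier (GL n)" and y: "y \<in> coord_space d" for g y
  proof -
    define h where "h = inv\<^bsub>GL n\<^esub> g"
    have h: "h \<in> carrier (GL n)" "g = inv\<^bsub>GL n\<^esub> h"
      using g by (simp_all add: h_def inv_GL_closed inv_GL_inv)
    show ?thesis
      unfolding h(2) dual_rep_act_inv[OF h(1)] sym_sym_dual_act_def contragredient_inv[OF h(1)]
      by (intro T Q_act h Q_T y)
  qed
  ultimately show ?thesis unfolding modules_isomorphic_def by blast
qed

text \<open>The invariant is the image of \<open>f\<close>. The matrix coefficient of
  \<open>f\<close> depends only on a leading minor, which transposed \<open>levi\<close> matrices
  with unimodular first block leave unchanged; so \<open>f\<close> and its image are fixed. The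
  image generates \<open>L\<close> because \<open>f\<close> generates the dual module.\<close>

lemma dual_submodule_generated_by_invariant:
  assumes L: "is_submodule (carrier (GL n)) (sym_sym_dual_act i k n) (sym_sym i k n) L"
    and iso: "modules_isomorphic (carrier (GL n)) (dual_rep_act d \<rho>) (coord_space d) (sym_sym_dual_act i k n) L"
  obtains w where "w \<in> SL_invariants i k i" "L \<subseteq> sym_sym_orbit i k n w"
proof -
  let ?A = "sym_sym_act i k n"
  obtain f where f1: "f \<in> coord_space d"
    and f2: "\<forall>g\<in>carrier (GL n). bil {..<d} f (R g v) = det (leading_block i g) ^ k"
    using lowest_weight_functional by (elim bexE)
  note f = f1 f2[rule_format]
  obtain T where T: "linear_map_on (coord_space d) T" "bij_betw T (coord_space d) L"
    "\<forall>g\<in>carrier (GL n). \<forall>y\<in>coord_space d. T (dual_rep_act d \<rho> g y) = sym_sym_dual_act i k n g (T y)"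
    using iso unfolding modules_isomorphic_def by (elim exE conjE)
  have equiv: "T (vec_act d (transpose_mat (\<rho> h)) y) = ?A (transpose_mat h) (T y)"
    if "h \<in> carrier (GL n)" "y \<in> coord_space d" for h y
    using T(3)[rule_format, OF inv_GL_closed[OF that(1)] that(2)]
    by (simp only: dual_rep_act_inv[OF that(1)] sym_sym_dual_act_def contragredient_inv[OF that(1)])
  define w where "w = T f"
  have "w \<in> L" using T(2) f(1) by (auto simp: w_def bij_betw_def)
  then have w: "w \<in> sym_sym i k n" using L by (auto simp: is_submodule_def)
  have "w \<in> SL_invariants i k i"
  proof (rule levi_fixed_imp_SL_invariants[OF w i])
    fix S c assume S: "S \<in> SL i" and c: "c \<noteq> (0 :: complex)"
    have S': "S \<in> carrier_mat i i" using S by (simp add: SL_def)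
    \<comment> \<open>Transposed because the isomorphism intertwines
      \<open>transpose_mat (\<rho> b)\<close> with the action of \<open>transpose_mat b\<close>,
      which is then the desired Levi element.\<close>
    define b where "b = transpose_mat (levi i n S c)"
    have b: "b \<in> carrier (GL n)" unfolding b_def by (intro transpose_in_GL levi_in_GL S i c)
    have b_block: "leading_block i b = transpose_mat S"
      using S' i levi_carrier[OF S' i, of c]
      by (intro eq_matI) (auto simp: b_def leading_block_def levi_index)
    have bT: "transpose_mat b = levi i n S c" by (simp add: b_def)
    have "vec_act d (transpose_mat (\<rho> b)) f - f = 0"
    proof (rule orbit_separates)
      show "vec_act d (transpose_mat (\<rho> b)) f - f \<in> coord_space d"
        using rho_carrier[OF b] f(1)
        by (intro fvs.subspace_diff[OF coord_space_subspace] vec_act_closed) auto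
      fix h assume h: "h \<in> carrier (GL n)"
      have "leading_block i (b * h) = leading_block i b * leading_block i h"
        using b h i levi_carrier[OF S' i, of c]
        by (intro leading_block_mult_lower) (auto simp: carrier_GL b_def levi_index[OF S' i])
      then have "det (leading_block i (b * h)) = det (leading_block i h)"
        using S S' by (simp add: b_block det_mult[of _ i] det_transpose SL_def)
      then show "bil {..<d} (vec_act d (transpose_mat (\<rho> b)) f - f) (R h v) = 0"
        using h mult_in_GL[OF b h] by (simp add: bil_diff_left bil_vec_act R_mult[OF b h] f(2))
    qed
    then have "vec_act d (transpose_mat (\<rho> b)) f = f" by simp
    then show "?A (levi i n S c) w = w"
      using equiv[OF b f(1)] by (simp only: bT w_def)
  qed
  moreover have "L \<subseteq> sym_sym_orbit i k n w"
  proof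
    fix x assume "x \<in> L"
    then obtain y where y: "y \<in> coord_space d" "x = T y" using T(2) by (auto simp: bij_betw_def)
    let ?S = "{y \<in> coord_space d. T y \<in> sym_sym_orbit i k n w}"
    have add: "T (y + y') = T y + T y'" if "y \<in> coord_space d" "y' \<in> coord_space d" for y y'
      using T(1) that by (simp only: linear_map_on_def)
    have scale: "T (fscale c y) = fscale c (T y)" if "y \<in> coord_space d" for c y
      using T(1) that by (simp only: linear_map_on_def)
    have zero: "0 \<in> coord_space d" by (rule fvs.subspace_0[OF coord_space_subspace])
    have "T 0 = 0" using scale[OF zero, of 0] by simp
    have "fvs.span {vec_act d (transpose_mat (\<rho> g)) f |g. g \<in> carrier (GL n)} \<subseteq> ?S"
    proof (rule fvs.span_minimal)
      show "fvs.subspace ?S"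
      proof (rule fvs.subspaceI)
        show "0 \<in> ?S" using zero \<open>T 0 = 0\<close> by (simp add: fvs.subspace_0[OF sym_sym_orbit_subspace])
        show "y + y' \<in> ?S" if "y \<in> ?S" "y' \<in> ?S" for y y'
          using that by (simp add: add fvs.subspace_add[OF coord_space_subspace]
              fvs.subspace_add[OF sym_sym_orbit_subspace])
        show "fscale c y \<in> ?S" if "y \<in> ?S" for c y
          using that by (simp add: scale fvs.subspace_scale[OF coord_space_subspace]
              fvs.subspace_scale[OF sym_sym_orbit_subspace])
      qed
      show "{vec_act d (transpose_mat (\<rho> g)) f |g. g \<in> carrier (GL n)} \<subseteq> ?S"
      proof clarify
        fix g assume g: "g \<in> carrier (GL n)"
        then have "vec_act d (transpose_mat (\<rho> g)) f \<in> coord_space d"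
          using rho_carrier[OF g] by (intro vec_act_closed) simp
        then show "vec_act d (transpose_mat (\<rho> g)) f \<in> coord_space d
            \<and> T (vec_act d (transpose_mat (\<rho> g)) f) \<in> sym_sym_orbit i k n w"
          by (simp add: equiv[OF g f(1)] sym_sym_orbit_base transpose_in_GL g flip: w_def)
      qed
    qed
    then have "coord_space d \<subseteq> ?S" by (simp only: transpose_orbit_span[OF f])
    then show "x \<in> sym_sym_orbit i k n w" using y by auto
  qed
  ultimately show ?thesis using that by blast
qed

end


section \<open>Vanishing of phi as orthogonality, and the equivalence\<close>

section \<open>The main equivalence\<close>

lemma is_irreducible_rep_highest_weight:
  assumes V: "is_irreducible_rep n (replicate i k) d \<rho>" and i: "i \<le> n"
  shows "\<exists>v. highest_weight_module n i k d \<rho> v"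
proof -
  have rep: "rational_rep n d \<rho>"
    "irreducible_module (carrier (GL n)) (\<lambda>g. vec_act d (\<rho> g)) (coord_space d)"
    and "has_highest_weight n d \<rho> (replicate i k)"
    using V by (simp_all add: is_irreducible_rep_def)
  then obtain v where v: "v \<in> coord_space d" "v \<noteq> 0"
    "\<forall>b\<in>carrier (GL n). upper_triangular b \<longrightarrow>
       vec_act d (\<rho> b) v = fscale (\<Prod>j<n. b $$ (j, j) ^ partition_part (replicate i k) j) v"
    unfolding has_highest_weight_def by (elim bexE conjE)
  have weight: "(\<Prod>j<n. b $$ (j, j) ^ partition_part (replicate i k) j) = (\<Prod>j<i. b $$ (j, j)) ^ k"
    for b :: "complex mat"
  proof -
    have "(\<Prod>j<n. b $$ (j, j) ^ partition_part (replicate i k) j)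
        = (\<Prod>j<i. b $$ (j, j) ^ partition_part (replicate i k) j)"
      using i by (intro prod.mono_neutral_right) (auto simp: partition_part_def)
    also have "\<dots> = (\<Prod>j<i. b $$ (j, j) ^ k)"
      by (intro prod.cong refl) (simp add: partition_part_def)
    finally show ?thesis by (simp only: prod_power_distrib)
  qed
  have "highest_weight_module n i k d \<rho> v"
    by unfold_locales (use i rep v in \<open>simp_all add: weight\<close>)
  then show ?thesis by (rule exI[where x = v])
qed

text \<open>\<open>t\<close> involves only the first \<open>i\<close> coordinates, so the remaining
  columns of \<open>Y\<close> are arbitrary. This moves phi from rectangular matrices to the action
  on S^j(S^m(C^m)).\<close>

lemma phi_eq_bil_act:
  assumes phi: "is_phi m i \<phi>" and t: "t \<in> sym_sym j m i" and i: "i \<le> m"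
    and X: "X \<in> carrier_mat m i" and Y: "Y \<in> carrier_mat m m"
    and XY: "\<And>p q. p < m \<Longrightarrow> q < i \<Longrightarrow> X $$ (p, q) = Y $$ (p, q)"
  shows "\<phi> t X = bil (idx j m m) (tensor (replicate j (v_o m))) (sym_sym_act j m m Y t)"
proof -
  have "kernel_map (idx j m m) (mat_kernel2 Y) t L = kernel_map (idx j m i) (mat_kernel2 X) t L" for L
  proof (rule kernel_map_restrict[OF finite_idx idx_mono[OF i] subsetD[OF sym_sym_supported t]])
    fix L' assume L': "L' \<in> idx j m i"
    show "mat_kernel2 Y L L' = mat_kernel2 X L L'"
      using X Y i
      by (intro tensor_kernel_cong_right[OF _ L'] tensor_kernel_cong_right[of "{..<i}" _ _ _ m])
         (auto simp: mat_kernel_def XY)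
  qed
  then have "kernel_map (idx j m m) (mat_kernel2 Y) t = kernel_map (idx j m i) (mat_kernel2 X) t" ..
  then show ?thesis by (simp only: phi_eq_bil[OF phi t X] sym_sym_act_def)
qed

text \<open>The first \<open>i\<close> columns of a group element give one direction; the other
  needs density, since a padded rectangular matrix can be singular.\<close>

lemma phi_vanishes_iff:
  assumes phi: "is_phi m i \<phi>" and t: "t \<in> sym_sym j m i" and i: "i \<le> m"
  shows "\<phi> t = 0 \<longleftrightarrow>
    (\<forall>g\<in>carrier (GL m). bil (idx j m m) (tensor (replicate j (v_o m))) (sym_sym_act j m m g t) = 0)"
    (is "_ \<longleftrightarrow> (\<forall>g\<in>_. ?F g = 0)")
proof
  assume 0: "\<phi> t = 0"
  show "\<forall>g\<in>carrier (GL m). ?F g = 0"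
  proof
    fix g assume "g \<in> carrier (GL m)"
    then have "\<phi> t (mat m i (\<lambda>(p, q). g $$ (p, q))) = ?F g"
      using i by (intro phi_eq_bil_act[OF phi t i]) (auto simp: carrier_GL)
    then show "?F g = 0" by (simp add: 0)
  qed
next
  assume 0: "\<forall>g\<in>carrier (GL m). ?F g = 0"
  show "\<phi> t = 0"
  proof
    fix X
    show "\<phi> t X = 0 X"
    proof (cases "X \<in> carrier_mat m i")
      case True
      define Y where "Y = mat m m (\<lambda>(p, q). if q < i then X $$ (p, q) else 0)"
      have Y: "Y \<in> carrier_mat m m" by (simp add: Y_def)
      have "?F Y = 0"
      proof (rule poly_along_dense[where f = ?F and P = det and A = "1\<^sub>m m" and n = m])
        show "poly_along m ?F"
          unfolding bil_def
          by (intro poly_along_sum poly_along_mult[OF poly_along_const] poly_along_sym_sym_act)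
        show "poly_along m det" by (rule poly_along_det)
        show "?F Z = 0" if "Z \<in> carrier_mat m m" "det Z \<noteq> 0" for Z
          using 0 that by (simp add: carrier_GL)
      qed (simp_all add: Y)
      moreover have "\<phi> t X = ?F Y"
        using i by (intro phi_eq_bil_act[OF phi t i True Y]) (simp add: Y_def)
      ultimately show ?thesis by simp
    next
      case False
      then show ?thesis using phi_eq_0_outside[OF phi t] by simp
    qed
  qed
qed

theorem proposition3p2:
  fixes m i d :: nat
    and \<phi> :: "(nat list list \<Rightarrow> complex) \<Rightarrow> complex mat \<Rightarrow> complex"
    and \<rho> :: "complex mat \<Rightarrow> complex mat"
  assumes "0 < m" and "even m" and "1 \<le> i" and "i \<le> m"
    and phi: "is_phi m i \<phi>"
    and V: "is_irreducible_rep m (replicate i m) d \<rho>"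
  shows "(\<exists>t\<in>SL_invariants i m i. \<phi> t \<noteq> 0) \<longleftrightarrow>
    (let G = carrier (GL m);
         act = sym_sym_dual_act i m m;
         M = sym_power i (sym_power m (coord_space m));
         U = (is_submodule G act M) hull {tensor (replicate i (v_o m))};
         I = isotypic_component G act M (dual_rep_act d \<rho>) (coord_space d)
     in U \<inter> I \<noteq> {0})"
proof -
  let ?A = "sym_sym_act i m m" and ?B = "idx i m m" and ?H = "SL_invariants i m i"
  define G where "G = carrier (GL m)"
  define act where "act = sym_sym_dual_act i m m"
  define M where "M = sym_sym i m m"
  define vo where "vo = tensor (replicate i (v_o m))"
  define U where "U = (is_submodule G act M) hull {vo}"
  define I where "I = isotypic_component G act M (dual_rep_act d \<rho>) (coord_space d)"
  note i = \<open>i \<le> m\<close>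
  have i0: "0 < i" using \<open>1 \<le> i\<close> by simp
  obtain v where "highest_weight_module m i m d \<rho> v"
    using is_irreducible_rep_highest_weight[OF V i] by (elim exE)
  then interpret highest_weight_module m i m d \<rho> v .
  have sub_iff: "is_submodule G act M S \<longleftrightarrow>
      S \<subseteq> M \<and> fvs.subspace S \<and> (\<forall>g\<in>G. \<forall>u\<in>S. ?A g u \<in> S)" for S
    unfolding G_def act_def by (rule is_submodule_dual_iff)
  have M_supp: "M \<subseteq> supported ?B" unfolding M_def by (rule sym_sym_supported)
  have M_sub: "fvs.subspace M" unfolding M_def by (rule sym_power_subspace)
  have M_closed: "?A g x \<in> M" if "g \<in> G" "x \<in> M" for g x
    using that by (simp add: M_def G_def carrier_GL sym_sym_act_closed)
  have A_mult: "?A g (?A h x) = ?A (g * h) x" if "g \<in> G" "h \<in> G" for g h x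
    using that by (intro sym_sym_act_mult) (auto simp: G_def carrier_GL)
  have H_i: "t \<in> sym_sym i m i" if "t \<in> ?H" for t using that SL_invariants_sym_sym by blast
  have H_M: "t \<in> M" if "t \<in> ?H" for t
    using H_i[OF that] sym_sym_mono[OF i] unfolding M_def by blast
  have vo_M: "vo \<in> M" unfolding vo_def M_def by (intro tensor_replicate_in_sym_power v_o_in_sym_power)
  have vo_U: "vo \<in> U" unfolding U_def by (simp add: hull_inc)
  have U_min: "U \<subseteq> S" if "is_submodule G act M S" "vo \<in> S" for S
    unfolding U_def using that by (intro hull_minimal) auto
  have U: "U \<subseteq> M" "fvs.subspace U" "\<And>g u. g \<in> G \<Longrightarrow> u \<in> U \<Longrightarrow> ?A g u \<in> U"
  proof -
    show "U \<subseteq> M" by (rule U_min) (use M_sub M_closed vo_M in \<open>auto simp: sub_iff\<close>)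
    show "fvs.subspace U"
      unfolding U_def hull_def by (rule fvs.subspace_Inter) (simp add: sub_iff)
    show "?A g u \<in> U" if "g \<in> G" "u \<in> U" for g u
      using that unfolding U_def hull_def by (auto simp: sub_iff)
  qed
  \<comment> \<open>With \<open>I_min\<close> below, this identifies the isotypic component with the
    span of the orbits of invariants.\<close>
  have orbit_I: "t \<in> I" if t: "t \<in> ?H" "t \<noteq> 0" for t
  proof -
    have t_M: "t \<in> sym_sym i m m" using H_M[OF t(1)] by (simp add: M_def)
    have "is_submodule G act M (sym_sym_orbit i m m t)"
      unfolding sub_iff using sym_sym_orbit_subset[OF t_M] sym_sym_orbit_subspace sym_sym_orbit_closed
      by (auto simp: M_def G_def)
    moreover have "modules_isomorphic G (dual_rep_act d \<rho>) (coord_space d) act (sym_sym_orbit i m m t)"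
      unfolding G_def act_def by (rule orbit_isomorphic_dual[OF t i0])
    moreover have "t \<in> sym_sym_orbit i m m t"
      using sym_sym_orbit_base[OF one_in_GL, of i m m t]
      by (simp only: sym_sym_act_one[OF subsetD[OF sym_sym_supported t_M]])
    ultimately show ?thesis
      unfolding I_def isotypic_component_def by (intro fvs.span_base) blast
  qed
  have I_sub: "fvs.subspace I" unfolding I_def isotypic_component_def by (rule fvs.subspace_span)
  \<comment> \<open>Each copy of the dual module lies in the orbit span of one invariant, so
    inclusions of the isotypic component reduce to orbits.\<close>
  have I_min: "I \<subseteq> S" if "fvs.subspace S" "\<And>w. w \<in> ?H \<Longrightarrow> sym_sym_orbit i m m w \<subseteq> S" for S
    unfolding I_def isotypic_component_def
  proof (rule fvs.span_minimal[OF _ that(1)], rule Union_least)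
    fix L assume "L \<in> {L. is_submodule G act M L \<and> modules_isomorphic G (dual_rep_act d \<rho>) (coord_space d) act L}"
    then have L: "is_submodule (carrier (GL m)) (sym_sym_dual_act i m m) (sym_sym i m m) L"
      "modules_isomorphic (carrier (GL m)) (dual_rep_act d \<rho>) (coord_space d) (sym_sym_dual_act i m m) L"
      by (simp_all add: G_def act_def M_def)
    obtain w where "w \<in> ?H" "L \<subseteq> sym_sym_orbit i m m w"
      using dual_submodule_generated_by_invariant[OF L] by blast
    then show "L \<subseteq> S" using that(2) by blast
  qed
  have "(\<exists>t\<in>?H. \<phi> t \<noteq> 0) \<longleftrightarrow> U \<inter> I \<noteq> {0}"
  proof
    assume "\<exists>t\<in>?H. \<phi> t \<noteq> 0"
    then obtain t where t: "t \<in> ?H" "\<phi> t \<noteq> 0" by blast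
    then obtain g where g: "g \<in> G" "bil ?B vo (?A g t) \<noteq> 0"
      using phi_vanishes_iff[OF phi H_i[OF t(1)] i] unfolding vo_def G_def by blast
    have gT: "transpose_mat g \<in> G" using g(1) by (simp add: G_def transpose_in_GL)
    \<comment> \<open>The conjugate of \<open>t\<close> is projected because bilinear
      non-orthogonality of \<open>t\<close> to \<open>U\<close> is Hermitian non-orthogonality of
      its conjugate.\<close>
    obtain u where u: "u \<in> U" "\<And>w. w \<in> U \<Longrightarrow> bil ?B (cnj_fun t - u) (cnj_fun w) = 0"
      using orthogonal_projection[OF finite_idx U(2), of i m m "cnj_fun t"] U(1) M_supp by blast
    have "u \<noteq> 0"
    proof
      assume "u = 0"
      then have "bil ?B (cnj_fun t) (cnj_fun (?A (transpose_mat g) vo)) = 0"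
        using u(2)[OF U(3)[OF gT vo_U]] by simp
      then have "bil ?B t (?A (transpose_mat g) vo) = 0" by (simp flip: cnj_bil)
      then show False using g(2) by (simp add: bil_commute[of _ t] bil_sym_sym_act)
    qed
    \<comment> \<open>Equivariance of the projection transfers the Levi-invariance of the conjugate
      of \<open>t\<close> to \<open>u\<close>.\<close>
    moreover have "u \<in> ?H"
    proof (rule levi_fixed_imp_SL_invariants[OF _ i])
      show "u \<in> sym_sym i m m" using u(1) U(1) by (auto simp: M_def)
      fix S c assume S: "S \<in> SL i" and c: "c \<noteq> (0 :: complex)"
      show "?A (levi i m S c) u = u"
      proof (rule orthogonal_projection_levi_fixed[OF U(2) _ _ u levi_in_GL[OF S i c]])
        show "U \<subseteq> supported ?B" using U(1) M_supp by blast
        show "?A (levi i m S c) (cnj_fun t) = cnj_fun t"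
          by (rule SL_invariants_levi[OF cnj_fun_SL_invariants[OF t(1)] S i])
      qed (use U(3) in \<open>simp add: G_def\<close>)
    qed
    ultimately show "U \<inter> I \<noteq> {0}" using orbit_I u(1) by blast
  next
    assume UI: "U \<inter> I \<noteq> {0}"
    show "\<exists>t\<in>?H. \<phi> t \<noteq> 0"
    proof (rule ccontr)
      assume "\<not> (\<exists>t\<in>?H. \<phi> t \<noteq> 0)"
      then have vanish: "bil ?B vo (?A g t) = 0" if "t \<in> ?H" "g \<in> G" for t g
        using phi_vanishes_iff[OF phi H_i[OF that(1)] i] that unfolding vo_def G_def by blast
      \<comment> \<open>The annihilator of all orbits of invariants. It is a submodule containing
        \<open>vo\<close>, hence contains the submodule generated by \<open>vo\<close>.\<close>
      define P where "P = {x \<in> M. \<forall>t\<in>?H. \<forall>g\<in>G. bil ?B x (?A g t) = 0}"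
      have "U \<subseteq> P"
      proof (rule U_min)
        have "fvs.subspace P"
          unfolding P_def
          by (rule fvs.subspaceI)
             (simp_all add: bil_simps fvs.subspace_0[OF M_sub] fvs.subspace_add[OF M_sub]
               fvs.subspace_scale[OF M_sub])
        moreover have "?A h x \<in> P" if "h \<in> G" "x \<in> P" for h x
        proof -
          have hT: "transpose_mat h \<in> G" using that by (simp add: G_def transpose_in_GL)
          have "transpose_mat h * g \<in> G" if "g \<in> G" for g
            using hT that by (simp add: G_def mult_in_GL)
          then show ?thesis
            using that by (simp add: P_def M_closed bil_sym_sym_act A_mult[OF hT])
        qed
        ultimately show "is_submodule G act M P" by (auto simp: sub_iff P_def)
        show "vo \<in> P" using vanish vo_M by (simp add: P_def)
      qed
      have "u = 0" if u: "u \<in> U" "u \<in> I" for u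
      proof -
        \<comment> \<open>Conjugation carries the orbit span of an invariant to that of the
          conjugate invariant, which \<open>u\<close> annihilates. Applied to \<open>u\<close>
          itself this gives norm zero.\<close>
        have "I \<subseteq> {y. cnj_fun y \<in> {z. \<forall>x\<in>{u}. bil ?B z x = 0}}"
        proof (rule I_min)
          show "fvs.subspace {y. cnj_fun y \<in> {z. \<forall>x\<in>{u}. bil ?B z x = 0}}"
            by (rule fvs.subspaceI) (simp_all add: cnj_fun_add cnj_fun_scale bil_simps)
          fix w assume w: "w \<in> ?H"
          have "sym_sym_orbit i m m (cnj_fun w) \<subseteq> {z. \<forall>x\<in>{u}. bil ?B z x = 0}"
          proof (rule sym_sym_orbit_minimal[OF bil_annihilator_subspace], clarify)
            fix g assume "g \<in> carrier (GL m)"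
            then show "bil ?B (?A g (cnj_fun w)) u = 0"
              using u(1) \<open>U \<subseteq> P\<close> cnj_fun_SL_invariants[OF w]
              unfolding bil_commute[of _ _ u] by (auto simp: P_def G_def)
          qed
          then show "sym_sym_orbit i m m w \<subseteq> {y. cnj_fun y \<in> {z. \<forall>x\<in>{u}. bil ?B z x = 0}}"
            using cnj_fun_sym_sym_orbit by blast
        qed
        then have "bil ?B (cnj_fun u) u = 0" using u(2) by auto
        then show "u = 0"
          using bil_positive_definite[OF finite_idx, of u] u(1) U(1) M_supp
          by (auto simp: bil_commute)
      qed
      moreover have "0 \<in> U \<inter> I" using fvs.subspace_0[OF U(2)] fvs.subspace_0[OF I_sub] by simp
      ultimately show False using UI by blast
    qed
  qed
  then show ?thesis
    unfolding Let_def U_def I_def G_def act_def M_def vo_def .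
qed

end
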